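(* Let $\chi\in(0,1)$ and let $d,m$ be positive integers. Let $\{\Xi_l\}_{l\in\mathbb Z}$ be i.i.d. zero-mean random vectors in $\mathbb R^m$ such that $$\sup_{t\ge0}t^\alpha P(|\Xi_1|^2>t)<\infty\quad\text{for some }\alpha\in(1,2),$$ and let $(C_l)_{l\in\mathbb Z}$ be matrices in $\mathbb R^{(d+1)\times m}$ such that $$\sup_{l\in\mathbb Z}|l|^\sigma\|C_l\|<\infty\quad\text{for some }\sigma\in\left(\tfrac12,1\right].$$ Let the $\mathbb R^d$-valued variables $x_k$ and $\mathbb R$-valued variables $y_{k+1}$ be given by $$(x_k^T,y_{k+1})^T=\sum_{l=-\infty}^\infty C_{k-l}\Xi_l,$$ and set $A_k=x_kx_k^T$, $b_k=y_{k+1}x_k$, $A=E[x_kx_k^T]$ and $b=E[y_{k+1}x_k]$ (which do not depend on $k$). Assume $A$ is positive definite and put $h=A^{-1}b$. Let $\{\bar h_k\}_{k=1}^\infty$ be an $\mathbb R^d$-valued sequence satisfying $$\bar h_{k+1}=\bar h_k+\frac1{k^\chi}\left(b_k-A_k\bar h_k\right)\qquad\text{for all }k=1,2,\dots$$ Then, for any $\gamma\ge0$ with $$\gamma<\gamma_0^{(\chi)}:=\left(\chi-\tfrac1\alpha\right)\wedge\left(\chi+2\sigma-2\right),$$ one has $|\bar h_n-h|=o(n^{-\gamma})$ as $n\to\infty$ almost surely.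
   Context: $|x|$ denotes the Euclidean norm of a vector $x$, $\|C\|=\sup_{|x|=1}|Cx|$ is the operator norm of a matrix $C$, and $a\wedge b=\min\{a,b\}$. *)

theory Defs
  imports "HOL-Probability.Probability" "HOL-Library.Landau_Symbols"
begin

(* Convergence of \<Sum>l=-\<infinity>..\<infinity> f l to s, where the lower and the upper limit
   of summation tend to infinity independently of each other. *)
definition has_bilateral_sum :: "(int \<Rightarrow> 'a::real_normed_vector) \<Rightarrow> 'a \<Rightarrow> bool" where
  "has_bilateral_sum f s \<longleftrightarrow>
     ((\<lambda>(p, q). \<Sum>l = - int p..int q. f l) \<longlongrightarrow> s) (sequentially \<times>\<^sub>F sequentially)"

(* The vector (x^T, y)^T of dimension CARD('d) + 1: the index type 'd + 1 is the disjoint sum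
   of 'd and the one-element type. *)
definition stack :: "real ^ 'd \<Rightarrow> real \<Rightarrow> real ^ ('d + 1)" where
  "stack x y = (\<chi> i. case i of Inl j \<Rightarrow> x $ j | Inr _ \<Rightarrow> y)"

(* x y^T *)
definition outer_prod :: "real ^ 'm \<Rightarrow> real ^ 'n \<Rightarrow> real ^ 'n ^ 'm" where
  "outer_prod x y = (\<chi> i j. x $ i * y $ j)"

definition positive_definite :: "real ^ 'n ^ 'n \<Rightarrow> bool" where
  "positive_definite A \<longleftrightarrow> transpose A = A \<and> (\<forall>v. v \<noteq> 0 \<longrightarrow> v \<bullet> (A *v v) > 0)"

end

theory Submission
  imports Defs
begin

text \<open>
  Stack \<open>X\<^sub>k = (x\<^sub>k, y\<^sub>k\<^sub>+\<^sub>1)\<close> and fix \<open>\<beta>\<close> with \<open>max (1/\<alpha>) (2 - 2\<sigma>) < \<beta> < \<chi> - \<gamma>\<close>. It suffices that the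
  partial sums of \<open>X\<^sub>k X\<^sub>k\<^sup>T - E X\<^sub>k X\<^sub>k\<^sup>T\<close> are almost surely \<open>O(n\<^sup>\<beta>)\<close>: a deterministic summation by parts
  followed by a comparison argument then gives \<open>\<bar>h\<^sub>n - h\<bar> = O(n\<^sup>\<beta>\<^sup>-\<^sup>\<chi>)\<close>.

  By polarisation one may replace \<open>X\<^sub>k\<close> by a scalar linear process \<open>\<Sum>\<^sub>l g\<^sub>k\<^sub>-\<^sub>l \<bullet> \<Xi>\<^sub>l\<close>. In its square, truncated
  to finitely many \<open>l\<close>, the diagonal terms are independent with heavy tails but summable coefficients,
  so their block sums of length \<open>m\<close> have \<open>p\<close>-th moment \<open>O(m)\<close> for \<open>1 < p < \<alpha>\<close> by a von Bahr--Esseen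
  inequality; the off-diagonal terms are orthogonal and long-range dependent, and their block sums have
  second moment \<open>O(m\<^sup>2\<^sup>\<beta>)\<close>. Fatou's lemma removes the truncation, and dyadic chaining turns the
  moment bounds into an almost sure bound.
\<close>

section \<open>Deterministic recursions\<close>

text \<open>Since \<alpha> < 2, the squares of the innovations may have infinite variance, so no
  second-moment argument can treat the whole quadratic form. Off the diagonal, however, only
  products of distinct, independent innovations occur, and their second moments need nothing beyond
  the second moments of the factors. This is the origin of the two thresholds: 1/\<alpha> is what
  p-th moments of the diagonal permit as p tends to \<alpha>, and 2 - 2\<sigma> comes from
  autocovariances of order |k|^(1 - 2\<sigma>), whose squares sum over an m by m block to m^(2(2 -
  2\<sigma>)), up to terms of order m and logarithms. The terms of order m would give the exponent
  1/2, which is below 1/\<alpha>. In the recursion the obstacle is that |A_k| is unbounded: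
  k^(\<beta> - chi) |A_k| need not become small, so the error terms cannot be compared with the
  contraction one step at a time. Only averages of |A_k| are controlled, and these reduce to the
  same products of coordinates. All moment bounds are uniform in the truncation, hence almost sure
  convergence of the series is the only convergence used.\<close>

lemma powr_decrement_mult_le:
  fixes \<beta> \<kappa> :: real and k :: nat
  assumes "0 < \<beta>" "\<beta> < \<kappa>" "\<kappa> < 1" "2 \<le> k"
  shows "0 \<le> real (k - 1) powr (-\<kappa>) - real k powr (-\<kappa>)" (is "0 \<le> ?d")
    and "(real (k - 1) powr (-\<kappa>) - real k powr (-\<kappa>)) * real (k - 1) powr \<beta>
           \<le> 4 * (real k powr (-\<kappa>) * real k powr (\<beta> - \<kappa>))"
proof -
  define m where "m = real (k - 1)"
  have m: "m \<ge> 1" "real k = m + 1" "m \<ge> (m + 1) / 2" using assms by (auto simp: m_def)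
  show "0 \<le> ?d" using m assms unfolding m_def[symmetric] by (auto intro!: powr_mono2')
  have "\<exists>z. m < z \<and> z < m + 1 \<and> (m + 1) powr (-\<kappa>) - m powr (-\<kappa>) = (m + 1 - m) * (-\<kappa> * z powr (-\<kappa> - 1))"
    by (rule MVT2) (use m in \<open>auto intro!: derivative_eq_intros\<close>)
  then obtain z where z: "m < z" "m powr (-\<kappa>) - (m + 1) powr (-\<kappa>) = \<kappa> * z powr (-\<kappa> - 1)" by auto
  have "\<kappa> * z powr (-\<kappa> - 1) \<le> 1 * m powr (-\<kappa> - 1)"
    by (intro mult_mono powr_mono2') (use z m assms in auto)
  then have "(m powr (-\<kappa>) - (m+1) powr (-\<kappa>)) * m powr \<beta> \<le> m powr (-\<kappa> - 1) * m powr \<beta>"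
    unfolding z by (intro mult_right_mono) auto
  also have "\<dots> = m powr (\<beta> - \<kappa> - 1)"
    by (simp add: powr_add[symmetric] algebra_simps)
  \<comment> \<open>k - 1 >= k/2 for k >= 2; the exponent lies in (-2, 0), so this costs at most
    2^2, the constant 4 of the statement.\<close>
  also have "\<dots> \<le> ((m + 1) / 2) powr (\<beta> - \<kappa> - 1)"
    by (intro powr_mono2') (use m assms in auto)
  also have "\<dots> = 2 powr (1 + \<kappa> - \<beta>) * (m + 1) powr (\<beta> - \<kappa> - 1)"
    using m by (simp add: powr_divide powr_diff powr_minus powr_add field_simps)
  \<comment> \<open>Here \<kappa> < 1 enters. It makes the decrement of the step sizes, when it
    meets partial sums of order k^\<beta>, a second-order quantity: step size times k^(\<beta> -
    \<kappa>).\<close>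
  also have "\<dots> \<le> 2 powr 2 * (m + 1) powr (-\<kappa> + (\<beta> - \<kappa>))"
    by (intro mult_mono powr_mono) (use m assms in auto)
  finally show "(real (k - 1) powr (-\<kappa>) - real k powr (-\<kappa>)) * real (k - 1) powr \<beta>
           \<le> 4 * (real k powr (-\<kappa>) * real k powr (\<beta> - \<kappa>))"
    unfolding m_def[symmetric] m(2) by (simp add: powr_add[symmetric])
qed

lemma eventually_powr_small:
  fixes d e c :: real
  assumes "0 < d" "0 < e"
  shows "eventually (\<lambda>k::nat. c * real k powr (-d) < e) sequentially"
proof -
  have "(\<lambda>k::nat. c * real k powr (-d)) \<longlonglongrightarrow> c * 0"
    using assms by (intro tendsto_intros tendsto_neg_powr filterlim_real_sequentially) auto
  then show ?thesis using assms by (intro order_tendstoD(2)[where y=0]) auto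
qed

text \<open>The barrier \<open>c k\<^sup>-\<^sup>\<delta> exp (\<eta> k\<^sup>-\<^sup>\<kappa> \<Sum>\<^sub>i\<^sub>\<le>\<^sub>k (t\<^sub>i - \<tau>))\<close> with \<open>\<delta> = \<kappa> - \<beta>\<close> grows with \<open>t\<^sub>k\<close> exactly
  when the recursion does, so the unbounded coefficients \<open>t\<^sub>k\<close> only enter through their averages.\<close>
lemma scalar_recursion_rate:
  fixes u t :: "nat \<Rightarrow> real" and K lam \<tau> \<beta> \<kappa> :: real
  assumes "0 < \<beta>" "\<beta> < \<kappa>" "\<kappa> < 1" and K: "0 \<le> K" and lam: "0 < lam" and tau: "0 \<le> \<tau>"
    and u: "\<And>k. 0 \<le> u k" and t: "\<And>k. 0 \<le> t k"
    and rec: "eventually (\<lambda>k. u (Suc k) \<le> (1 - lam * real k powr (-\<kappa>)) * u k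
        + K * (real k powr (-\<kappa>) * real k powr (\<beta> - \<kappa>)) * (1 + t k) * (1 + u k)) sequentially"
    and avg: "\<And>n. \<bar>(\<Sum>k=1..n. t k) - real n * \<tau>\<bar> \<le> K * real n powr \<beta>"
  shows "\<exists>c. eventually (\<lambda>k. u k \<le> c * real k powr (\<beta> - \<kappa>)) sequentially"
proof -
  define \<delta> where "\<delta> = \<kappa> - \<beta>"
  have d: "0 < \<delta>" "\<delta> < 1" using assms by (auto simp: \<delta>_def)
  have bd: "\<beta> - \<kappa> = -\<delta>" by (simp add: \<delta>_def)
  \<comment> \<open>The mean drift \<tau> in the exponent of the barrier may consume half of the
    contraction. The summand 2 covers \<tau> = 0.\<close>
  define \<eta> where "\<eta> = lam / (2 * \<tau> + 2)"
  have eta: "0 < \<eta>" "\<eta> * \<tau> \<le> lam / 2" using lam tau by (auto simp: \<eta>_def field_simps)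
  define a where "a = (\<lambda>k::nat. real k powr (-\<kappa>))"
  define T where "T = (\<lambda>n::nat. (\<Sum>k=1..n. t k) - real n * \<tau>)"
  define q where "q = (\<lambda>k. a k * T k)"
  \<comment> \<open>The error in the recursion will be at most 2\<mu> a_k (1 + t_k) W_k. Its t_k
    part has to fit under the growth \<eta> a_k t_k of the barrier, its constant part under
    lam/8.\<close>
  define \<mu> where "\<mu> = min (\<eta> / 2) (lam / 16)"
  have mu: "0 < \<mu>" "\<mu> \<le> \<eta>/2" "\<mu> \<le> lam/16" using eta lam by (auto simp: \<mu>_def)
  \<comment> \<open>Budget for the contraction lam a_k: lam/2 goes to \<tau>, lam/8 to the variation
    of the step sizes (\<open>e2\<close>), lam/8 to the decay of k^(-\<delta>) (\<open>e3\<close>)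
    and lam/8 to the error through \<mu>. \<open>e4\<close> keeps 1 - lam a_k nonnegative, and
    \<open>e5\<close> confines the exponential factor to [1/2, 2].\<close>
  have e1: "eventually (\<lambda>k::nat. K * real k powr (-\<delta>) < \<mu>) sequentially"
    by (rule eventually_powr_small) (use d mu in auto)
  have e2: "eventually (\<lambda>k::nat. (\<eta> * 4 * K) * real k powr (-\<delta>) < lam/8) sequentially"
    by (rule eventually_powr_small) (use d lam in auto)
  have e3: "eventually (\<lambda>k::nat. \<delta> * real k powr (-(1-\<kappa>)) < lam/8) sequentially"
    by (rule eventually_powr_small) (use d lam assms in auto)
  have e4: "eventually (\<lambda>k::nat. lam * real k powr (-\<kappa>) < 1/2) sequentially"
    by (rule eventually_powr_small) (use d lam assms in auto)
  have e5: "eventually (\<lambda>k::nat. (\<eta> * K) * real k powr (-\<delta>) < ln 2) sequentially"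
    by (rule eventually_powr_small) (use d in auto)
  have "eventually (\<lambda>k. K * real k powr (-\<delta>) < \<mu> \<and> (\<eta> * 4 * K) * real k powr (-\<delta>) < lam/8
      \<and> \<delta> * real k powr (-(1-\<kappa>)) < lam/8 \<and> lam * real k powr (-\<kappa>) < 1/2 \<and>
      (\<eta> * K) * real k powr (-\<delta>) < ln 2 \<and>
      u (Suc k) \<le> (1 - lam * real k powr (-\<kappa>)) * u k
        + K * (real k powr (-\<kappa>) * real k powr (\<beta> - \<kappa>)) * (1 + t k) * (1 + u k)) sequentially"
    using e1 e2 e3 e4 e5 rec by eventually_elim blast
  then obtain k0 where k0: "\<And>k. k \<ge> k0 \<Longrightarrow> K * real k powr (-\<delta>) < \<mu>"
     "\<And>k. k \<ge> k0 \<Longrightarrow> (\<eta> * 4 * K) * real k powr (-\<delta>) < lam/8"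
     "\<And>k. k \<ge> k0 \<Longrightarrow> \<delta> * real k powr (-(1-\<kappa>)) < lam/8"
     "\<And>k. k \<ge> k0 \<Longrightarrow> lam * real k powr (-\<kappa>) < 1/2"
     "\<And>k. k \<ge> k0 \<Longrightarrow> (\<eta> * K) * real k powr (-\<delta>) < ln 2"
     "\<And>k. k \<ge> k0 \<Longrightarrow> u (Suc k) \<le> (1 - lam * a k) * u k
        + K * (a k * real k powr (-\<delta>)) * (1 + t k) * (1 + u k)"
    unfolding eventually_sequentially bd a_def by blast
  \<comment> \<open>The barrier at k involves \<open>q (k - 1)\<close>, so the bounds are needed at
    k - 1 as well, and the decrement estimate needs k >= 2.\<close>
  define k1 where "k1 = k0 + 2"
  \<comment> \<open>The first summand lets c k^(-\<delta>)/2 absorb the inhomogeneous term K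
    k^(-\<delta>) into \<mu> W_k, the second starts the induction at \<open>k1\<close>, and the
    third keeps c positive.\<close>
  define c where "c = 2 * K / \<mu> + 2 * real k1 powr \<delta> * u k1 + 1"
  have c: "c > 0" "2 * K \<le> c * \<mu>" "c \<ge> 2 * real k1 powr \<delta> * u k1"
    using K mu u[of k1] by (auto simp: c_def distrib_right intro!: add_nonneg_pos add_nonneg_nonneg)
  \<comment> \<open>The lag matters: W_k contains t only up to k - 1, so the quotient of W_(k+1) and
    W_k brings in t_k, the coefficient of the step from k to k + 1.\<close>
  define W where "W = (\<lambda>k. c * exp (- \<delta> * ln (real k) + \<eta> * q (k - 1)))"
  have Tb: "\<bar>T n\<bar> \<le> K * real n powr \<beta>" for n using avg[of n] by (simp add: T_def)
  have qb: "\<bar>q n\<bar> \<le> K * real n powr (-\<delta>)" for n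
  proof -
    have "\<bar>q n\<bar> = a n * \<bar>T n\<bar>" by (simp add: q_def a_def abs_mult)
    also have "\<dots> \<le> a n * (K * real n powr \<beta>)" by (intro mult_left_mono Tb) (simp add: a_def)
    also have "\<dots> = K * (real n powr (-\<kappa>) * real n powr \<beta>)" by (simp add: a_def)
    also have "\<dots> = K * real n powr (-\<delta>)" by (simp only: powr_add[symmetric]) (simp add: \<delta>_def)
    finally show ?thesis .
  qed
  have etaq: "\<bar>\<eta> * q (k - 1)\<bar> \<le> ln 2" if "k \<ge> k1" for k
  proof -
    have "\<bar>\<eta> * q (k - 1)\<bar> \<le> \<eta> * (K * real (k-1) powr (-\<delta>))"
      using qb[of "k-1"] eta by (simp add: abs_mult)
    also have "\<dots> < ln 2" using k0(5)[of "k-1"] that by (simp add: k1_def mult.assoc)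
    finally show ?thesis by simp
  qed
  have kd: "exp (- \<delta> * ln (real k)) = real k powr (-\<delta>)" if "k \<ge> k1" for k
    using that by (simp add: powr_def k1_def)
  have Wup: "W k \<le> 2 * c * real k powr (-\<delta>)" and Wlow: "c * real k powr (-\<delta>) / 2 \<le> W k"
    if "k \<ge> k1" for k
  proof -
    have "exp (\<eta> * q (k-1)) \<le> exp (ln 2)" "exp (- ln 2) \<le> exp (\<eta> * q (k-1))"
      using etaq[OF that] unfolding exp_le_cancel_iff by linarith+
    then have "exp (\<eta> * q (k-1)) \<le> 2" "1/2 \<le> exp (\<eta> * q (k-1))"
      by (simp_all add: exp_minus)
    then have "c * real k powr (-\<delta>) * exp (\<eta> * q (k-1)) \<le> c * real k powr (-\<delta>) * 2"
      "c * real k powr (-\<delta>) * (1/2) \<le> c * real k powr (-\<delta>) * exp (\<eta> * q (k-1))"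
      using c by (intro mult_left_mono; simp)+
    moreover have "W k = c * real k powr (-\<delta>) * exp (\<eta> * q (k-1))"
      by (simp only: W_def exp_add kd[OF that] mult.assoc)
    ultimately show "W k \<le> 2 * c * real k powr (-\<delta>)" "c * real k powr (-\<delta>) / 2 \<le> W k" by auto
  qed
  have main: "u k \<le> W k" if "k \<ge> k1" for k
    using that
  proof (induction k rule: dec_induct)
    case base
    have "u k1 = (2 * real k1 powr \<delta> * u k1) * real k1 powr (-\<delta>) / 2"
      by (simp add: k1_def powr_minus field_simps)
    also have "\<dots> \<le> c * real k1 powr (-\<delta>) / 2" using c by (intro divide_right_mono mult_right_mono) auto
    also have "\<dots> \<le> W k1" by (rule Wlow) simp
    finally show ?case .
  next
    case (step k)
    have k2: "k \<ge> 2" "k \<ge> k0" using step by (auto simp: k1_def)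
    have ak: "a k > 0" using k2 by (simp add: a_def)
    have Wpos: "W k > 0" using c by (simp add: W_def)
    have qdiff: "q k - q (k-1) \<ge> a k * t k - a k * \<tau> - 4 * K * (a k * real k powr (-\<delta>))"
    proof -
      have "T k = T (k - 1) + (t k - \<tau>)"
        using k2 by (cases k) (auto simp: T_def algebra_simps)
      then have "q k - q (k-1) = a k * (t k - \<tau>) - (a (k-1) - a k) * T (k-1)"
        unfolding q_def by (simp only:) (simp add: algebra_simps)
      moreover have "(a (k-1) - a k) * T (k-1) \<le> (a (k-1) - a k) * (K * real (k-1) powr \<beta>)"
        using Tb[of "k-1"] powr_decrement_mult_le(1)[OF assms(1-3) k2(1)]
        by (intro mult_left_mono) (auto simp: a_def)
      moreover have "\<dots> \<le> K * (4 * (a k * real k powr (-\<delta>)))"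
        using powr_decrement_mult_le(2)[OF assms(1-3) k2(1)] K
        unfolding a_def bd by (simp add: mult.left_commute mult_left_mono)
      ultimately show ?thesis by (simp add: algebra_simps)
    qed
    have lnd: "ln (real (Suc k)) - ln (real k) \<le> 1 / real k"
    proof -
      have "real (Suc k) = real k * (1 + 1 / real k)" using k2 by (simp add: field_simps)
      then have "ln (real (Suc k)) = ln (real k) + ln (1 + 1 / real k)"
        using k2 by (simp only:) (subst ln_mult, auto intro: add_pos_nonneg)
      then have "ln (real (Suc k)) - ln (real k) = ln (1 + 1 / real k)" by simp
      also have "\<dots> \<le> 1 / real k" by (rule ln_add_one_self_le_self) simp
      finally show ?thesis .
    qed
    have inv: "\<delta> / real k \<le> lam / 8 * a k"
    proof -
      have "\<delta> / real k = (\<delta> * real k powr (-(1-\<kappa>))) * a k"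
      proof -
        have *: "real k powr (-(1-\<kappa>)) * real k powr (-\<kappa>) = real k powr (-1)"
          unfolding powr_add[symmetric] by simp
        show ?thesis unfolding a_def mult.assoc * by (simp add: powr_minus_divide)
      qed
      also have "\<dots> \<le> lam / 8 * a k" using k0(3)[OF k2(2)] ak by (intro mult_right_mono) auto
      finally show ?thesis .
    qed
    define z where "z = - \<delta> * (ln (real (Suc k)) - ln (real k)) + \<eta> * (q k - q (k-1))"
    have z: "z \<ge> \<eta> * (a k * t k) - lam * 3/4 * a k"
    proof -
      have "\<eta> * (q k - q (k-1)) \<ge> \<eta> * (a k * t k - a k * \<tau> - 4 * K * (a k * real k powr (-\<delta>)))"
        using qdiff eta by (intro mult_left_mono) auto
      moreover have "\<eta> * (a k * t k - a k * \<tau> - 4 * K * (a k * real k powr (-\<delta>)))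
        = \<eta> * (a k * t k) - (\<eta> * \<tau>) * a k - (\<eta> * 4 * K * real k powr (-\<delta>)) * a k"
        by (simp add: algebra_simps)
      moreover have "(\<eta> * \<tau>) * a k \<le> lam / 2 * a k"
         using eta ak by (intro mult_right_mono) auto
      moreover have "(\<eta> * 4 * K * real k powr (-\<delta>)) * a k \<le> lam / 8 * a k"
         using k0(2)[OF k2(2)] ak by (intro mult_right_mono) auto
      moreover have "\<delta> * (ln (real (Suc k)) - ln (real k)) \<le> lam / 8 * a k"
      proof -
        have "\<delta> * (ln (real (Suc k)) - ln (real k)) \<le> \<delta> * (1 / real k)"
          using lnd d by (intro mult_left_mono) auto
        also have "\<dots> = \<delta> / real k" by simp
        also have "\<dots> \<le> lam / 8 * a k" by (rule inv)
        finally show ?thesis .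
      qed
      moreover have "- \<delta> * (ln (real (Suc k)) - ln (real k)) = - (\<delta> * (ln (real (Suc k)) - ln (real k)))"
         by simp
      ultimately show ?thesis unfolding z_def by linarith
    qed
    have "W (Suc k) = W k * exp z"
    proof -
      have "exp (- \<delta> * ln (real (Suc k)) + \<eta> * q k)
        = exp (- \<delta> * ln (real k) + \<eta> * q (k - 1)) * exp z"
        unfolding z_def exp_add[symmetric] by (simp add: algebra_simps)
      then show ?thesis by (simp add: W_def)
    qed
    moreover have "exp z \<ge> 1 + z" by simp
    ultimately have "W (Suc k) \<ge> W k * (1 + z)" using Wpos by simp
    then have W1: "W (Suc k) \<ge> W k * (1 + \<eta> * (a k * t k) - lam * 3/4 * a k)"
      using z Wpos by (smt (verit) mult_left_mono)
    have small: "K * real k powr (-\<delta>) * (1 + W k) \<le> 2 * \<mu> * W k"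
    proof -
      have "K * real k powr (-\<delta>) = 2 * K * (real k powr (-\<delta>) / 2)" by simp
      also have "\<dots> \<le> c * \<mu> * (real k powr (-\<delta>) / 2)" using c by (intro mult_right_mono) auto
      also have "\<dots> = \<mu> * (c * real k powr (-\<delta>) / 2)" by simp
      also have "\<dots> \<le> \<mu> * W k" using Wlow[of k] step mu by (intro mult_left_mono) auto
      finally have "K * real k powr (-\<delta>) \<le> \<mu> * W k" .
      moreover have "K * real k powr (-\<delta>) * W k \<le> \<mu> * W k"
        using k0(1)[OF k2(2)] Wpos by (intro mult_right_mono) auto
      ultimately show ?thesis by (simp add: algebra_simps)
    qed
    have lamk: "lam * a k < 1/2" using k0(4)[OF k2(2)] by (simp add: a_def)
    have "u (Suc k) \<le> (1 - lam * a k) * u k + K * (a k * real k powr (-\<delta>)) * (1 + t k) * (1 + u k)"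
      by (rule k0(6)[OF k2(2)])
    also have "\<dots> \<le> (1 - lam * a k) * W k + K * (a k * real k powr (-\<delta>)) * (1 + t k) * (1 + W k)"
      using step.IH lamk K ak t[of k] by (intro add_mono mult_left_mono mult_nonneg_nonneg) auto
    also have "\<dots> = (1 - lam * a k) * W k + (a k * (1 + t k)) * (K * real k powr (-\<delta>) * (1 + W k))"
      by simp
    also have "\<dots> \<le> (1 - lam * a k) * W k + (a k * (1 + t k)) * (2 * \<mu> * W k)"
      using small ak t[of k] by (intro add_left_mono mult_left_mono) auto
    also have "\<dots> = W k * (1 - lam * a k + 2 * \<mu> * a k + 2 * \<mu> * (a k * t k))"
      by (simp add: algebra_simps)
    also have "\<dots> \<le> W k * (1 + \<eta> * (a k * t k) - lam * 3/4 * a k)"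
    proof (intro mult_left_mono)
      have "2 * \<mu> * a k \<le> lam / 8 * a k" using mu ak by (intro mult_right_mono) auto
      moreover have "2 * \<mu> * (a k * t k) \<le> \<eta> * (a k * t k)"
        using mu ak t[of k] by (intro mult_right_mono) auto
      moreover have "lam * a k > 0" using lam ak by simp
      ultimately show "1 - lam * a k + 2 * \<mu> * a k + 2 * \<mu> * (a k * t k)
          \<le> 1 + \<eta> * (a k * t k) - lam * 3/4 * a k"
        by (simp add: algebra_simps)
    qed (use Wpos in auto)
    also have "\<dots> \<le> W (Suc k)" by (rule W1)
    finally show ?case .
  qed
  have "u k \<le> (2 * c) * real k powr (\<beta> - \<kappa>)" if "k \<ge> k1" for k
    using main[OF that] Wup[OF that] unfolding bd by simp
  then show ?thesis unfolding eventually_sequentially by blast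
qed

text \<open>In the expanded square the quadratic term costs at most a lam |v|^2, half of the gain 2
  a lam |v|^2; what is left, 1 - lam a, is below (1 - lam a/2)^2. The condition
  \<open>a * lam \<le> 2\<close> makes the right-hand side nonnegative, so that squares may be
  compared.\<close>

lemma norm_one_minus_coercive_le:
  fixes f :: "'a::real_inner \<Rightarrow> 'a"
  assumes coercive: "lam * (norm v)\<^sup>2 \<le> v \<bullet> f v" and bounded: "norm (f v) \<le> L * norm v"
    and a: "0 \<le> a" "a * L\<^sup>2 \<le> lam" "a * lam \<le> 2"
  shows "norm (v - a *\<^sub>R f v) \<le> (1 - lam / 2 * a) * norm v"
proof (rule power2_le_imp_le)
  have "(norm (v - a *\<^sub>R f v))\<^sup>2 = (norm v)\<^sup>2 - 2 * a * (v \<bullet> f v) + a\<^sup>2 * (norm (f v))\<^sup>2"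
    unfolding power2_norm_eq_inner
    by (simp add: inner_diff_left inner_diff_right inner_commute power2_eq_square algebra_simps)
  also have "\<dots> \<le> (norm v)\<^sup>2 - 2 * a * (lam * (norm v)\<^sup>2) + a\<^sup>2 * (L * norm v)\<^sup>2"
    using assms by (intro add_mono diff_mono mult_left_mono power_mono) auto
  also have "\<dots> = (norm v)\<^sup>2 - 2 * a * (lam * (norm v)\<^sup>2) + (a * L\<^sup>2) * (a * (norm v)\<^sup>2)"
    by (simp add: power2_eq_square algebra_simps)
  also have "\<dots> \<le> (norm v)\<^sup>2 - 2 * a * (lam * (norm v)\<^sup>2) + lam * (a * (norm v)\<^sup>2)"
    using a by (intro add_left_mono mult_right_mono) auto
  also have "\<dots> = ((1 - lam / 2 * a)\<^sup>2 - (lam / 2 * a)\<^sup>2) * (norm v)\<^sup>2"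
    by (simp add: power2_eq_square algebra_simps)
  also have "\<dots> \<le> ((1 - lam / 2 * a) * norm v)\<^sup>2"
    by (simp add: power_mult_distrib mult_right_mono)
  finally show "(norm (v - a *\<^sub>R f v))\<^sup>2 \<le> ((1 - lam / 2 * a) * norm v)\<^sup>2" .
  show "0 \<le> (1 - lam / 2 * a) * norm v" using a by (simp add: mult.commute)
qed

text \<open>Summation by parts is built into the corrected error
  \<open>U\<^sub>k = e\<^sub>k + a\<^sub>k\<^sub>-\<^sub>1 (S\<^sub>k\<^sub>-\<^sub>1 e\<^sub>k - T\<^sub>k\<^sub>-\<^sub>1)\<close>: its recursion contains the partial sums \<open>S\<close>, \<open>T\<close> of
  the fluctuations only, multiplied by second-order quantities.\<close>
lemma linear_stochastic_approximation_rate: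
  fixes e \<zeta> :: "nat \<Rightarrow> 'a::real_inner" and G :: "nat \<Rightarrow> 'a \<Rightarrow> 'a" and f :: "'a \<Rightarrow> 'a"
    and t :: "nat \<Rightarrow> real" and K L lam \<tau> \<beta> \<kappa> :: real
  assumes \<beta>\<kappa>: "0 < \<beta>" "\<beta> < \<kappa>" "\<kappa> < 1" and lam: "0 < lam" and L: "0 \<le> L" and K: "0 \<le> K"
    and tau: "0 \<le> \<tau>"
    and linear: "linear f" "\<And>k. linear (G k)"
    and coercive: "\<And>v. lam * (norm v)\<^sup>2 \<le> v \<bullet> f v"
    and bounded: "\<And>v. norm (f v) \<le> L * norm v"
    and recursion: "\<And>k. 1 \<le> k \<Longrightarrow> e (Suc k) = e k + (real k powr (-\<kappa>)) *\<^sub>R (\<zeta> k - G k (e k))"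
    and G: "\<And>k v. norm (G k v) \<le> t k * norm v"
    and \<zeta>: "\<And>k. norm (\<zeta> k) \<le> t k"
    and sum_G: "\<And>n v. norm (\<Sum>k=1..n. G k v - f v) \<le> K * real n powr \<beta> * norm v"
    and sum_\<zeta>: "\<And>n. norm (\<Sum>k=1..n. \<zeta> k) \<le> K * real n powr \<beta>"
    and sum_t: "\<And>n. \<bar>(\<Sum>k=1..n. t k) - real n * \<tau>\<bar> \<le> K * real n powr \<beta>"
  shows "\<exists>c. eventually (\<lambda>k. norm (e k) \<le> c * real k powr (\<beta> - \<kappa>)) sequentially"
proof -
  define \<delta> where "\<delta> = \<kappa> - \<beta>"
  have d: "0 < \<delta>" "\<delta> < 1" using \<beta>\<kappa> by (auto simp: \<delta>_def)
  have bd: "\<beta> - \<kappa> = -\<delta>" by (simp add: \<delta>_def)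
  define a where "a = (\<lambda>k::nat. real k powr (-\<kappa>))"
  have a0: "0 \<le> a k" for k by (simp add: a_def)
  define S where "S = (\<lambda>n v. \<Sum>k=1..n. G k v - f v)"
  define T where "T = (\<lambda>n. \<Sum>k=1..n. \<zeta> k)"
  have linS: "linear (S n)" for n
    unfolding S_def by (intro linear_compose_sum linear_compose_sub ballI linear)
  have aS: "a n * (K * real n powr \<beta>) = K * real n powr (-\<delta>)" for n
  proof -
    have "a n * (K * real n powr \<beta>) = K * (real n powr (-\<kappa>) * real n powr \<beta>)" by (simp add: a_def)
    also have "\<dots> = K * real n powr (-\<delta>)" by (simp only: powr_add[symmetric]) (simp add: \<delta>_def)
    finally show ?thesis .
  qed
  have ST: "norm (S n v - T n) \<le> K * real n powr \<beta> * (norm v + 1)" for n v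
    using norm_triangle_ineq4[of "S n v" "T n"] sum_G[where n=n and v=v] sum_\<zeta>[of n]
    by (simp add: S_def T_def algebra_simps)
  have t0: "0 \<le> t k" for k using \<zeta>[of k] norm_ge_zero[of "\<zeta> k"] by linarith
  define U where "U = (\<lambda>k. e k + a (k-1) *\<^sub>R (S (k-1) (e k) - T (k-1)))"
  \<comment> \<open>Half of K' (1 + t_k) dominates the coefficients 2LK, 4K and K t_k that come from
    \<open>n2\<close>, \<open>n3\<close> and \<open>n4\<close>; the other factor 2 comes from |e_k|
    + 1 <= 2 (1 + |U_k|).\<close>
  define K' where "K' = 4 * L * K + 11 * K"
  have K': "0 \<le> K'" "K \<le> K'" using K L by (auto simp: K'_def)
  have Ue: "norm (U k - e k) \<le> 2 * K * real k powr (-\<delta>) * (norm (e k) + 1)" if "k \<ge> 2" for k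
  proof -
    have "norm (U k - e k) = a (k-1) * norm (S (k-1) (e k) - T (k-1))"
      by (simp add: U_def a0)
    also have "\<dots> \<le> a (k-1) * (K * real (k-1) powr \<beta> * (norm (e k) + 1))"
      by (intro mult_left_mono ST a0)
    also have "\<dots> = K * real (k-1) powr (-\<delta>) * (norm (e k) + 1)"
      using aS[of "k-1"] by (simp add: mult.assoc[symmetric])
    also have "real (k-1) powr (-\<delta>) \<le> (real k / 2) powr (-\<delta>)"
      by (intro powr_mono2') (use that d in auto)
    also have "(real k / 2) powr (-\<delta>) = 2 powr \<delta> * real k powr (-\<delta>)"
      using that by (simp add: powr_divide powr_minus field_simps)
    also have "2 powr \<delta> \<le> 2 powr 1" using d by (intro powr_mono) auto
    finally show ?thesis using K by (simp add: mult_left_mono mult_right_mono mult_ac)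
  qed
  have ev1: "eventually (\<lambda>k::nat. (4 * K) * real k powr (-\<delta>) < 1) sequentially"
    by (rule eventually_powr_small) (use d in auto)
  have ev2: "eventually (\<lambda>k::nat. L\<^sup>2 * real k powr (-\<kappa>) < lam) sequentially"
    by (rule eventually_powr_small) (use \<beta>\<kappa> lam in auto)
  have ev3: "eventually (\<lambda>k::nat. lam * real k powr (-\<kappa>) < 2) sequentially"
    by (rule eventually_powr_small) (use \<beta>\<kappa> lam in auto)
  \<comment> \<open>Once 2 K k^(-\<delta>) <= 1/2 the correction can be absorbed. Bounds in terms of
    e_k become bounds in terms of U_k, and the recursion for U closes.\<close>
  have eU: "norm (e k) + 1 \<le> 2 * (1 + norm (U k))"
    if "k \<ge> 2" "(4 * K) * real k powr (-\<delta>) < 1" for k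
  proof -
    have "norm (e k) \<le> norm (U k) + norm (U k - e k)"
      using norm_triangle_ineq4[of "U k" "U k - e k"] by simp
    moreover have "(2 * K * real k powr (-\<delta>)) * (norm (e k) + 1) \<le> (1/2) * (norm (e k) + 1)"
      using that by (intro mult_right_mono) auto
    ultimately show ?thesis using Ue[OF that(1)] by simp
  qed
  have step: "norm (U (Suc k)) \<le> (1 - lam / 2 * a k) * norm (U k)
      + K' * (a k * real k powr (-\<delta>)) * (1 + t k) * (1 + norm (U k))"
    if k: "k \<ge> 2" "(4 * K) * real k powr (-\<delta>) < 1" "L\<^sup>2 * a k < lam" "lam * a k < 2" for k
  proof -
    define \<Delta> where "\<Delta> = a k *\<^sub>R (\<zeta> k - G k (e k))"
    define X where "X = S (k-1) (e k) - T (k-1)"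
    define p where "p = a k * real k powr (-\<delta>)"
    have p: "0 \<le> p" by (simp add: p_def a0)
    have e1: "e (Suc k) = e k + \<Delta>" using recursion[of k] k by (simp add: \<Delta>_def a_def)
    have Sk: "S k v = S (k-1) v + (G k v - f v)" for v
      using k by (cases k) (auto simp: S_def)
    have Tk: "T k = T (k-1) + \<zeta> k" using k by (cases k) (auto simp: T_def)
    have "U (Suc k) = e k + \<Delta> + a k *\<^sub>R (S k (e k) + S k \<Delta> - T k)"
      by (simp add: U_def e1 linear_add[OF linS])
    \<comment> \<open>From k - 1 to k the expression \<open>S (e k) - T\<close> grows by G_k e_k - f
      e_k - \<zeta>_k. Multiplied by a_k, its random part cancels \<Delta>. What remains of time k
      is the averaged term -a_k f(e_k) and the second-order term a_k S_k \<Delta>.\<close>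
    also have "\<dots> = e k + a k *\<^sub>R X - a k *\<^sub>R f (e k) + a k *\<^sub>R S k \<Delta>"
      unfolding X_def Sk[of "e k"] Tk by (simp add: \<Delta>_def algebra_simps)
    also have "\<dots> = U k - (a (k-1) - a k) *\<^sub>R X - a k *\<^sub>R f (e k) + a k *\<^sub>R S k \<Delta>"
      by (simp add: U_def X_def algebra_simps)
    also have "f (e k) = f (U k) - f (U k - e k)" by (simp add: linear_diff[OF linear(1)])
    finally have decomp: "U (Suc k) = (U k - a k *\<^sub>R f (U k)) + a k *\<^sub>R f (U k - e k)
       - (a (k-1) - a k) *\<^sub>R X + a k *\<^sub>R S k \<Delta>" by (simp add: algebra_simps)
    have n1: "norm (U k - a k *\<^sub>R f (U k)) \<le> (1 - lam / 2 * a k) * norm (U k)"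
      by (rule norm_one_minus_coercive_le[OF coercive bounded]) (use k a0 in \<open>auto simp: mult.commute\<close>)
    define N where "N = 2 * (1 + norm (U k))"
    have eN: "norm (e k) + 1 \<le> N" using eU[OF k(1,2)] by (simp add: N_def)
    have N0: "0 \<le> N" by (simp add: N_def)
    have n2: "norm (a k *\<^sub>R f (U k - e k)) \<le> 2 * L * K * p * N"
    proof -
      have "norm (a k *\<^sub>R f (U k - e k)) \<le> a k * (L * (2 * K * real k powr (-\<delta>) * (norm (e k) + 1)))"
        using bounded[of "U k - e k"] Ue[OF k(1)] a0[of k] L
        by (auto intro!: mult_left_mono intro: order_trans)
      also have "\<dots> \<le> a k * (L * (2 * K * real k powr (-\<delta>) * N))"
        using eN a0 L K by (intro mult_left_mono) auto
      finally show ?thesis by (simp add: p_def mult_ac)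
    qed
    have n3: "norm ((a (k-1) - a k) *\<^sub>R X) \<le> 4 * K * p * N"
    proof -
      have dd: "0 \<le> a (k-1) - a k" "(a (k-1) - a k) * real (k-1) powr \<beta> \<le> 4 * p"
        using powr_decrement_mult_le[OF \<beta>\<kappa> k(1)] unfolding a_def p_def bd by auto
      have "norm ((a (k-1) - a k) *\<^sub>R X) \<le> (a (k-1) - a k) * (K * real (k-1) powr \<beta> * (norm (e k) + 1))"
        using dd ST[of "k-1" "e k"] unfolding X_def by (simp add: mult_left_mono)
      also have "\<dots> = ((a (k-1) - a k) * real (k-1) powr \<beta>) * (K * (norm (e k) + 1))" by simp
      also have "\<dots> \<le> (4 * p) * (K * N)"
        by (rule mult_mono[OF dd(2)]) (use eN K p in \<open>auto intro: mult_left_mono\<close>)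
      finally show ?thesis by (simp add: mult_ac)
    qed
    have n4: "norm (a k *\<^sub>R S k \<Delta>) \<le> K * p * t k * N"
    proof -
      have "norm (\<zeta> k - G k (e k)) \<le> t k + t k * norm (e k)"
        using norm_triangle_ineq4[of "\<zeta> k" "G k (e k)"] \<zeta>[of k] G[of k "e k"] by simp
      also have "\<dots> = t k * (norm (e k) + 1)" by (simp add: algebra_simps)
      also have "\<dots> \<le> t k * N" using t0 eN by (intro mult_left_mono)
      finally have D: "norm \<Delta> \<le> a k * (t k * N)" by (simp add: \<Delta>_def a0 mult_left_mono)
      have "norm (a k *\<^sub>R S k \<Delta>) \<le> a k * (K * real k powr \<beta> * norm \<Delta>)"
        using sum_G[where n=k and v=\<Delta>] by (simp add: S_def a0 mult_left_mono)
      also have "\<dots> = K * real k powr (-\<delta>) * norm \<Delta>" using aS[of k] by (simp add: mult.assoc[symmetric])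
      also have "\<dots> \<le> K * real k powr (-\<delta>) * (a k * (t k * N))"
        using D K by (intro mult_left_mono) auto
      finally show ?thesis by (simp add: p_def mult_ac)
    qed
    have "norm (U (Suc k)) \<le> norm (U k - a k *\<^sub>R f (U k)) + norm (a k *\<^sub>R f (U k - e k))
       + norm ((a (k-1) - a k) *\<^sub>R X) + norm (a k *\<^sub>R S k \<Delta>)"
      unfolding decomp
      by (intro norm_triangle_le order_trans[OF norm_triangle_ineq4] add_right_mono norm_triangle_ineq)
    also have "\<dots> \<le> (1 - lam / 2 * a k) * norm (U k) + 2 * L * K * p * N + 4 * K * p * N + K * p * t k * N"
      using n1 n2 n3 n4 by simp
    also have "\<dots> = (1 - lam / 2 * a k) * norm (U k) + (2 * L * K + 4 * K + K * t k) * (p * N)"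
      by (simp add: algebra_simps)
    also have "\<dots> \<le> (1 - lam / 2 * a k) * norm (U k) + (K' / 2 * (1 + t k)) * (p * N)"
    proof (intro add_left_mono mult_right_mono mult_nonneg_nonneg p N0)
      have "0 \<le> L * K * t k" "0 \<le> K * t k" using L K t0[of k] by auto
      then show "2 * L * K + 4 * K + K * t k \<le> K' / 2 * (1 + t k)"
        using K L by (simp add: K'_def algebra_simps)
    qed
    also have "(K' / 2 * (1 + t k)) * (p * N) = K' * p * (1 + t k) * (1 + norm (U k))"
      by (simp add: N_def)
    finally show ?thesis by (simp add: p_def)
  qed
  have "\<exists>c. eventually (\<lambda>k. norm (U k) \<le> c * real k powr (\<beta> - \<kappa>)) sequentially"
  proof (rule scalar_recursion_rate[OF \<beta>\<kappa> K'(1) _ tau])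
    show "0 < lam / 2" using lam by simp
    show "\<bar>(\<Sum>k=1..n. t k) - real n * \<tau>\<bar> \<le> K' * real n powr \<beta>" for n
      by (rule order_trans[OF sum_t]) (use K' in \<open>auto intro: mult_right_mono\<close>)
    show "eventually (\<lambda>k. norm (U (Suc k)) \<le> (1 - lam / 2 * real k powr (-\<kappa>)) * norm (U k)
      + K' * (real k powr (-\<kappa>) * real k powr (\<beta> - \<kappa>)) * (1 + t k) * (1 + norm (U k))) sequentially"
      using ev1 ev2 ev3 eventually_ge_at_top[of 2]
      by eventually_elim (use step in \<open>simp add: a_def bd\<close>)
  qed (use t0 in auto)
  then obtain c where "eventually (\<lambda>k. norm (U k) \<le> c * real k powr (\<beta> - \<kappa>)) sequentially" ..
  then have "eventually (\<lambda>k. norm (e k) \<le> (2 * c + 4 * K) * real k powr (\<beta> - \<kappa>)) sequentially"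
    using ev1 eventually_ge_at_top[of 2]
  proof eventually_elim
    case (elim k)
    have "norm (e k) \<le> norm (U k) + norm (U k - e k)"
      using norm_triangle_ineq4[of "U k" "U k - e k"] by simp
    also have "norm (U k - e k) \<le> (2 * K * real k powr (-\<delta>)) * (2 * (1 + norm (U k)))"
      by (rule order_trans[OF Ue]) (use elim eU K in \<open>auto intro!: mult_left_mono\<close>)
    also have "\<dots> = 4 * K * real k powr (-\<delta>) + (4 * K * real k powr (-\<delta>)) * norm (U k)"
      by (simp add: algebra_simps)
    also have "(4 * K * real k powr (-\<delta>)) * norm (U k) \<le> 1 * norm (U k)"
      using elim by (intro mult_right_mono) auto
    finally show ?case using elim unfolding bd by (simp add: algebra_simps)
  qed
  then show ?thesis by blast
qed

section \<open>Positive definite matrices and the least-squares recursion\<close>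

lemma outer_prod_mult_vec: "outer_prod u w *v v = (w \<bullet> v) *\<^sub>R u"
  by (simp add: vec_eq_iff outer_prod_def matrix_vector_mult_def inner_vec_def sum_distrib_left mult_ac)

lemma norm_matrix_vector_mult_le_entries:
  fixes B :: "real ^ 'd ^ 'd"
  assumes "\<And>i j. \<bar>B $ i $ j\<bar> \<le> c"
  shows "norm (B *v v) \<le> real CARD('d) * real CARD('d) * c * norm v"
proof -
  have "norm (B *v v) \<le> onorm ((*v) B) * norm v"
    by (rule onorm[OF matrix_vector_mul_bounded_linear])
  also have "\<dots> \<le> real CARD('d) * real CARD('d) * c * norm v"
    by (intro mult_right_mono onorm_le_matrix_component assms) auto
  finally show ?thesis .
qed

text \<open>The quadratic form attains its minimum on the unit sphere, and homogeneity carries this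
  positive minimum over to all vectors.\<close>

lemma positive_definite_coercive:
  fixes A :: "real ^ 'n ^ 'n"
  assumes "positive_definite A"
  shows "\<exists>lam>0. \<forall>v. lam * (norm v)\<^sup>2 \<le> v \<bullet> (A *v v)"
proof -
  let ?f = "\<lambda>v. v \<bullet> (A *v v)"
  have ne: "sphere (0::real^'n) 1 \<noteq> {}" by simp
  have cont: "continuous_on (sphere 0 1) ?f"
    by (intro continuous_intros linear_continuous_on matrix_vector_mul_bounded_linear)
  obtain z where z: "z \<in> sphere 0 1" "\<And>v. v \<in> sphere 0 1 \<Longrightarrow> ?f z \<le> ?f v"
    using continuous_attains_inf[OF compact_sphere ne cont] by blast
  have "z \<noteq> 0" using z(1) by auto
  then have "0 < ?f z" using assms by (auto simp: positive_definite_def)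
  moreover have "?f z * (norm v)\<^sup>2 \<le> ?f v" for v
  proof (cases "v = 0")
    case False
    have "?f z \<le> ?f (v /\<^sub>R norm v)" using False by (intro z(2)) auto
    also have "\<dots> = ?f v / (norm v)\<^sup>2"
      by (simp add: matrix_vector_mult_scaleR power2_eq_square field_simps)
    finally show ?thesis using False by (simp add: field_simps)
  qed simp
  ultimately show ?thesis by blast
qed

lemma positive_definite_matrix_inv_mult:
  fixes A :: "real ^ 'n ^ 'n"
  assumes "positive_definite A"
  shows "A *v (matrix_inv A *v b) = b"
proof -
  have "v = 0" if "A *v v = 0" for v
    using assms that unfolding positive_definite_def by (metis inner_zero_right less_irrefl)
  then have "invertible A"
    unfolding invertible_left_inverse matrix_left_invertible_ker by blast
  then have "A ** matrix_inv A = mat 1"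
    unfolding invertible_def matrix_inv_def by (metis (mono_tags, lifting) someI_ex)
  then show ?thesis by (simp add: matrix_vector_mul_assoc)
qed

text \<open>The error H_k - h is driven by \<zeta>_k = b_k - A_k h. Because A h = b, the partial
  sums of \<zeta> are combinations of the fluctuations of b_k and A_k.\<close>

lemma least_squares_recursion_rate:
  fixes x :: "nat \<Rightarrow> real ^ 'd" and y :: "nat \<Rightarrow> real" and A :: "real ^ 'd ^ 'd" and b h :: "real ^ 'd"
    and H :: "nat \<Rightarrow> real ^ 'd" and K yy \<beta> \<kappa> :: real
  assumes \<beta>\<kappa>: "0 < \<beta>" "\<beta> < \<kappa>" "\<kappa> < 1" and pd: "positive_definite A" and h: "A *v h = b"
    and K: "0 \<le> K" and yy: "0 \<le> yy"
    and sum_xx: "\<And>i j n. \<bar>\<Sum>k=1..n. x k $ i * x k $ j - A $ i $ j\<bar> \<le> K * real n powr \<beta>"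
    and sum_yx: "\<And>i n. \<bar>\<Sum>k=1..n. y k * x k $ i - b $ i\<bar> \<le> K * real n powr \<beta>"
    and sum_yy: "\<And>n. \<bar>\<Sum>k=1..n. (y k)\<^sup>2 - yy\<bar> \<le> K * real n powr \<beta>"
    and recursion: "\<And>k. 1 \<le> k \<Longrightarrow> H (Suc k) = H k + (real k powr (-\<kappa>)) *\<^sub>R
        (y k *\<^sub>R x k - outer_prod (x k) (x k) *v H k)"
  shows "\<exists>c. eventually (\<lambda>k. norm (H k - h) \<le> c * real k powr (\<beta> - \<kappa>)) sequentially"
proof -
  define d where "d = real CARD('d)"
  have d: "1 \<le> d" unfolding d_def by simp
  obtain lam where lam: "0 < lam" "\<And>v. lam * (norm v)\<^sup>2 \<le> v \<bullet> (A *v v)"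
    using positive_definite_coercive[OF pd] by blast
  define L where "L = onorm ((*v) A)"
  have L: "norm (A *v v) \<le> L * norm v" for v
    unfolding L_def by (rule onorm[OF matrix_vector_mul_bounded_linear])
  have L0: "0 \<le> L" unfolding L_def by (rule onorm_pos_le[OF matrix_vector_mul_bounded_linear])
  define c where "c = 1 + norm h"
  have c: "1 \<le> c" by (simp add: c_def)
  \<comment> \<open>t_k has to dominate both |A_k| = |x_k|^2 and |\<zeta>_k|, while its own partial
    sums stay controlled. A combination of squares of coordinates does both; this is where the sums
    of y_k^2 come in.\<close>
  define t where "t = (\<lambda>k. c * ((\<Sum>i\<in>UNIV. x k $ i * x k $ i) + (y k)\<^sup>2))"
  define \<tau> where "\<tau> = c * ((\<Sum>i\<in>UNIV. A $ i $ i) + yy)"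
  define \<zeta> where "\<zeta> = (\<lambda>k. y k *\<^sub>R x k - outer_prod (x k) (x k) *v h)"
  have nx: "(\<Sum>i\<in>UNIV. x k $ i * x k $ i) = (norm (x k))\<^sup>2" for k
    by (simp add: power2_norm_eq_inner inner_vec_def)
  have Aii: "0 \<le> A $ i $ i" for i
  proof -
    have "0 \<le> lam * (norm (axis i (1::real) :: real^'d))\<^sup>2" using lam by simp
    also have "\<dots> \<le> axis i 1 \<bullet> (A *v axis i 1)" by (rule lam(2))
    also have "\<dots> = A $ i $ i"
      by (simp add: inner_axis' matrix_vector_mult_basis column_def)
    finally show ?thesis .
  qed
  define K1 where "K1 = d * d * K"
  define K2 where "K2 = d * K + K1 * norm h"
  define K3 where "K3 = c * (d * K + K)"
  define K' where "K' = K1 + K2 + K3"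
  have K1: "0 \<le> K1" and K2: "0 \<le> K2" and K3: "0 \<le> K3"
    using d K c by (auto simp: K1_def K2_def K3_def)
  have S: "norm (\<Sum>k=1..n. outer_prod (x k) (x k) *v v - A *v v) \<le> K1 * real n powr \<beta> * norm v" for n v
  proof -
    define B where "B = (\<Sum>k=1..n. outer_prod (x k) (x k) - A)"
    have "(\<Sum>k=1..n. outer_prod (x k) (x k) *v v - A *v v) = B *v v"
      unfolding B_def by (induction n) (auto simp: matrix_vector_mult_add_rdistrib matrix_vector_mult_diff_rdistrib)
    also have "norm \<dots> \<le> d * d * (K * real n powr \<beta>) * norm v"
      unfolding d_def
    proof (rule norm_matrix_vector_mult_le_entries)
      show "\<bar>B $ i $ j\<bar> \<le> K * real n powr \<beta>" for i j
        using sum_xx[where i=i and j=j and n=n] by (simp add: B_def outer_prod_def)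
    qed
    finally show ?thesis by (simp add: K1_def mult_ac)
  qed
  have "\<exists>c. eventually (\<lambda>k. norm ((H k - h)) \<le> c * real k powr (\<beta> - \<kappa>)) sequentially"
  proof (rule linear_stochastic_approximation_rate[where f="(*v) A" and G="\<lambda>k. (*v) (outer_prod (x k) (x k))"
        and \<zeta>=\<zeta> and t=t and \<tau>=\<tau> and K=K' and L=L and lam=lam])
    show "0 \<le> K'" using K1 K2 K3 by (simp add: K'_def)
    show "0 \<le> \<tau>" using c yy Aii by (auto simp: \<tau>_def intro!: mult_nonneg_nonneg add_nonneg_nonneg sum_nonneg)
    show "H (Suc k) - h = H k - h + real k powr - \<kappa> *\<^sub>R (\<zeta> k - outer_prod (x k) (x k) *v (H k - h))"
      if "1 \<le> k" for k
      using recursion[OF that] by (simp add: \<zeta>_def matrix_vector_mult_diff_distrib)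
    show "norm (outer_prod (x k) (x k) *v v) \<le> t k * norm v" for k v
    proof -
      have "norm (outer_prod (x k) (x k) *v v) \<le> (norm (x k) * norm v) * norm (x k)"
        unfolding outer_prod_mult_vec norm_scaleR by (intro mult_right_mono Cauchy_Schwarz_ineq2) auto
      also have "\<dots> = 1 * (norm (x k))\<^sup>2 * norm v" by (simp add: power2_eq_square)
      also have "\<dots> \<le> t k * norm v"
        unfolding t_def nx using c by (intro mult_right_mono mult_mono) auto
      finally show ?thesis .
    qed
    show "norm (\<zeta> k) \<le> t k" for k
    proof -
      have "norm (\<zeta> k) \<le> \<bar>y k\<bar> * norm (x k) + (norm (x k) * norm h) * norm (x k)"
        unfolding \<zeta>_def outer_prod_mult_vec
        by (intro order_trans[OF norm_triangle_ineq4] add_mono)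
           (auto intro!: mult_right_mono Cauchy_Schwarz_ineq2)
      also have "\<bar>y k\<bar> * norm (x k) \<le> (norm (x k))\<^sup>2 + (y k)\<^sup>2"
      proof -
        have "0 \<le> (\<bar>y k\<bar> - norm (x k))\<^sup>2" by simp
        also have "\<dots> = (norm (x k))\<^sup>2 + (y k)\<^sup>2 - 2 * (\<bar>y k\<bar> * norm (x k))"
          unfolding power2_diff power2_abs by simp
        finally have "2 * (\<bar>y k\<bar> * norm (x k)) \<le> (norm (x k))\<^sup>2 + (y k)\<^sup>2" by simp
        moreover have "0 \<le> \<bar>y k\<bar> * norm (x k)" by simp
        ultimately show ?thesis by linarith
      qed
      also have "(norm (x k) * norm h) * norm (x k) \<le> norm h * ((norm (x k))\<^sup>2 + (y k)\<^sup>2)"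
        by (simp add: power2_eq_square algebra_simps)
      finally show ?thesis by (simp add: t_def nx c_def algebra_simps)
    qed
    show "norm (\<Sum>k=1..n. outer_prod (x k) (x k) *v v - A *v v) \<le> K' * real n powr \<beta> * norm v" for n v
      by (rule order_trans[OF S]) (use K1 K2 K3 in \<open>auto simp: K'_def intro!: mult_right_mono\<close>)
    show "norm (\<Sum>k=1..n. \<zeta> k) \<le> K' * real n powr \<beta>" for n
    proof -
      have "(\<Sum>k=1..n. \<zeta> k) = (\<Sum>k=1..n. y k *\<^sub>R x k - b) - (\<Sum>k=1..n. outer_prod (x k) (x k) *v h - A *v h)"
        unfolding sum_subtractf[symmetric] by (intro sum.cong refl) (simp add: \<zeta>_def h)
      also have "norm \<dots> \<le> norm (\<Sum>k=1..n. y k *\<^sub>R x k - b) + K1 * real n powr \<beta> * norm h"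
        by (rule order_trans[OF norm_triangle_ineq4]) (use S[of h n] in simp)
      also have "norm (\<Sum>k=1..n. y k *\<^sub>R x k - b) \<le> (\<Sum>i\<in>UNIV. \<bar>(\<Sum>k=1..n. y k *\<^sub>R x k - b) $ i\<bar>)"
        by (rule norm_le_l1_cart)
      also have "\<dots> \<le> (\<Sum>i\<in>(UNIV::'d set). K * real n powr \<beta>)"
        by (intro sum_mono) (use sum_yx in simp)
      also have "\<dots> = d * K * real n powr \<beta>" by (simp add: d_def)
      finally have "norm (\<Sum>k=1..n. \<zeta> k) \<le> K2 * real n powr \<beta>"
        by (simp add: K2_def algebra_simps)
      also have "\<dots> \<le> K' * real n powr \<beta>" using K1 K3 by (intro mult_right_mono) (auto simp: K'_def)
      finally show ?thesis .
    qed
    show "\<bar>(\<Sum>k=1..n. t k) - real n * \<tau>\<bar> \<le> K' * real n powr \<beta>" for n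
    proof -
      have "(\<Sum>k=1..n. t k) - real n * \<tau> = (\<Sum>k=1..n. t k - \<tau>)" by (simp add: sum_subtractf)
      also have "\<dots> = (\<Sum>k=1..n. c * ((\<Sum>i\<in>UNIV. x k $ i * x k $ i - A $ i $ i) + ((y k)\<^sup>2 - yy)))"
        by (intro sum.cong refl) (simp add: t_def \<tau>_def sum_subtractf algebra_simps)
      also have "\<dots> = c * ((\<Sum>i\<in>UNIV. \<Sum>k=1..n. x k $ i * x k $ i - A $ i $ i) + (\<Sum>k=1..n. (y k)\<^sup>2 - yy))"
        by (simp only: sum_distrib_left[symmetric] sum.distrib sum.swap[of _ UNIV])
      also have "\<bar>\<dots>\<bar> \<le> c * ((\<Sum>i\<in>(UNIV::'d set). K * real n powr \<beta>) + K * real n powr \<beta>)"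
        unfolding abs_mult using c
        by (intro mult_mono order_trans[OF abs_triangle_ineq] add_mono order_trans[OF sum_abs] sum_mono sum_xx sum_yy) auto
      also have "\<dots> = K3 * real n powr \<beta>" by (simp add: K3_def d_def algebra_simps)
      also have "\<dots> \<le> K' * real n powr \<beta>" using K1 K2 by (intro mult_right_mono) (auto simp: K'_def)
      finally show ?thesis .
    qed
  qed (use \<beta>\<kappa> lam L L0 in auto)
  then show ?thesis .
qed

section \<open>Moments of sums of independent variables\<close>

text \<open>Concavity: the graph lies below its tangent at 1. It serves with q = p/2, to pass from
  squares to p-th powers.\<close>

lemma powr_le_tangent:
  fixes x q :: real
  assumes "0 \<le> x" "0 < q" "q \<le> 1"
  shows "x powr q \<le> 1 + q * (x - 1)"
proof (cases "x = 0")
  case False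
  then show ?thesis using Youngs_inequality_0[of q "1 - q" x 1] assms by (simp add: algebra_simps)
qed (use assms in auto)

text \<open>The constant comes from \<open>\<bar>1 + s\<bar>\<^sup>p = ((1 + s)\<^sup>2)\<^sup>p\<^sup>/\<^sup>2 \<le> 1 + p s + p s\<^sup>2 / 2\<close> if \<open>\<bar>s\<bar> \<le> 1\<close>,
  and from crude bounds otherwise.\<close>
lemma abs_powr_add_le:
  fixes a b p :: real
  assumes p: "1 < p" "p \<le> 2"
  shows "\<bar>a + b\<bar> powr p \<le> \<bar>a\<bar> powr p + p * (sgn a * \<bar>a\<bar> powr (p - 1)) * b + 6 * \<bar>b\<bar> powr p"
proof (cases "\<bar>b\<bar> \<le> \<bar>a\<bar>")
  case True
  show ?thesis
  proof (cases "a = 0")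
    case False
    define s where "s = b / a"
    have s: "\<bar>s\<bar> \<le> 1" using True False by (simp add: s_def field_simps)
    have b: "b = a * s" using False by (simp add: s_def)
    have "\<bar>1 + s\<bar> powr 2 = (1 + s)\<^sup>2" by (cases "1 + s = 0") auto
    then have "\<bar>1 + s\<bar> powr p = ((1 + s)\<^sup>2) powr (p/2)" using powr_powr[of "\<bar>1 + s\<bar>" 2 "p/2"] by simp
    also have "\<dots> \<le> 1 + p/2 * ((1 + s)\<^sup>2 - 1)" by (rule powr_le_tangent) (use p in auto)
    also have "\<dots> = 1 + p * s + p/2 * s\<^sup>2" by (simp add: power2_eq_square algebra_simps)
    also have "\<dots> \<le> 1 + p * s + 6 * \<bar>s\<bar> powr p"
    proof -
      have "s\<^sup>2 \<le> \<bar>s\<bar> powr p"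
      proof (cases "s = 0")
        case False
        have "s\<^sup>2 = \<bar>s\<bar> powr 2" using False by simp
        also have "\<dots> \<le> \<bar>s\<bar> powr p" by (rule powr_mono') (use p s in auto)
        finally show ?thesis .
      qed auto
      then have "p/2 * s\<^sup>2 \<le> 6 * \<bar>s\<bar> powr p" by (intro mult_mono) (use p in auto)
      then show ?thesis by simp
    qed
    finally have *: "\<bar>1 + s\<bar> powr p \<le> 1 + p * s + 6 * \<bar>s\<bar> powr p" .
    have "\<bar>a + b\<bar> powr p = \<bar>a\<bar> powr p * \<bar>1 + s\<bar> powr p"
      by (simp add: powr_mult[symmetric] abs_mult[symmetric] b distrib_left)
    also have "\<dots> \<le> \<bar>a\<bar> powr p * (1 + p * s + 6 * \<bar>s\<bar> powr p)"
      by (intro mult_left_mono *) auto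
    also have "\<dots> = \<bar>a\<bar> powr p + p * (\<bar>a\<bar> powr p * s) + 6 * \<bar>b\<bar> powr p"
      by (simp add: b abs_mult powr_mult algebra_simps)
    also have "\<bar>a\<bar> powr p * s = sgn a * \<bar>a\<bar> powr (p - 1) * b"
      using False by (auto simp: powr_diff b sgn_if)
    finally show ?thesis by (simp add: mult.assoc)
  qed (use True in auto)
next
  case False
  then have b: "\<bar>a\<bar> < \<bar>b\<bar>" "0 < \<bar>b\<bar>" by auto
  have "\<bar>a + b\<bar> powr p \<le> (2 * \<bar>b\<bar>) powr p" using b p by (intro powr_mono2) auto
  also have "\<dots> = 2 powr p * \<bar>b\<bar> powr p" by (simp add: powr_mult)
  also have "\<dots> \<le> 2 powr 2 * \<bar>b\<bar> powr p" using p by (intro mult_right_mono powr_mono) auto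
  finally have 1: "\<bar>a + b\<bar> powr p \<le> 4 * \<bar>b\<bar> powr p" by simp
  have "\<bar>p * (sgn a * \<bar>a\<bar> powr (p - 1)) * b\<bar> = p * (\<bar>sgn a\<bar> * (\<bar>a\<bar> powr (p - 1) * \<bar>b\<bar>))"
    using p by (simp add: abs_mult)
  also have "\<dots> \<le> 2 * (1 * (\<bar>b\<bar> powr (p - 1) * \<bar>b\<bar>))"
    using p b by (intro mult_mono powr_mono2) (auto simp: sgn_if)
  also have "\<dots> = 2 * \<bar>b\<bar> powr p" using b by (simp add: powr_diff)
  finally have "- (2 * \<bar>b\<bar> powr p) \<le> p * (sgn a * \<bar>a\<bar> powr (p - 1)) * b"
    by (simp add: abs_le_iff)
  moreover have "0 \<le> \<bar>a\<bar> powr p" by simp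
  ultimately show ?thesis using 1 by linarith
qed

text \<open>From |a + b| <= 2 max(|a|, |b|) and 2^p <= 4.\<close>

lemma abs_powr_add_le_convex:
  fixes a b p :: real
  assumes p: "1 < p" "p \<le> 2"
  shows "\<bar>a + b\<bar> powr p \<le> 4 * \<bar>a\<bar> powr p + 4 * \<bar>b\<bar> powr p"
proof -
  have "\<bar>a + b\<bar> powr p \<le> (2 * max \<bar>a\<bar> \<bar>b\<bar>) powr p" using p by (intro powr_mono2) auto
  also have "\<dots> = 2 powr p * max \<bar>a\<bar> \<bar>b\<bar> powr p" by (simp add: powr_mult)
  also have "\<dots> \<le> 2 powr 2 * max \<bar>a\<bar> \<bar>b\<bar> powr p" using p by (intro mult_right_mono powr_mono) auto
  also have "\<dots> \<le> 4 * (\<bar>a\<bar> powr p + \<bar>b\<bar> powr p)" by (auto simp: max_def)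
  finally show ?thesis by simp
qed

lemma abs_powr_le_one_plus:
  fixes a p q :: real
  assumes "0 \<le> q" "q \<le> p"
  shows "\<bar>a\<bar> powr q \<le> 1 + \<bar>a\<bar> powr p"
proof (cases "\<bar>a\<bar> \<le> 1")
  case True
  have "\<bar>a\<bar> powr q \<le> 1" using powr_mono2[of q "\<bar>a\<bar>" 1] True assms by auto
  moreover have "0 \<le> \<bar>a\<bar> powr p" by simp
  ultimately show ?thesis by linarith
next
  case False
  then have "\<bar>a\<bar> powr q \<le> \<bar>a\<bar> powr p" using assms by (intro powr_mono) auto
  then show ?thesis by simp
qed

context prob_space begin

lemma integrable_abs_powr_mono:
  fixes f :: "'a \<Rightarrow> real"
  assumes f: "f \<in> borel_measurable M" and int: "integrable M (\<lambda>\<omega>. \<bar>f \<omega>\<bar> powr p)"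
    and q: "0 \<le> q" "q \<le> p"
  shows "integrable M (\<lambda>\<omega>. \<bar>f \<omega>\<bar> powr q)"
  using abs_powr_le_one_plus[OF q]
  by (intro Bochner_Integration.integrable_bound[OF Bochner_Integration.integrable_add[OF integrable_const[of 1] int]])
     (use f in auto)

lemma integrable_abs_powr_add:
  fixes f g :: "'a \<Rightarrow> real"
  assumes [measurable]: "f \<in> borel_measurable M" "g \<in> borel_measurable M"
    and f: "integrable M (\<lambda>\<omega>. \<bar>f \<omega>\<bar> powr p)" and g: "integrable M (\<lambda>\<omega>. \<bar>g \<omega>\<bar> powr p)"
    and p: "1 < p" "p \<le> 2"
  shows "integrable M (\<lambda>\<omega>. \<bar>f \<omega> + g \<omega>\<bar> powr p)"
proof (rule Bochner_Integration.integrable_bound)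
  show "integrable M (\<lambda>\<omega>. 4 * \<bar>f \<omega>\<bar> powr p + 4 * \<bar>g \<omega>\<bar> powr p)" using f g by simp
  show "AE \<omega> in M. norm (\<bar>f \<omega> + g \<omega>\<bar> powr p) \<le> norm (4 * \<bar>f \<omega>\<bar> powr p + 4 * \<bar>g \<omega>\<bar> powr p)"
    using abs_powr_add_le_convex[OF p] by auto
qed simp

text \<open>A version of the von Bahr--Esseen inequality.\<close>
lemma expectation_abs_sum_powr_le:
  fixes X :: "'i \<Rightarrow> 'a \<Rightarrow> real"
  assumes p: "1 < p" "p \<le> 2" and I: "finite I"
    and indep: "indep_vars (\<lambda>_. borel) X I"
    and int: "\<And>i. i \<in> I \<Longrightarrow> integrable M (\<lambda>\<omega>. \<bar>X i \<omega>\<bar> powr p)"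
    and mean: "\<And>i. i \<in> I \<Longrightarrow> expectation (X i) = 0"
  shows "integrable M (\<lambda>\<omega>. \<bar>\<Sum>i\<in>I. X i \<omega>\<bar> powr p) \<and>
    expectation (\<lambda>\<omega>. \<bar>\<Sum>i\<in>I. X i \<omega>\<bar> powr p) \<le> 6 * (\<Sum>i\<in>I. expectation (\<lambda>\<omega>. \<bar>X i \<omega>\<bar> powr p))"
  using I indep int mean
proof (induction I)
  case (insert i I)
  define S where "S = (\<lambda>\<omega>. \<Sum>i\<in>I. X i \<omega>)"
  have IH: "integrable M (\<lambda>\<omega>. \<bar>S \<omega>\<bar> powr p)"
    "expectation (\<lambda>\<omega>. \<bar>S \<omega>\<bar> powr p) \<le> 6 * (\<Sum>i\<in>I. expectation (\<lambda>\<omega>. \<bar>X i \<omega>\<bar> powr p))"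
    using insert.IH[OF indep_vars_subset[OF insert.prems(1)]] insert.prems by (auto simp: S_def)
  have [measurable]: "X j \<in> borel_measurable M" if "j \<in> insert i I" for j
    using insert.prems(1) that by (auto simp: indep_vars_def)
  have [measurable]: "S \<in> borel_measurable M" unfolding S_def by measurable
  have iX: "integrable M (X i)"
  proof -
    have "integrable M (\<lambda>\<omega>. \<bar>X i \<omega>\<bar> powr 1)"
      by (rule integrable_abs_powr_mono[of _ p]) (use insert.prems p in auto)
    then have "integrable M (\<lambda>\<omega>. \<bar>X i \<omega>\<bar>)" by (simp add: powr_one')
    then show ?thesis by (rule integrable_abs_cancel) simp
  qed
  have iS: "integrable M (\<lambda>\<omega>. \<bar>S \<omega>\<bar> powr (p-1))"
    by (rule integrable_abs_powr_mono[OF _ IH(1)]) (use p in auto)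
  \<comment> \<open>p Q is the derivative of |s|^p. Q(S) is independent of X_i, so the first-order
    term has mean zero; this is what makes the p-th moments add up. Q is integrable along S because
    it only grows like |s|^(p-1).\<close>
  define Q where "Q = (\<lambda>s::real. sgn s * \<bar>s\<bar> powr (p - 1))"
  have Qm[measurable]: "Q \<in> borel_measurable borel" unfolding Q_def by measurable
  have iQ: "integrable M (\<lambda>\<omega>. Q (S \<omega>))"
    by (rule Bochner_Integration.integrable_bound[OF iS]) (auto simp: Q_def abs_mult sgn_if)
  have ind: "indep_var borel (X i) borel (\<lambda>\<omega>. Q (S \<omega>))"
    using indep_var_compose[OF indep_vars_sum[OF insert.hyps insert.prems(1)], of id borel Q borel]
    by (simp add: S_def comp_def)
  have cross: "expectation (\<lambda>\<omega>. X i \<omega> * Q (S \<omega>)) = 0" "integrable M (\<lambda>\<omega>. X i \<omega> * Q (S \<omega>))"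
    using indep_var_lebesgue_integral[OF ind iX iQ] indep_var_integrable[OF ind iX iQ] insert.prems(3)[of i]
    by auto
  have iXp: "integrable M (\<lambda>\<omega>. \<bar>X i \<omega>\<bar> powr p)" using insert.prems by auto
  have int: "integrable M (\<lambda>\<omega>. \<bar>S \<omega> + X i \<omega>\<bar> powr p)"
    by (rule integrable_abs_powr_add) (use IH iXp p in auto)
  have "expectation (\<lambda>\<omega>. \<bar>S \<omega> + X i \<omega>\<bar> powr p)
     \<le> expectation (\<lambda>\<omega>. \<bar>S \<omega>\<bar> powr p + p * (X i \<omega> * Q (S \<omega>)) + 6 * \<bar>X i \<omega>\<bar> powr p)"
  proof (rule integral_mono[OF int])
    show "integrable M (\<lambda>\<omega>. \<bar>S \<omega>\<bar> powr p + p * (X i \<omega> * Q (S \<omega>)) + 6 * \<bar>X i \<omega>\<bar> powr p)"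
      using IH iXp cross by simp
    show "\<bar>S \<omega> + X i \<omega>\<bar> powr p \<le> \<bar>S \<omega>\<bar> powr p + p * (X i \<omega> * Q (S \<omega>)) + 6 * \<bar>X i \<omega>\<bar> powr p" for \<omega>
      using abs_powr_add_le[OF p, of "S \<omega>" "X i \<omega>"] by (simp add: Q_def mult_ac)
  qed
  also have "\<dots> = expectation (\<lambda>\<omega>. \<bar>S \<omega>\<bar> powr p) + 6 * expectation (\<lambda>\<omega>. \<bar>X i \<omega>\<bar> powr p)"
    using IH iXp cross by simp
  finally show ?case
    using IH int insert.hyps by (simp add: S_def add.commute algebra_simps)
qed auto

end

section \<open>Off-diagonal part of the quadratic form\<close>

lemma double_sum_square_add_le:
  fixes s :: real and r n :: "'k \<Rightarrow> 'l \<Rightarrow> real"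
  shows "2 * s\<^sup>2 * (\<Sum>k\<in>A. \<Sum>k'\<in>B. (r k k')\<^sup>2) + 4 * (\<Sum>k\<in>A. \<Sum>k'\<in>B. (s * r k k') * (s * n k k'))
    \<le> 2 * s\<^sup>2 * (\<Sum>k\<in>A. \<Sum>k'\<in>B. (r k k' + n k k')\<^sup>2)"
proof -
  \<comment> \<open>In the application r is the sum over the old indices and n the summand of a new
    one. Completing the square wastes 2 (s y)^2 but preserves the closed form of the bound when an
    index is added.\<close>
  have "2 * s\<^sup>2 * x\<^sup>2 + 4 * ((s * x) * (s * y)) \<le> 2 * s\<^sup>2 * (x + y)\<^sup>2" for x y
  proof -
    have "2 * s\<^sup>2 * (x + y)\<^sup>2 = 2 * s\<^sup>2 * x\<^sup>2 + 4 * ((s * x) * (s * y)) + 2 * (s * y)\<^sup>2"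
      by (simp add: power2_eq_square algebra_simps)
    then show ?thesis by simp
  qed
  then show ?thesis
    unfolding sum_distrib_left sum.distrib[symmetric] by (intro sum_mono)
qed

context prob_space begin

text \<open>\<open>F\<close> exhibits Y as a function of the coordinates in L, so independence
  follows from grouping the family over the disjoint index sets L and {i}.\<close>

lemma indep_var_restrict_single:
  fixes F :: "('i \<Rightarrow> 'b::topological_space) \<Rightarrow> real" and H :: "'b \<Rightarrow> real"
  assumes indep: "indep_vars (\<lambda>_. borel) X UNIV" and i: "i \<notin> L"
    and F: "F \<in> borel_measurable (PiM L (\<lambda>_. borel))" and H: "H \<in> borel_measurable borel"
    and cong: "\<And>\<omega>. F (restrict (\<lambda>l. X l \<omega>) L) = Y \<omega>"
  shows "indep_var borel Y borel (\<lambda>\<omega>. H (X i \<omega>))"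
proof -
  have "indep_var borel (F \<circ> (\<lambda>\<omega>. restrict (\<lambda>l. X l \<omega>) L))
      borel ((\<lambda>z. H (z i)) \<circ> (\<lambda>\<omega>. restrict (\<lambda>l. X l \<omega>) {i}))"
    by (rule indep_var_compose[OF indep_var_restrict[OF indep]]) (use i F H in auto)
  then show ?thesis by (simp add: comp_def cong)
qed

end

locale centered_innovations = prob_space M for M :: "'a measure" +
  fixes \<Xi> :: "int \<Rightarrow> 'a \<Rightarrow> 'm::euclidean_space" and s :: real
  assumes indep: "indep_vars (\<lambda>_. borel) \<Xi> UNIV"
    and integrable_Xi: "\<And>l. integrable M (\<Xi> l)"
    and mean_zero: "\<And>l. expectation (\<Xi> l) = 0"
    and integrable_sq: "\<And>l. integrable M (\<lambda>\<omega>. (norm (\<Xi> l \<omega>))\<^sup>2)"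
    and second_moment: "\<And>l. expectation (\<lambda>\<omega>. (norm (\<Xi> l \<omega>))\<^sup>2) = s"
begin

lemma Xi_measurable[measurable]: "\<Xi> l \<in> borel_measurable M"
  using integrable_Xi by (rule borel_measurable_integrable)

lemma s_nonneg: "0 \<le> s"
  using second_moment[of 0] by (metis integral_nonneg_AE AE_I2 zero_le_power2)

lemma integrable_inner: "integrable M (\<lambda>\<omega>. c \<bullet> \<Xi> l \<omega>)"
  using integrable_Xi by simp

lemma expectation_inner: "expectation (\<lambda>\<omega>. c \<bullet> \<Xi> l \<omega>) = 0"
  using integrable_Xi mean_zero by simp

lemma inner_mult_inner_le:
  fixes c d x :: 'm
  shows "\<bar>(c \<bullet> x) * (d \<bullet> x)\<bar> \<le> norm c * norm d * (norm x)\<^sup>2"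
proof -
  have "\<bar>(c \<bullet> x) * (d \<bullet> x)\<bar> \<le> (norm c * norm x) * (norm d * norm x)"
    unfolding abs_mult by (intro mult_mono Cauchy_Schwarz_ineq2) auto
  then show ?thesis by (simp add: power2_eq_square mult_ac)
qed

lemma integrable_inner_mult: "integrable M (\<lambda>\<omega>. (c \<bullet> \<Xi> l \<omega>) * (d \<bullet> \<Xi> l \<omega>))"
proof (rule Bochner_Integration.integrable_bound)
  show "integrable M (\<lambda>\<omega>. norm c * norm d * (norm (\<Xi> l \<omega>))\<^sup>2)" using integrable_sq by simp
  show "AE \<omega> in M. norm ((c \<bullet> \<Xi> l \<omega>) * (d \<bullet> \<Xi> l \<omega>)) \<le> norm (norm c * norm d * (norm (\<Xi> l \<omega>))\<^sup>2)"
    using inner_mult_inner_le by (intro AE_I2) (auto simp: abs_mult)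
qed measurable

lemma expectation_inner_mult_le:
  "\<bar>expectation (\<lambda>\<omega>. (c \<bullet> \<Xi> l \<omega>) * (d \<bullet> \<Xi> l \<omega>))\<bar> \<le> s * (norm c * norm d)"
proof -
  have "\<bar>expectation (\<lambda>\<omega>. (c \<bullet> \<Xi> l \<omega>) * (d \<bullet> \<Xi> l \<omega>))\<bar>
      \<le> expectation (\<lambda>\<omega>. norm c * norm d * (norm (\<Xi> l \<omega>))\<^sup>2)"
    using integrable_inner_mult integrable_sq inner_mult_inner_le
    by (intro order_trans[OF integral_abs_bound] integral_mono integrable_abs) auto
  then show ?thesis using second_moment by (simp add: mult.commute)
qed

definition lin :: "('k \<Rightarrow> int \<Rightarrow> 'm) \<Rightarrow> int set \<Rightarrow> 'k \<Rightarrow> 'a \<Rightarrow> real" where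
  "lin c L k \<omega> = (\<Sum>l\<in>L. c k l \<bullet> \<Xi> l \<omega>)"

text \<open>For finite L and B this is the sum of (c k l . \<Xi> l)(c k l' . \<Xi> l') over k in B
  and ordered pairs l \<noteq> l'. Written as square minus diagonal, it has a simple increment when
  an index is inserted in L.\<close>

definition offdiag :: "('k \<Rightarrow> int \<Rightarrow> 'm) \<Rightarrow> int set \<Rightarrow> 'k set \<Rightarrow> 'a \<Rightarrow> real" where
  "offdiag c L B \<omega> = (\<Sum>k\<in>B. (lin c L k \<omega>)\<^sup>2 - (\<Sum>l\<in>L. (c k l \<bullet> \<Xi> l \<omega>)\<^sup>2))"

lemma lin_measurable[measurable]: "lin c L k \<in> borel_measurable M"
  unfolding lin_def by measurable

lemma offdiag_measurable[measurable]: "offdiag c L B \<in> borel_measurable M"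
  unfolding offdiag_def by measurable

lemma lin_insert: "finite L \<Longrightarrow> i \<notin> L \<Longrightarrow> lin c (insert i L) k \<omega> = lin c L k \<omega> + c k i \<bullet> \<Xi> i \<omega>"
  by (simp add: lin_def)

lemma expectation_lin: "integrable M (lin c L k)" "expectation (lin c L k) = 0"
  unfolding lin_def using integrable_inner expectation_inner by (simp_all add: Bochner_Integration.integral_sum)

lemma restrict_eqs:
  "(\<Sum>l\<in>L. c k l \<bullet> restrict (\<lambda>l. \<Xi> l \<omega>) L l) = lin c L k \<omega>"
  "(\<Sum>k\<in>B. (lin c L k \<omega>)\<^sup>2 - (\<Sum>l\<in>L. (c k l \<bullet> restrict (\<lambda>l. \<Xi> l \<omega>) L l)\<^sup>2))
    = offdiag c L B \<omega>"
  by (simp_all add: lin_def offdiag_def)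

lemma indep_lin:
  assumes "i \<notin> L" "H \<in> borel_measurable borel"
  shows "indep_var borel (lin c L k) borel (\<lambda>\<omega>. H (\<Xi> i \<omega>))"
  by (rule indep_var_restrict_single[OF indep assms(1) _ assms(2),
        where F="\<lambda>z. \<Sum>l\<in>L. c k l \<bullet> z l"])
     (simp_all only: restrict_eqs, measurable)

lemma indep_lin_mult:
  assumes "i \<notin> L" "H \<in> borel_measurable borel"
  shows "indep_var borel (\<lambda>\<omega>. lin c L k \<omega> * lin c L k' \<omega>) borel (\<lambda>\<omega>. H (\<Xi> i \<omega>))"
  by (rule indep_var_restrict_single[OF indep assms(1) _ assms(2),
        where F="\<lambda>z. (\<Sum>l\<in>L. c k l \<bullet> z l) * (\<Sum>l\<in>L. c k' l \<bullet> z l)"])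
     (simp_all only: restrict_eqs, measurable)

lemma indep_offdiag_mult_lin:
  assumes "i \<notin> L" "H \<in> borel_measurable borel"
  shows "indep_var borel (\<lambda>\<omega>. offdiag c L B \<omega> * lin c L k \<omega>) borel (\<lambda>\<omega>. H (\<Xi> i \<omega>))"
  by (rule indep_var_restrict_single[OF indep assms(1) _ assms(2),
        where F="\<lambda>z. (\<Sum>k\<in>B. (\<Sum>l\<in>L. c k l \<bullet> z l)\<^sup>2 - (\<Sum>l\<in>L. (c k l \<bullet> z l)\<^sup>2))
           * (\<Sum>l\<in>L. c k l \<bullet> z l)"])
     (simp_all only: restrict_eqs, measurable)

lemma expectation_lin_mult:
  assumes "finite L"
  shows "integrable M (\<lambda>\<omega>. lin c L k \<omega> * lin c L k' \<omega>) \<and>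
    \<bar>expectation (\<lambda>\<omega>. lin c L k \<omega> * lin c L k' \<omega>)\<bar> \<le> s * (\<Sum>l\<in>L. norm (c k l) * norm (c k' l))"
  using assms
proof (induction L)
  case empty
  show ?case by (simp add: lin_def)
next
  case (insert i L)
  let ?x = "\<lambda>k \<omega>. c k i \<bullet> \<Xi> i \<omega>"
  have H: "(\<lambda>x. c k i \<bullet> x) \<in> borel_measurable borel" for k by measurable
  note 1 = indep_var_lebesgue_integral[OF indep_lin[OF insert.hyps(2) H] expectation_lin(1) integrable_inner]
  note 2 = indep_var_integrable[OF indep_lin[OF insert.hyps(2) H] expectation_lin(1) integrable_inner]
  have cross: "expectation (\<lambda>\<omega>. lin c L k \<omega> * ?x k' \<omega>) = 0" "integrable M (\<lambda>\<omega>. lin c L k \<omega> * ?x k' \<omega>)" for k k'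
    using 1 2 by (simp_all add: expectation_lin)
  have eq: "lin c (insert i L) k \<omega> * lin c (insert i L) k' \<omega> =
      lin c L k \<omega> * lin c L k' \<omega> + lin c L k \<omega> * ?x k' \<omega> + lin c L k' \<omega> * ?x k \<omega> + ?x k \<omega> * ?x k' \<omega>" for \<omega>
    using insert.hyps by (simp add: lin_insert algebra_simps)
  have ints: "integrable M (\<lambda>\<omega>. lin c L k \<omega> * lin c L k' \<omega>)" using insert.IH by blast
  have "expectation (\<lambda>\<omega>. lin c (insert i L) k \<omega> * lin c (insert i L) k' \<omega>)
     = expectation (\<lambda>\<omega>. lin c L k \<omega> * lin c L k' \<omega>) + expectation (\<lambda>\<omega>. ?x k \<omega> * ?x k' \<omega>)"
    unfolding eq using cross ints integrable_inner_mult by simp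
  moreover have "integrable M (\<lambda>\<omega>. lin c (insert i L) k \<omega> * lin c (insert i L) k' \<omega>)"
    unfolding eq using cross ints integrable_inner_mult by simp
  ultimately show ?case
    using insert.IH insert.hyps expectation_inner_mult_le[of "c k i" i "c k' i"]
      abs_triangle_ineq[of "expectation (\<lambda>\<omega>. lin c L k \<omega> * lin c L k' \<omega>)" "expectation (\<lambda>\<omega>. ?x k \<omega> * ?x k' \<omega>)"]
    by (simp only: sum.insert distrib_left simp_thms) linarith
qed

text \<open>Inserting i in L adds twice the sum of Y_k x_k over k, where x_k depends on \<Xi>_i only
  and Y_k on the other innovations: a martingale difference. Hence second moments add, and that of
  each increment factorises into covariances, so second moments of the innovations suffice.\<close>

lemma expectation_offdiag_sq_le:
  assumes L: "finite L" and B: "finite B"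
  shows "integrable M (\<lambda>\<omega>. (offdiag c L B \<omega>)\<^sup>2) \<and>
    expectation (\<lambda>\<omega>. (offdiag c L B \<omega>)\<^sup>2)
      \<le> 2 * s\<^sup>2 * (\<Sum>k\<in>B. \<Sum>k'\<in>B. (\<Sum>l\<in>L. norm (c k l) * norm (c k' l))\<^sup>2)"
  using L
proof (induction L)
  case empty
  show ?case by (simp add: offdiag_def lin_def)
next
  case (insert i L)
  let ?x = "\<lambda>k \<omega>. c k i \<bullet> \<Xi> i \<omega>"
  let ?V = "offdiag c L B" and ?Y = "lin c L"
  let ?\<rho> = "\<lambda>k k'. \<Sum>l\<in>L. norm (c k l) * norm (c k' l)"
  let ?n = "\<lambda>k k'. norm (c k i) * norm (c k' i)"
  have H: "(\<lambda>x. c k i \<bullet> x) \<in> borel_measurable borel" for k by measurable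
  have H2: "(\<lambda>x. (c k i \<bullet> x) * (c k' i \<bullet> x)) \<in> borel_measurable borel" for k k' by measurable
  have iYY: "integrable M (\<lambda>\<omega>. ?Y k \<omega> * ?Y k' \<omega>)" for k k'
    by (rule conjunct1[OF expectation_lin_mult[OF insert.hyps(1)]])
  have iVV: "integrable M (\<lambda>\<omega>. (?V \<omega>)\<^sup>2)" using insert.IH by blast
  have iVY: "integrable M (\<lambda>\<omega>. ?V \<omega> * ?Y k \<omega>)" for k
  proof (rule Bochner_Integration.integrable_bound)
    show "integrable M (\<lambda>\<omega>. (?V \<omega>)\<^sup>2 + ?Y k \<omega> * ?Y k \<omega>)" using iVV iYY by simp
    have "\<bar>a * b\<bar> \<le> a\<^sup>2 + b * b" for a b :: real
    proof -
      have "0 \<le> (a - b)\<^sup>2" "0 \<le> (a + b)\<^sup>2" "0 \<le> a\<^sup>2 + b * b" by simp_all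
      then show ?thesis unfolding abs_le_iff power2_eq_square by (simp add: algebra_simps)
    qed
    then show "AE \<omega> in M. norm (?V \<omega> * ?Y k \<omega>) \<le> norm ((?V \<omega>)\<^sup>2 + ?Y k \<omega> * ?Y k \<omega>)"
      unfolding real_norm_def by (intro AE_I2 order_trans[OF _ abs_ge_self])
  qed measurable
  have c1: "expectation (\<lambda>\<omega>. (?V \<omega> * ?Y k \<omega>) * ?x k \<omega>) = 0" "integrable M (\<lambda>\<omega>. (?V \<omega> * ?Y k \<omega>) * ?x k \<omega>)" for k
    using indep_var_lebesgue_integral[OF indep_offdiag_mult_lin[OF insert.hyps(2) H] iVY integrable_inner]
      indep_var_integrable[OF indep_offdiag_mult_lin[OF insert.hyps(2) H] iVY integrable_inner]
    by (simp_all add: expectation_inner)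
  have c2: "expectation (\<lambda>\<omega>. (?Y k \<omega> * ?Y k' \<omega>) * (?x k \<omega> * ?x k' \<omega>)) \<le> (s * ?\<rho> k k') * (s * ?n k k')"
    "integrable M (\<lambda>\<omega>. (?Y k \<omega> * ?Y k' \<omega>) * (?x k \<omega> * ?x k' \<omega>))" for k k'
  proof -
    have "expectation (\<lambda>\<omega>. (?Y k \<omega> * ?Y k' \<omega>) * (?x k \<omega> * ?x k' \<omega>)) =
        expectation (\<lambda>\<omega>. ?Y k \<omega> * ?Y k' \<omega>) * expectation (\<lambda>\<omega>. ?x k \<omega> * ?x k' \<omega>)"
      by (rule indep_var_lebesgue_integral[OF indep_lin_mult[OF insert.hyps(2) H2] iYY integrable_inner_mult])
    also have "\<dots> \<le> \<bar>expectation (\<lambda>\<omega>. ?Y k \<omega> * ?Y k' \<omega>)\<bar> * \<bar>expectation (\<lambda>\<omega>. ?x k \<omega> * ?x k' \<omega>)\<bar>"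
      unfolding abs_mult[symmetric] by (rule abs_ge_self)
    also have "\<dots> \<le> (s * ?\<rho> k k') * (s * ?n k k')"
      by (intro mult_mono conjunct2[OF expectation_lin_mult[OF insert.hyps(1)]]
            expectation_inner_mult_le mult_nonneg_nonneg sum_nonneg s_nonneg) auto
    finally show "expectation (\<lambda>\<omega>. (?Y k \<omega> * ?Y k' \<omega>) * (?x k \<omega> * ?x k' \<omega>)) \<le> (s * ?\<rho> k k') * (s * ?n k k')" .
    show "integrable M (\<lambda>\<omega>. (?Y k \<omega> * ?Y k' \<omega>) * (?x k \<omega> * ?x k' \<omega>))"
      by (rule indep_var_integrable[OF indep_lin_mult[OF insert.hyps(2) H2] iYY integrable_inner_mult])
  qed
  \<comment> \<open>Squaring Y_k + x_k also produces x_k^2, which is exactly the new diagonal term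
    subtracted in \<open>offdiag\<close>.\<close>
  have Veq: "offdiag c (insert i L) B \<omega> = ?V \<omega> + 2 * (\<Sum>k\<in>B. ?Y k \<omega> * ?x k \<omega>)" for \<omega>
    unfolding offdiag_def sum_distrib_left sum.distrib[symmetric] using insert.hyps
    by (intro sum.cong refl) (simp add: lin_insert power2_eq_square algebra_simps)
  have Vsq: "(offdiag c (insert i L) B \<omega>)\<^sup>2 = (?V \<omega>)\<^sup>2 + 4 * (\<Sum>k\<in>B. (?V \<omega> * ?Y k \<omega>) * ?x k \<omega>)
      + 4 * (\<Sum>k\<in>B. \<Sum>k'\<in>B. (?Y k \<omega> * ?Y k' \<omega>) * (?x k \<omega> * ?x k' \<omega>))" for \<omega>
  proof -
    have "(\<Sum>k\<in>B. ?Y k \<omega> * ?x k \<omega>)\<^sup>2 = (\<Sum>k\<in>B. \<Sum>k'\<in>B. (?Y k \<omega> * ?Y k' \<omega>) * (?x k \<omega> * ?x k' \<omega>))"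
      unfolding power2_eq_square sum_product by (intro sum.cong refl) simp
    moreover have "?V \<omega> * (\<Sum>k\<in>B. ?Y k \<omega> * ?x k \<omega>) = (\<Sum>k\<in>B. (?V \<omega> * ?Y k \<omega>) * ?x k \<omega>)"
      unfolding sum_distrib_left by (intro sum.cong refl) simp
    ultimately show ?thesis unfolding Veq by (simp add: power2_sum algebra_simps power_mult_distrib)
  qed
  have "integrable M (\<lambda>\<omega>. (offdiag c (insert i L) B \<omega>)\<^sup>2)"
    unfolding Vsq using iVV c1(2) c2(2) by simp
  moreover have "expectation (\<lambda>\<omega>. (offdiag c (insert i L) B \<omega>)\<^sup>2)
      \<le> 2 * s\<^sup>2 * (\<Sum>k\<in>B. \<Sum>k'\<in>B. (?\<rho> k k' + ?n k k')\<^sup>2)"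
  proof -
    have "expectation (\<lambda>\<omega>. (offdiag c (insert i L) B \<omega>)\<^sup>2) = expectation (\<lambda>\<omega>. (?V \<omega>)\<^sup>2)
      + 4 * (\<Sum>k\<in>B. \<Sum>k'\<in>B. expectation (\<lambda>\<omega>. (?Y k \<omega> * ?Y k' \<omega>) * (?x k \<omega> * ?x k' \<omega>)))"
      unfolding Vsq using iVV c1 c2(2) by simp
    also have "\<dots> \<le> 2 * s\<^sup>2 * (\<Sum>k\<in>B. \<Sum>k'\<in>B. (?\<rho> k k')\<^sup>2)
      + 4 * (\<Sum>k\<in>B. \<Sum>k'\<in>B. (s * ?\<rho> k k') * (s * ?n k k'))"
      using insert.IH by (intro add_mono mult_left_mono sum_mono c2(1)) simp_all
    also have "\<dots> \<le> 2 * s\<^sup>2 * (\<Sum>k\<in>B. \<Sum>k'\<in>B. (?\<rho> k k' + ?n k k')\<^sup>2)"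
      by (rule double_sum_square_add_le)
    finally show ?thesis .
  qed
  ultimately show ?case using insert.hyps by (simp add: add.commute)
qed

end

section \<open>Diagonal part and convolution bounds\<close>

lemma sum_int_le_two_suminf:
  fixes w :: "nat \<Rightarrow> real"
  assumes w: "\<And>n. 0 \<le> w n" "summable w" and L: "finite L"
  shows "(\<Sum>l\<in>L. w (nat \<bar>l\<bar>)) \<le> 2 * (\<Sum>n. w n)"
proof -
  have "(\<Sum>l\<in>L. w (nat \<bar>l\<bar>)) = (\<Sum>l\<in>L \<inter> {0..}. w (nat \<bar>l\<bar>)) + (\<Sum>l\<in>L - {0..}. w (nat \<bar>l\<bar>))"
    using L by (metis sum.Int_Diff)
  also have "(\<Sum>l\<in>L \<inter> {0..}. w (nat \<bar>l\<bar>)) = sum w ((\<lambda>l. nat \<bar>l\<bar>) ` (L \<inter> {0..}))"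
    by (subst sum.reindex) (auto simp: inj_on_def)
  also have "(\<Sum>l\<in>L - {0..}. w (nat \<bar>l\<bar>)) = sum w ((\<lambda>l. nat \<bar>l\<bar>) ` (L - {0..}))"
    by (subst sum.reindex) (auto simp: inj_on_def)
  also have "sum w ((\<lambda>l. nat \<bar>l\<bar>) ` (L \<inter> {0..})) \<le> (\<Sum>n. w n)"
    using w L by (intro sum_le_suminf) auto
  also have "sum w ((\<lambda>l. nat \<bar>l\<bar>) ` (L - {0..})) \<le> (\<Sum>n. w n)"
    using w L by (intro sum_le_suminf) auto
  finally show ?thesis by simp
qed

text \<open>With \<open>\<epsilon> = \<beta> + 2\<sigma> - 2 > 0\<close>, trade all but the exponent \<open>1 + \<epsilon>\<close> of the smaller of the two
  distances for the larger one, which is at least half of \<open>1 + \<bar>k - k'\<bar>\<close>.\<close>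
lemma powr_convolution_term_le:
  fixes u v d \<sigma> \<beta> :: real
  assumes "1 \<le> u" "1 \<le> v" "1 \<le> d" "d + 1 \<le> u + v"
    and "1/2 < \<sigma>" "1/2 < \<beta>" "\<beta> < 1" "2 - 2 * \<sigma> < \<beta>"
  shows "u powr (-\<sigma>) * v powr (-\<sigma>)
    \<le> 2 * d powr (\<beta> - 1) * (u powr (-(\<beta> + 2 * \<sigma> - 1)) + v powr (-(\<beta> + 2 * \<sigma> - 1)))"
proof -
  have *: "u powr (-\<sigma>) * v powr (-\<sigma>) \<le> 2 * d powr (\<beta> - 1) * u powr (-(\<beta> + 2 * \<sigma> - 1))"
    if uv: "u \<le> v" "1 \<le> u" "d + 1 \<le> u + v" for u v
  proof -
    have "v powr (-\<sigma>) = v powr (-(\<beta> + \<sigma> - 1)) * v powr (\<beta> - 1)"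
      unfolding powr_add[symmetric] by simp
    \<comment> \<open>v is the larger distance: v >= u serves the first factor, which is decreasing
      because \<beta> + \<sigma> > 1, and v >= d/2 serves the second.\<close>
    also have "\<dots> \<le> u powr (-(\<beta> + \<sigma> - 1)) * (d / 2) powr (\<beta> - 1)"
      using uv assms by (intro mult_mono powr_mono2') auto
    also have "(d / 2) powr (\<beta> - 1) = 2 powr (1 - \<beta>) * d powr (\<beta> - 1)"
      using assms by (simp add: powr_divide powr_diff field_simps)
    also have "\<dots> \<le> 2 powr 1 * d powr (\<beta> - 1)"
      using assms by (intro mult_right_mono powr_mono) auto
    finally have "u powr (-\<sigma>) * v powr (-\<sigma>)
        \<le> u powr (-\<sigma>) * (u powr (-(\<beta> + \<sigma> - 1)) * (2 * d powr (\<beta> - 1)))"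
      by (simp add: mult_left_mono)
    also have "\<dots> = 2 * d powr (\<beta> - 1) * (u powr (-\<sigma>) * u powr (-(\<beta> + \<sigma> - 1)))" by simp
    also have "u powr (-\<sigma>) * u powr (-(\<beta> + \<sigma> - 1)) = u powr (-(\<beta> + 2 * \<sigma> - 1))"
      unfolding powr_add[symmetric] by (simp add: algebra_simps)
    finally show ?thesis .
  qed
  have nn: "0 \<le> 2 * d powr (\<beta> - 1) * x powr (-(\<beta> + 2 * \<sigma> - 1))" for x by simp
  show ?thesis
  proof (cases "u \<le> v")
    case True
    show ?thesis using *[OF True assms(1,4)] nn[of v] unfolding distrib_left by linarith
  next
    case False
    then have "v powr (-\<sigma>) * u powr (-\<sigma>) \<le> 2 * d powr (\<beta> - 1) * v powr (-(\<beta> + 2 * \<sigma> - 1))"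
      using assms by (intro *) auto
    then show ?thesis using nn[of u] unfolding distrib_left mult.commute[of "u powr (-\<sigma>)"] by linarith
  qed
qed

lemma summable_shift_powr: "a < -1 \<Longrightarrow> summable (\<lambda>n. (1 + real n) powr a)"
  using summable_real_powr_iff[of a] summable_Suc_iff[of "\<lambda>n. real n powr a"] by (simp add: add.commute)

lemma finite_sum_int_powr_le:
  fixes e :: real
  assumes "1 < e"
  shows "\<exists>Z\<ge>0. \<forall>L k. finite L \<longrightarrow> (\<Sum>l\<in>L. (1 + \<bar>real_of_int (k - l)\<bar>) powr (-e)) \<le> Z"
proof (intro exI[of _ "2 * (\<Sum>n. (1 + real n) powr (-e))"] conjI allI impI)
  have sm: "summable (\<lambda>n. (1 + real n) powr (-e))" using assms by (intro summable_shift_powr) auto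
  show "0 \<le> 2 * (\<Sum>n. (1 + real n) powr (-e))" using sm by (simp add: suminf_nonneg)
  fix L :: "int set" and k :: int assume "finite L"
  have "(\<Sum>l\<in>L. (1 + \<bar>real_of_int (k - l)\<bar>) powr (-e))
      = (\<Sum>l\<in>(\<lambda>l. k - l) ` L. (1 + real (nat \<bar>l\<bar>)) powr (-e))"
    by (subst sum.reindex) (auto simp: inj_on_def)
  also have "\<dots> \<le> 2 * (\<Sum>n. (1 + real n) powr (-e))"
    using sm \<open>finite L\<close> by (intro sum_int_le_two_suminf) auto
  finally show "(\<Sum>l\<in>L. (1 + \<bar>real_of_int (k - l)\<bar>) powr (-e)) \<le> 2 * (\<Sum>n. (1 + real n) powr (-e))" .
qed

text \<open>In effect this bounds the autocovariances of a linear process with coefficients of order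
  |l|^(-\<sigma>). The exponent \<beta> - 1 lies strictly above the natural 1 - 2\<sigma>, so the
  logarithm at \<sigma> = 1 needs no separate case. The removal of the truncation relies on
  uniformity in L.\<close>

lemma convolution_powr_le:
  fixes \<sigma> \<beta> :: real
  assumes "1/2 < \<sigma>" "1/2 < \<beta>" "\<beta> < 1" "2 - 2 * \<sigma> < \<beta>"
  shows "\<exists>Z\<ge>0. \<forall>L k k'. finite L \<longrightarrow>
    (\<Sum>l\<in>L. (1 + \<bar>real_of_int (k - l)\<bar>) powr (-\<sigma>) * (1 + \<bar>real_of_int (k' - l)\<bar>) powr (-\<sigma>))
      \<le> Z * (1 + \<bar>real_of_int (k - k')\<bar>) powr (\<beta> - 1)"
proof -
  have "1 < \<beta> + 2 * \<sigma> - 1" using assms by simp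
  from finite_sum_int_powr_le[OF this] obtain Z where Z: "0 \<le> Z"
    "\<And>L k. finite L \<Longrightarrow> (\<Sum>l\<in>L. (1 + \<bar>real_of_int (k - l)\<bar>) powr (-(\<beta> + 2 * \<sigma> - 1))) \<le> Z"
    by blast
  have "(\<Sum>l\<in>L. (1 + \<bar>real_of_int (k - l)\<bar>) powr (-\<sigma>) * (1 + \<bar>real_of_int (k' - l)\<bar>) powr (-\<sigma>))
      \<le> (4 * Z) * (1 + \<bar>real_of_int (k - k')\<bar>) powr (\<beta> - 1)" if L: "finite L" for L k k'
  proof -
    let ?d = "1 + \<bar>real_of_int (k - k')\<bar>" and ?a = "\<lambda>k l. (1 + \<bar>real_of_int (k - l)\<bar>)"
    have "(\<Sum>l\<in>L. ?a k l powr (-\<sigma>) * ?a k' l powr (-\<sigma>))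
       \<le> (\<Sum>l\<in>L. 2 * ?d powr (\<beta> - 1) *
            (?a k l powr (-(\<beta> + 2 * \<sigma> - 1)) + ?a k' l powr (-(\<beta> + 2 * \<sigma> - 1))))"
      by (intro sum_mono powr_convolution_term_le) (use assms in auto)
    also have "\<dots> = 2 * ?d powr (\<beta> - 1) * ((\<Sum>l\<in>L. ?a k l powr (-(\<beta> + 2 * \<sigma> - 1)))
            + (\<Sum>l\<in>L. ?a k' l powr (-(\<beta> + 2 * \<sigma> - 1))))"
      unfolding sum.distrib[symmetric] sum_distrib_left ..
    also have "\<dots> \<le> 2 * ?d powr (\<beta> - 1) * (Z + Z)"
      by (intro mult_left_mono add_mono Z L) auto
    finally show ?thesis by (simp add: mult_ac)
  qed
  then show ?thesis using Z(1) by (intro exI[of _ "4 * Z"]) auto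
qed

text \<open>With e = 2(\<beta>' - \<beta>) the exponent 2\<beta> - 2 splits as -(1 + e) + (2\<beta>'
  - 1). The first part is summable over k', the second contributes at most m^(2\<beta>' - 1), and
  the sum over k supplies the last factor m.\<close>

lemma double_sum_powr_le:
  fixes \<beta> \<beta>' :: real
  assumes "1/2 < \<beta>" "\<beta> < \<beta>'"
  shows "\<exists>Z\<ge>0. \<forall>a m. (\<Sum>k\<in>{a<..a + int m}. \<Sum>k'\<in>{a<..a + int m}. ((1 + \<bar>real_of_int (k - k')\<bar>) powr (\<beta> - 1))\<^sup>2)
      \<le> Z * real m powr (2 * \<beta>')"
proof -
  define e where "e = 2 * (\<beta>' - \<beta>)"
  have e: "0 < e" using assms by (simp add: e_def)
  from finite_sum_int_powr_le[of "1 + e"] e obtain Z where Z: "0 \<le> Z"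
    "\<And>L k. finite L \<Longrightarrow> (\<Sum>l\<in>L. (1 + \<bar>real_of_int (k - l)\<bar>) powr (-(1 + e))) \<le> Z"
    by auto
  have "(\<Sum>k\<in>{a<..a + int m}. \<Sum>k'\<in>{a<..a + int m}. ((1 + \<bar>real_of_int (k - k')\<bar>) powr (\<beta> - 1))\<^sup>2)
      \<le> Z * real m powr (2 * \<beta>')" for a m
  proof (cases "m = 0")
    case False
    have "((1 + \<bar>real_of_int (k - k')\<bar>) powr (\<beta> - 1))\<^sup>2
        \<le> (1 + \<bar>real_of_int (k - k')\<bar>) powr (-(1 + e)) * real m powr (2 * \<beta>' - 1)"
      if "k \<in> {a<..a + int m}" "k' \<in> {a<..a + int m}" for k k'
    proof -
      let ?d = "1 + \<bar>real_of_int (k - k')\<bar>"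
      \<comment> \<open>In a half-open block of m integers |k - k'| <= m - 1, so even the shifted
        distance is at most m.\<close>
      have d: "0 < ?d" "?d \<le> real m" using that by auto
      have "(?d powr (\<beta> - 1))\<^sup>2 = ?d powr (-(1 + e)) * ?d powr (2 * \<beta>' - 1)"
        unfolding power2_eq_square powr_add[symmetric] by (simp add: e_def algebra_simps)
      also have "\<dots> \<le> ?d powr (-(1 + e)) * real m powr (2 * \<beta>' - 1)"
        using d assms by (intro mult_left_mono powr_mono2) auto
      finally show ?thesis .
    qed
    then have "(\<Sum>k\<in>{a<..a + int m}. \<Sum>k'\<in>{a<..a + int m}. ((1 + \<bar>real_of_int (k - k')\<bar>) powr (\<beta> - 1))\<^sup>2)
      \<le> (\<Sum>k\<in>{a<..a + int m}. \<Sum>k'\<in>{a<..a + int m}.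
          (1 + \<bar>real_of_int (k - k')\<bar>) powr (-(1 + e)) * real m powr (2 * \<beta>' - 1))"
      by (intro sum_mono)
    also have "\<dots> \<le> (\<Sum>k\<in>{a<..a + int m}. Z * real m powr (2 * \<beta>' - 1))"
      unfolding sum_distrib_right[symmetric] by (intro sum_mono mult_right_mono Z) auto
    also have "\<dots> = Z * (real m powr 1 * real m powr (2 * \<beta>' - 1))" using False by simp
    also have "\<dots> = Z * real m powr (2 * \<beta>')" unfolding powr_add[symmetric] by simp
    finally show ?thesis .
  qed simp
  then show ?thesis using Z(1) by blast
qed

section \<open>Moments of order p of the diagonal part\<close>

context prob_space begin

text \<open>Jensen's inequality, obtained by taking expectations in the tangent bound for x^(p/2) at
  x = T. As T only has to dominate the second moment, V = 0 needs no separate treatment.\<close>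

lemma expectation_abs_powr_le_of_sq:
  fixes V :: "'a \<Rightarrow> real"
  assumes [measurable]: "V \<in> borel_measurable M" and int: "integrable M (\<lambda>\<omega>. (V \<omega>)\<^sup>2)"
    and p: "0 < p" "p \<le> 2" and T: "0 < T" "expectation (\<lambda>\<omega>. (V \<omega>)\<^sup>2) \<le> T"
  shows "integrable M (\<lambda>\<omega>. \<bar>V \<omega>\<bar> powr p) \<and> expectation (\<lambda>\<omega>. \<bar>V \<omega>\<bar> powr p) \<le> T powr (p/2)"
proof -
  let ?b = "\<lambda>\<omega>. T powr (p/2) * (1 + p/2 * ((V \<omega>)\<^sup>2 / T - 1))"
  have le: "\<bar>V \<omega>\<bar> powr p \<le> ?b \<omega>" for \<omega>
  proof -
    have "\<bar>V \<omega>\<bar> powr 2 = (V \<omega>)\<^sup>2" by (cases "V \<omega> = 0") auto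
    then have "\<bar>V \<omega>\<bar> powr p = ((V \<omega>)\<^sup>2) powr (p/2)" using powr_powr[of "\<bar>V \<omega>\<bar>" 2 "p/2"] by simp
    also have "\<dots> = (T * ((V \<omega>)\<^sup>2 / T)) powr (p/2)" using T by simp
    also have "\<dots> = T powr (p/2) * ((V \<omega>)\<^sup>2 / T) powr (p/2)" by (simp only: powr_mult)
    also have "\<dots> \<le> ?b \<omega>" using T p by (intro mult_left_mono powr_le_tangent) auto
    finally show ?thesis .
  qed
  have ib: "integrable M ?b" using int by simp
  have i: "integrable M (\<lambda>\<omega>. \<bar>V \<omega>\<bar> powr p)"
    by (rule Bochner_Integration.integrable_bound[OF ib])
       (use le in \<open>auto intro!: AE_I2 intro: order_trans[OF _ abs_ge_self]\<close>)
  have "expectation (\<lambda>\<omega>. \<bar>V \<omega>\<bar> powr p) \<le> expectation ?b" by (intro integral_mono i ib le)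
  also have "\<dots> = T powr (p/2) * (1 + p/2 * (expectation (\<lambda>\<omega>. (V \<omega>)\<^sup>2) / T - 1))"
    using int by (simp add: prob_space)
  also have "\<dots> \<le> T powr (p/2) * (1 + p/2 * 0)"
    using T p by (intro mult_left_mono add_left_mono) auto
  finally show ?thesis using i by simp
qed

end

context centered_innovations begin

definition var_inner :: "int \<Rightarrow> 'm \<Rightarrow> real" where
  "var_inner l c = expectation (\<lambda>\<omega>. (c \<bullet> \<Xi> l \<omega>)\<^sup>2)"

lemma integrable_inner_sq: "integrable M (\<lambda>\<omega>. (c \<bullet> \<Xi> l \<omega>)\<^sup>2)"
  using integrable_inner_mult[of c l c] by (simp add: power2_eq_square)

lemma var_inner_bounds: "0 \<le> var_inner l c" "var_inner l c \<le> s * (norm c)\<^sup>2"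
  using expectation_inner_mult_le[of c l c] by (auto simp: var_inner_def power2_eq_square)

text \<open>The sum over l stands outside because each inner sum is a function of \<Xi> l alone: the
  outer summands are independent, whereas the contributions of different k are not.\<close>

definition diag :: "('k \<Rightarrow> int \<Rightarrow> 'm) \<Rightarrow> int set \<Rightarrow> 'k set \<Rightarrow> 'a \<Rightarrow> real" where
  "diag c L B \<omega> = (\<Sum>l\<in>L. \<Sum>k\<in>B. (c k l \<bullet> \<Xi> l \<omega>)\<^sup>2 - var_inner l (c k l))"

lemma diag_measurable[measurable]: "diag c L B \<in> borel_measurable M"
  unfolding diag_def by measurable

text \<open>The l-th summand is at most w_l (|\<Xi>_l|^2 + s), where w_l is the sum of |c k l|^2
  over k. The column bound \<open>W1\<close> gives w_l^p <= W^(p-1) w_l, and after exchanging the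
  sums the row bound \<open>W2\<close> bounds the sum of the w_l by W times the size of B. The
  constant is 6 times 4, from the inequality for independent sums and from
  \<open>abs_powr_add_le_convex\<close>.\<close>

lemma expectation_abs_diag_powr_le:
  assumes L: "finite L" and B: "finite B" and p: "1 < p" "p \<le> 2"
    and mom: "\<And>l. integrable M (\<lambda>\<omega>. ((norm (\<Xi> l \<omega>))\<^sup>2) powr p)"
      "\<And>l. expectation (\<lambda>\<omega>. ((norm (\<Xi> l \<omega>))\<^sup>2) powr p) = sp"
    and W1: "\<And>l. l \<in> L \<Longrightarrow> (\<Sum>k\<in>B. (norm (c k l))\<^sup>2) \<le> W"
    and W2: "\<And>k. k \<in> B \<Longrightarrow> (\<Sum>l\<in>L. (norm (c k l))\<^sup>2) \<le> W"
    and W: "0 \<le> W"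
  shows "integrable M (\<lambda>\<omega>. \<bar>diag c L B \<omega>\<bar> powr p) \<and>
    expectation (\<lambda>\<omega>. \<bar>diag c L B \<omega>\<bar> powr p) \<le> 24 * (sp + s powr p) * W powr p * real (card B)"
proof -
  define X where "X = (\<lambda>l \<omega>. \<Sum>k\<in>B. (c k l \<bullet> \<Xi> l \<omega>)\<^sup>2 - var_inner l (c k l))"
  define w where "w = (\<lambda>l. \<Sum>k\<in>B. (norm (c k l))\<^sup>2)"
  have w0: "0 \<le> w l" for l unfolding w_def by (intro sum_nonneg) auto
  have Xm[measurable]: "X l \<in> borel_measurable M" for l unfolding X_def by measurable
  have Xb: "\<bar>X l \<omega>\<bar> powr p \<le> w l powr p * (4 * ((norm (\<Xi> l \<omega>))\<^sup>2) powr p + 4 * s powr p)" for l \<omega>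
  proof -
    have "\<bar>X l \<omega>\<bar> \<le> (\<Sum>k\<in>B. \<bar>(c k l \<bullet> \<Xi> l \<omega>)\<^sup>2 - var_inner l (c k l)\<bar>)"
      unfolding X_def by (rule sum_abs)
    also have "\<dots> \<le> (\<Sum>k\<in>B. (norm (c k l))\<^sup>2 * ((norm (\<Xi> l \<omega>))\<^sup>2 + s))"
    proof (intro sum_mono)
      fix k
      have "(c k l \<bullet> \<Xi> l \<omega>)\<^sup>2 \<le> (norm (c k l))\<^sup>2 * (norm (\<Xi> l \<omega>))\<^sup>2"
        using inner_mult_inner_le[of "c k l" "\<Xi> l \<omega>" "c k l"] by (simp add: power2_eq_square)
      then show "\<bar>(c k l \<bullet> \<Xi> l \<omega>)\<^sup>2 - var_inner l (c k l)\<bar> \<le> (norm (c k l))\<^sup>2 * ((norm (\<Xi> l \<omega>))\<^sup>2 + s)"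
        using var_inner_bounds[of l "c k l"] zero_le_power2[of "c k l \<bullet> \<Xi> l \<omega>"]
          mult_nonneg_nonneg[OF zero_le_power2[of "norm (c k l)"] zero_le_power2[of "norm (\<Xi> l \<omega>)"]]
        unfolding distrib_left mult.commute[of s] by linarith
    qed
    also have "\<dots> = w l * ((norm (\<Xi> l \<omega>))\<^sup>2 + s)" by (simp add: w_def sum_distrib_right)
    finally have "\<bar>X l \<omega>\<bar> powr p \<le> (w l * ((norm (\<Xi> l \<omega>))\<^sup>2 + s)) powr p"
      using p by (intro powr_mono2) auto
    also have "\<dots> = w l powr p * \<bar>(norm (\<Xi> l \<omega>))\<^sup>2 + s\<bar> powr p" using s_nonneg by (simp add: powr_mult)
    also have "\<dots> \<le> w l powr p * (4 * \<bar>(norm (\<Xi> l \<omega>))\<^sup>2\<bar> powr p + 4 * \<bar>s\<bar> powr p)"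
      by (intro mult_left_mono abs_powr_add_le_convex p) auto
    finally show ?thesis using s_nonneg by simp
  qed
  let ?b = "\<lambda>l \<omega>. w l powr p * (4 * ((norm (\<Xi> l \<omega>))\<^sup>2) powr p + 4 * s powr p)"
  have ib: "integrable M (?b l)" for l using mom by simp
  have iX: "integrable M (\<lambda>\<omega>. \<bar>X l \<omega>\<bar> powr p)" for l
    by (rule Bochner_Integration.integrable_bound[OF ib[of l]])
       (use Xb in \<open>auto intro!: AE_I2 intro: order_trans[OF _ abs_ge_self]\<close>)
  have EX: "expectation (\<lambda>\<omega>. \<bar>X l \<omega>\<bar> powr p) \<le> 4 * (sp + s powr p) * w l powr p" for l
  proof -
    have "expectation (\<lambda>\<omega>. \<bar>X l \<omega>\<bar> powr p) \<le> expectation (?b l)"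
      by (intro integral_mono iX ib Xb)
    also have "\<dots> = w l powr p * (4 * sp + 4 * s powr p)"
      using mom by (simp add: prob_space)
    finally show ?thesis by (simp add: algebra_simps)
  qed
  have meanX: "expectation (X l) = 0" for l
    unfolding X_def using integrable_inner_sq by (simp add: Bochner_Integration.integral_sum var_inner_def prob_space)
  have indepX: "indep_vars (\<lambda>_. borel) X L"
  proof -
    have "indep_vars (\<lambda>_. borel) \<Xi> L" by (rule indep_vars_subset[OF indep]) auto
    then show ?thesis unfolding X_def
      by (rule indep_vars_compose2[where Y="\<lambda>l x. \<Sum>k\<in>B. (c k l \<bullet> x)\<^sup>2 - var_inner l (c k l)"]) simp
  qed
  have sum: "(\<Sum>l\<in>L. w l powr p) \<le> W powr p * real (card B)"
  proof -
    have "(\<Sum>l\<in>L. w l powr p) \<le> (\<Sum>l\<in>L. W powr (p - 1) * w l)"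
    proof (intro sum_mono)
      fix l assume l: "l \<in> L"
      show "w l powr p \<le> W powr (p - 1) * w l"
      proof (cases "w l = 0")
        case False
        then have "w l powr p = w l powr (p - 1) * w l" using w0[of l] by (simp add: powr_diff)
        also have "\<dots> \<le> W powr (p - 1) * w l"
          using W1[OF l] p w0[of l] by (intro mult_right_mono powr_mono2) (auto simp: w_def)
        finally show ?thesis .
      qed simp
    qed
    also have "\<dots> = W powr (p - 1) * (\<Sum>k\<in>B. \<Sum>l\<in>L. (norm (c k l))\<^sup>2)"
      unfolding w_def sum_distrib_left[symmetric] by (subst sum.swap) simp
    also have "\<dots> \<le> W powr (p - 1) * (\<Sum>k\<in>B. W)" by (intro mult_left_mono sum_mono W2) auto
    also have "\<dots> = W powr p * real (card B)"
      using W by (cases "W = 0") (auto simp: powr_diff)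
    finally show ?thesis .
  qed
  have sp: "0 \<le> sp" using mom(2)[of 0] by (metis integral_nonneg_AE AE_I2 powr_ge_zero)
  have diag_X: "diag c L B \<omega> = (\<Sum>l\<in>L. X l \<omega>)" for \<omega> by (simp add: diag_def X_def)
  have "integrable M (\<lambda>\<omega>. \<bar>diag c L B \<omega>\<bar> powr p) \<and>
     expectation (\<lambda>\<omega>. \<bar>diag c L B \<omega>\<bar> powr p) \<le> 6 * (\<Sum>l\<in>L. expectation (\<lambda>\<omega>. \<bar>X l \<omega>\<bar> powr p))"
    unfolding diag_X
    by (rule expectation_abs_sum_powr_le[OF p L indepX iX meanX])
  moreover have "(\<Sum>l\<in>L. expectation (\<lambda>\<omega>. \<bar>X l \<omega>\<bar> powr p)) \<le> 4 * (sp + s powr p) * (W powr p * real (card B))"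
  proof -
    have "(\<Sum>l\<in>L. expectation (\<lambda>\<omega>. \<bar>X l \<omega>\<bar> powr p)) \<le> (\<Sum>l\<in>L. 4 * (sp + s powr p) * w l powr p)"
      by (intro sum_mono EX)
    also have "\<dots> \<le> 4 * (sp + s powr p) * (W powr p * real (card B))"
      unfolding sum_distrib_left[symmetric] using sp by (intro mult_left_mono sum) auto
    finally show ?thesis .
  qed
  ultimately show ?thesis by linarith
qed

end

section \<open>From block moments to almost sure bounds\<close>

text \<open>Strip the lowest binary digit of q: if it is 1, one block of length 2^i is removed, and
  what is left lives at scale i + 1. At most b blocks are used, each weighted by its right end
  point, which does not exceed 2^i q. This takes the place of a maximal inequality.\<close>

lemma dyadic_chaining:
  fixes s :: "nat \<Rightarrow> real"
  assumes s0: "s 0 = 0" and w: "0 \<le> w" and \<beta>: "0 \<le> \<beta>"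
    and block: "\<And>i j. \<bar>s (2^i * (j + 1)) - s (2^i * j)\<bar> \<le> w * real (2^i * (j + 1)) powr \<beta>"
    and q: "q < 2^b"
  shows "\<bar>s (2^i * q)\<bar> \<le> w * real b * real (2^i * q) powr \<beta>"
  using q
proof (induction b arbitrary: i q)
  case 0
  then show ?case using s0 by simp
next
  case (Suc b)
  define r where "r = q div 2"
  have r: "r < 2^b" using Suc.prems by (auto simp: r_def)
  have IH: "\<bar>s (2^Suc i * r)\<bar> \<le> w * real b * real (2^Suc i * r) powr \<beta>" by (rule Suc.IH[OF r])
  show ?case
  proof (cases "even q")
    case True
    then have q: "2^i * q = 2^Suc i * r" by (auto simp: r_def)
    have "w * real b * real (2^Suc i * r) powr \<beta> \<le> w * real (Suc b) * real (2^Suc i * r) powr \<beta>"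
      using w by (intro mult_right_mono mult_left_mono) auto
    then show ?thesis unfolding q using IH by linarith
  next
    case False
    then have q: "q = 2 * r + 1" by (auto simp: r_def elim!: oddE)
    have "\<bar>s (2^i * q)\<bar> \<le> \<bar>s (2^Suc i * r)\<bar> + \<bar>s (2^i * (2 * r + 1)) - s (2^i * (2 * r))\<bar>"
      unfolding q by (simp add: mult_ac)
    also have "\<dots> \<le> w * real b * real (2^Suc i * r) powr \<beta> + w * real (2^i * (2 * r + 1)) powr \<beta>"
      by (intro add_mono IH block)
    also have "\<dots> \<le> w * real b * real (2^i * q) powr \<beta> + w * real (2^i * q) powr \<beta>"
      using w \<beta> unfolding q by (intro add_mono mult_left_mono powr_mono2) auto
    finally show ?thesis by (simp add: algebra_simps)
  qed
qed

text \<open>The normalised block moments are summable over all scales i and positions j: at (i, j)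
  the expectation is at most C r^i (1 + j)^(-p \<beta>0) with r < 1 and p \<beta>0 > 1. Hence one
  almost surely finite variable dominates all dyadic blocks at once.\<close>

lemma (in prob_space) AE_partial_sums_bound:
  fixes Z :: "nat \<Rightarrow> 'a \<Rightarrow> real" and p \<theta> \<beta> C :: real
  assumes [measurable]: "\<And>k. Z k \<in> borel_measurable M"
    and p: "0 < p" and \<theta>: "1 \<le> \<theta>" "\<theta> < p * \<beta>" and C: "0 \<le> C"
    and moment: "\<And>a m. (\<integral>\<^sup>+\<omega>. ennreal (\<bar>\<Sum>k\<in>{a<..a+m}. Z k \<omega>\<bar> powr p) \<partial>M) \<le> ennreal (C * real m powr \<theta>)"
  shows "AE \<omega> in M. \<exists>K. \<forall>n. \<bar>\<Sum>k=1..n. Z k \<omega>\<bar> \<le> K * real n powr \<beta>"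
proof -
  \<comment> \<open>The gap between \<beta>0 and \<beta> absorbs the factor of order log n, the
    number of binary digits of n, that the chaining loses.\<close>
  define \<beta>0 where "\<beta>0 = (\<theta> / p + \<beta>) / 2"
  have b0: "\<theta> < p * \<beta>0" "\<beta>0 < \<beta>" "0 < \<beta>0"
  proof -
    have "\<theta> / p < \<beta>" "0 < \<theta> / p" using p \<theta> by (auto simp: field_simps)
    then show "\<beta>0 < \<beta>" "0 < \<beta>0" "\<theta> < p * \<beta>0" using p by (auto simp: \<beta>0_def field_simps)
  qed
  define bl where "bl = (\<lambda>i j \<omega>. \<bar>\<Sum>k\<in>{2^i * j<..2^i * j + 2^i}. Z k \<omega>\<bar> powr p)"
  define T where "T = (\<lambda>i j \<omega>. ennreal (bl i j \<omega> * real (2^i * (j + 1)) powr (- p * \<beta>0)))"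
  define W where "W = (\<lambda>\<omega>. \<Sum>i. \<Sum>j. T i j \<omega>)"
  have blm[measurable]: "bl i j \<in> borel_measurable M" for i j unfolding bl_def by measurable
  have Tm[measurable]: "T i j \<in> borel_measurable M" for i j unfolding T_def by measurable
  define r where "r = 2 powr (\<theta> - p * \<beta>0)"
  have r: "0 < r" "r < 1" using b0 by (auto simp: r_def powr_less_one)
  have ET: "(\<integral>\<^sup>+\<omega>. T i j \<omega> \<partial>M) \<le> ennreal (C * r ^ i) * ennreal ((1 + real j) powr (- p * \<beta>0))" for i j
  proof -
    have "(\<integral>\<^sup>+\<omega>. T i j \<omega> \<partial>M) = (\<integral>\<^sup>+\<omega>. ennreal (bl i j \<omega>) * ennreal (real (2^i * (j + 1)) powr (- p * \<beta>0)) \<partial>M)"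
      by (simp add: T_def bl_def ennreal_mult)
    also have "\<dots> = (\<integral>\<^sup>+\<omega>. ennreal (bl i j \<omega>) \<partial>M) * ennreal (real (2^i * (j + 1)) powr (- p * \<beta>0))"
      by (rule nn_integral_multc) measurable
    also have "\<dots> \<le> ennreal (C * real (2^i) powr \<theta>) * ennreal (real (2^i * (j + 1)) powr (- p * \<beta>0))"
      unfolding bl_def by (intro mult_right_mono moment) auto
    also have "\<dots> = ennreal (C * r ^ i) * ennreal ((1 + real j) powr (- p * \<beta>0))"
    proof -
      have "real (2^i * (j + 1)) powr (- p * \<beta>0) = real (2^i) powr (- p * \<beta>0) * (1 + real j) powr (- p * \<beta>0)"
      proof -
        have "real (2^i * (j + 1)) = real (2^i) * (1 + real j)" by (simp add: algebra_simps)
        then show ?thesis by (simp only: powr_mult)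
      qed
      moreover have "real (2^i) powr \<theta> * real (2^i) powr (- p * \<beta>0) = r ^ i"
        unfolding powr_add[symmetric] r_def
        by (simp add: powr_realpow[symmetric] powr_powr mult.commute)
      ultimately have "C * real (2^i) powr \<theta> * real (2^i * (j + 1)) powr (- p * \<beta>0)
          = (C * r ^ i) * ((1 + real j) powr (- p * \<beta>0))"
        by (simp add: mult.assoc[symmetric])
      then show ?thesis using C r by (simp add: ennreal_mult[symmetric])
    qed
    finally show ?thesis .
  qed
  have "(\<integral>\<^sup>+\<omega>. W \<omega> \<partial>M) = (\<Sum>i. \<Sum>j. \<integral>\<^sup>+\<omega>. T i j \<omega> \<partial>M)"
    unfolding W_def by (simp add: nn_integral_suminf)
  also have "\<dots> \<le> (\<Sum>i. \<Sum>j. ennreal (C * r ^ i) * ennreal ((1 + real j) powr (- p * \<beta>0)))"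
    by (intro suminf_le ET summableI)
  also have "\<dots> = (\<Sum>i. ennreal (C * r ^ i)) * (\<Sum>j. ennreal ((1 + real j) powr (- p * \<beta>0)))"
    by simp
  also have "\<dots> < \<infinity>"
  proof -
    have "(\<Sum>i. ennreal (C * r ^ i)) = ennreal (\<Sum>i. C * r ^ i)"
      using C r by (intro suminf_ennreal2 summable_mult summable_geometric) auto
    moreover have "(\<Sum>j. ennreal ((1 + real j) powr (- p * \<beta>0))) = ennreal (\<Sum>j. (1 + real j) powr (- p * \<beta>0))"
      using b0 \<theta> by (intro suminf_ennreal2 summable_shift_powr) auto
    ultimately show ?thesis by (simp add: ennreal_mult_less_top)
  qed
  finally have "(\<integral>\<^sup>+\<omega>. W \<omega> \<partial>M) \<noteq> \<infinity>" by auto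
  then have "AE \<omega> in M. W \<omega> \<noteq> \<infinity>"
    by (intro nn_integral_PInf_AE) (auto simp: W_def)
  then show ?thesis
  proof eventually_elim
    case (elim \<omega>)
    define w where "w = enn2real (W \<omega>)"
    have w0: "0 \<le> w" by (simp add: w_def)
    have Ww: "W \<omega> = ennreal w" using elim by (simp add: w_def top.not_eq_extremum)
    have TW: "T i j \<omega> \<le> ennreal w" for i j
    proof -
      have "T i j \<omega> \<le> (\<Sum>j. T i j \<omega>)"
        using sum_le_suminf[of "\<lambda>j. T i j \<omega>" "{j}"] by (simp add: summableI)
      also have "\<dots> \<le> W \<omega>"
        unfolding W_def using sum_le_suminf[of "\<lambda>i. \<Sum>j. T i j \<omega>" "{i}"] by (simp add: summableI)
      finally show ?thesis by (simp add: Ww)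
    qed
    define s where "s = (\<lambda>n. \<Sum>k=1..n. Z k \<omega>)"
    define v where "v = w powr (1/p)"
    have block: "\<bar>s (2^i * (j + 1)) - s (2^i * j)\<bar> \<le> v * real (2^i * (j + 1)) powr \<beta>0" for i j
    proof -
      define N where "N = real (2^i * (j + 1))"
      have N: "0 < N" by (simp add: N_def add_pos_nonneg)
      have sd: "s (2^i * (j + 1)) - s (2^i * j) = (\<Sum>k\<in>{2^i * j<..2^i * j + 2^i}. Z k \<omega>)"
      proof -
        have "{1..2^i * (j + 1)} = {1..2^i * j} \<union> {2^i * j<..2^i * j + 2^i}" by auto
        moreover have "sum f ({1..2^i * j} \<union> {2^i * j<..2^i * j + 2^i})
            = sum f {1..2^i * j} + sum f {2^i * j<..2^i * j + 2^i}" for f :: "nat \<Rightarrow> real"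
          by (rule sum.union_disjoint) auto
        ultimately show ?thesis unfolding s_def by simp
      qed
      have "bl i j \<omega> * N powr (- p * \<beta>0) \<le> w"
        using TW[of i j] w0 by (simp add: T_def N_def)
      then have "bl i j \<omega> * N powr (- p * \<beta>0) * N powr (p * \<beta>0) \<le> w * N powr (p * \<beta>0)"
        by (intro mult_right_mono) auto
      then have "bl i j \<omega> \<le> w * N powr (p * \<beta>0)"
        using N by (simp add: mult.assoc powr_add[symmetric])
      then have "bl i j \<omega> powr (1/p) \<le> (w * N powr (p * \<beta>0)) powr (1/p)"
        using p by (intro powr_mono2) (auto simp: bl_def)
      also have "\<dots> = v * N powr \<beta>0" using p w0 by (simp add: v_def powr_mult powr_powr)
      also have "bl i j \<omega> powr (1/p) = \<bar>s (2^i * (j + 1)) - s (2^i * j)\<bar>"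
        using p unfolding sd by (simp add: bl_def powr_powr)
      finally show ?thesis by (simp add: N_def)
    qed
    define e where "e = \<beta> - \<beta>0"
    have e: "e > 0" using b0 by (simp add: e_def)
    have "\<bar>s n\<bar> \<le> v * (1 + 1 / (e * ln 2)) * real n powr \<beta>" for n
    proof (cases "n = 0")
      case False
      then obtain b where b: "2^b \<le> n" "n < 2^(b+1)" using ex_power_ivl1[of 2 n] by auto
      have "real b * ln 2 = ln (2^b)" by (simp add: ln_realpow)
      also have "\<dots> \<le> ln (real n)" using b False by (simp flip: of_nat_power add: of_nat_le_iff[of "2^b" n, symmetric])
      also have "\<dots> \<le> real n powr e / e" using False e by (intro ln_powr_bound) auto
      finally have "real b \<le> real n powr e / (e * ln 2)" using e by (simp add: field_simps)
      moreover have "1 \<le> real n powr e" using False e by (intro ge_one_powr_ge_zero) auto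
      ultimately have bb: "real (b + 1) \<le> (1 + 1 / (e * ln 2)) * real n powr e" by (simp add: algebra_simps)
      have "\<bar>s (2^0 * n)\<bar> \<le> v * real (b + 1) * real (2^0 * n) powr \<beta>0"
        by (rule dyadic_chaining[OF _ _ _ block b(2)]) (use b0 in \<open>auto simp: s_def v_def\<close>)
      also have "\<dots> \<le> v * ((1 + 1 / (e * ln 2)) * real n powr e) * real (2^0 * n) powr \<beta>0"
        by (intro mult_right_mono mult_left_mono bb) (auto simp: v_def)
      also have "\<dots> = v * (1 + 1 / (e * ln 2)) * (real n powr e * real n powr \<beta>0)" by simp
      also have "real n powr e * real n powr \<beta>0 = real n powr \<beta>"
        unfolding powr_add[symmetric] by (simp add: e_def)
      finally show ?thesis by simp
    qed (simp add: s_def)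
    then show ?case unfolding s_def by blast
  qed
qed

section \<open>Quadratic functionals of linear processes\<close>

text \<open>Outside [-K, K] one has |z| <= K^(1-p) |z|^p. Bounded p-th moments thus make the effect
  of clipping on means uniformly small.\<close>

lemma abs_diff_clip_le:
  fixes z K p :: real
  assumes "0 < K" "1 < p"
  shows "\<bar>z - max (-K) (min K z)\<bar> \<le> K powr (1 - p) * \<bar>z\<bar> powr p"
proof (cases "\<bar>z\<bar> \<le> K")
  case True
  then have "max (-K) (min K z) = z" by auto
  then show ?thesis by simp
next
  case False
  have "\<bar>z - max (-K) (min K z)\<bar> \<le> \<bar>z\<bar>" using assms False by auto
  also have "\<dots> = \<bar>z\<bar> powr (1 - p) * \<bar>z\<bar> powr p"
    using False assms unfolding powr_add[symmetric] by simp
  also have "\<dots> \<le> K powr (1 - p) * \<bar>z\<bar> powr p"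
    using False assms by (intro mult_right_mono powr_mono2') auto
  finally show ?thesis .
qed

section \<open>Removing the truncation\<close>

context prob_space begin

lemma nn_integral_powr_limit_le:
  fixes Z :: "nat \<Rightarrow> 'a \<Rightarrow> real" and Z' :: "'a \<Rightarrow> real"
  assumes [measurable]: "\<And>N. Z N \<in> borel_measurable M"
    and p: "0 < p"
    and le: "\<And>N. (\<integral>\<^sup>+\<omega>. ennreal (\<bar>Z N \<omega>\<bar> powr p) \<partial>M) \<le> c"
    and lim: "AE \<omega> in M. (\<lambda>N. Z N \<omega>) \<longlonglongrightarrow> Z' \<omega>"
  shows "(\<integral>\<^sup>+\<omega>. ennreal (\<bar>Z' \<omega>\<bar> powr p) \<partial>M) \<le> c"
proof -
  have "(\<integral>\<^sup>+\<omega>. ennreal (\<bar>Z' \<omega>\<bar> powr p) \<partial>M) = (\<integral>\<^sup>+\<omega>. liminf (\<lambda>N. ennreal (\<bar>Z N \<omega>\<bar> powr p)) \<partial>M)"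
  proof (rule nn_integral_cong_AE, use lim in eventually_elim)
    case (elim \<omega>)
    have "(\<lambda>N. ennreal (\<bar>Z N \<omega>\<bar> powr p)) \<longlonglongrightarrow> ennreal (\<bar>Z' \<omega>\<bar> powr p)"
      using p by (intro tendsto_ennrealI tendsto_powr' tendsto_rabs elim tendsto_const) auto
    then show ?case by (intro lim_imp_Liminf[symmetric]) auto
  qed
  also have "\<dots> \<le> liminf (\<lambda>N. \<integral>\<^sup>+\<omega>. ennreal (\<bar>Z N \<omega>\<bar> powr p) \<partial>M)"
    by (rule nn_integral_liminf) measurable
  also have "\<dots> \<le> c" by (intro Liminf_le) (use le in auto)
  finally show ?thesis .
qed

lemma integrable_abs_powrI:
  fixes Z :: "'a \<Rightarrow> real"
  assumes [measurable]: "Z \<in> borel_measurable M" and c: "0 \<le> c"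
    and le: "(\<integral>\<^sup>+\<omega>. ennreal (\<bar>Z \<omega>\<bar> powr p) \<partial>M) \<le> ennreal c"
  shows "integrable M (\<lambda>\<omega>. \<bar>Z \<omega>\<bar> powr p)" "expectation (\<lambda>\<omega>. \<bar>Z \<omega>\<bar> powr p) \<le> c"
proof -
  show i: "integrable M (\<lambda>\<omega>. \<bar>Z \<omega>\<bar> powr p)"
    using le by (intro integrableI_nonneg) (auto simp: less_top[symmetric] top_unique)
  show "expectation (\<lambda>\<omega>. \<bar>Z \<omega>\<bar> powr p) \<le> c"
    using le c nn_integral_eq_integral[OF i] by simp
qed

text \<open>Uniform integrability in elementary form: clipped means converge by dominated
  convergence, and clipping at K moves every mean, that of the limit included, by at most K^(1-p) c.
  Then K tends to infinity.\<close>

lemma expectation_abs_powr_limit_zero: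
  fixes Z :: "nat \<Rightarrow> 'a \<Rightarrow> real" and Z' :: "'a \<Rightarrow> real"
  assumes meas[measurable]: "\<And>N. Z N \<in> borel_measurable M" "Z' \<in> borel_measurable M"
    and p: "1 < p" and c: "0 \<le> c"
    and le: "\<And>N. (\<integral>\<^sup>+\<omega>. ennreal (\<bar>Z N \<omega>\<bar> powr p) \<partial>M) \<le> ennreal c"
    and lim: "AE \<omega> in M. (\<lambda>N. Z N \<omega>) \<longlonglongrightarrow> Z' \<omega>"
    and mean: "\<And>N. expectation (Z N) = 0"
  shows "integrable M Z'" "expectation Z' = 0"
proof -
  have le': "(\<integral>\<^sup>+\<omega>. ennreal (\<bar>Z' \<omega>\<bar> powr p) \<partial>M) \<le> ennreal c"
    by (rule nn_integral_powr_limit_le[OF meas(1) _ le lim]) (use p in auto)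
  have int: "integrable M f" "\<bar>expectation f - expectation (\<lambda>\<omega>. max (-K) (min K (f \<omega>)))\<bar> \<le> K powr (1 - p) * c"
    if f[measurable]: "f \<in> borel_measurable M" and fle: "(\<integral>\<^sup>+\<omega>. ennreal (\<bar>f \<omega>\<bar> powr p) \<partial>M) \<le> ennreal c" and K: "0 < K"
    for f :: "'a \<Rightarrow> real" and K
  proof -
    note ip = integrable_abs_powrI[OF f c fle]
    have "integrable M (\<lambda>\<omega>. \<bar>f \<omega>\<bar> powr 1)"
      by (rule integrable_abs_powr_mono[OF f ip(1)]) (use p in auto)
    then have "integrable M (\<lambda>\<omega>. \<bar>f \<omega>\<bar>)" by simp
    then show i: "integrable M f" by (rule integrable_abs_cancel) simp
    have "expectation f - expectation (\<lambda>\<omega>. max (-K) (min K (f \<omega>)))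
        = expectation (\<lambda>\<omega>. f \<omega> - max (-K) (min K (f \<omega>)))"
      using i by simp
    also have "\<bar>\<dots>\<bar> \<le> expectation (\<lambda>\<omega>. \<bar>f \<omega> - max (-K) (min K (f \<omega>))\<bar>)" by (rule integral_abs_bound)
    also have "\<dots> \<le> expectation (\<lambda>\<omega>. K powr (1 - p) * \<bar>f \<omega>\<bar> powr p)"
      by (intro integral_mono abs_diff_clip_le K p) (use i ip in auto)
    also have "\<dots> \<le> K powr (1 - p) * c" using ip(2) by (simp add: mult_left_mono)
    finally show "\<bar>expectation f - expectation (\<lambda>\<omega>. max (-K) (min K (f \<omega>)))\<bar> \<le> K powr (1 - p) * c" .
  qed
  show "integrable M Z'" by (rule int(1)[OF meas(2) le', of 1]) simp
  have bound: "\<bar>expectation Z'\<bar> \<le> 2 * c * K powr (1 - p)" if K: "0 < K" for K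
  proof -
    let ?c = "\<lambda>z. max (-K) (min K z)"
    have "(\<lambda>N. expectation (\<lambda>\<omega>. ?c (Z N \<omega>))) \<longlonglongrightarrow> expectation (\<lambda>\<omega>. ?c (Z' \<omega>))"
    proof (rule integral_dominated_convergence[where w="\<lambda>_. K"])
      show "AE \<omega> in M. (\<lambda>N. ?c (Z N \<omega>)) \<longlonglongrightarrow> ?c (Z' \<omega>)"
        using lim by eventually_elim (intro tendsto_intros)
    qed (use K in auto)
    then have "(\<lambda>N. \<bar>expectation (\<lambda>\<omega>. ?c (Z N \<omega>))\<bar>) \<longlonglongrightarrow> \<bar>expectation (\<lambda>\<omega>. ?c (Z' \<omega>))\<bar>"
      by (rule tendsto_rabs)
    moreover have "\<bar>expectation (\<lambda>\<omega>. ?c (Z N \<omega>))\<bar> \<le> K powr (1 - p) * c" for N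
      using int(2)[OF meas(1) le K, of N] mean[of N] by simp
    ultimately have "\<bar>expectation (\<lambda>\<omega>. ?c (Z' \<omega>))\<bar> \<le> K powr (1 - p) * c"
      by (intro LIMSEQ_le_const2) auto
    then show ?thesis using int(2)[OF meas(2) le' K] by (simp add: mult_ac)
  qed
  have "((\<lambda>n. 2 * c * real n powr (1 - p)) \<longlonglongrightarrow> 2 * c * 0)"
    using p by (intro tendsto_intros tendsto_neg_powr filterlim_real_sequentially) auto
  then have "\<bar>expectation Z'\<bar> \<le> 2 * c * 0"
    by (rule LIMSEQ_le_const) (use bound in \<open>auto intro!: exI[of _ 1]\<close>)
  then show "expectation Z' = 0" by simp
qed

end

locale iid_innovations = centered_innovations M \<Xi> s
  for M :: "'a measure" and \<Xi> :: "int \<Rightarrow> 'a \<Rightarrow> 'm::euclidean_space" and s :: real +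
  fixes p sp :: real
  assumes ident: "\<And>l l'. distr M borel (\<Xi> l) = distr M borel (\<Xi> l')"
    and p: "1 < p" "p \<le> 2"
    and integrable_powr: "\<And>l. integrable M (\<lambda>\<omega>. ((norm (\<Xi> l \<omega>))\<^sup>2) powr p)"
    and powr_moment: "\<And>l. expectation (\<lambda>\<omega>. ((norm (\<Xi> l \<omega>))\<^sup>2) powr p) = sp"
begin

lemma sp_nonneg: "0 \<le> sp"
  using powr_moment[of 0] by (metis integral_nonneg_AE AE_I2 powr_ge_zero)

lemma var_inner_eq: "var_inner l c = var_inner 0 c"
proof -
  have "var_inner l c = (\<integral>x. (c \<bullet> x)\<^sup>2 \<partial>distr M borel (\<Xi> l))" for l
    unfolding var_inner_def by (subst integral_distr) auto
  then show ?thesis using ident[of l 0] by simp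
qed

text \<open>Centring by the variance of the truncated sum, not of the limit, keeps the mean zero for
  every finite L.\<close>

definition centered_sq :: "(int \<Rightarrow> 'm) \<Rightarrow> int set \<Rightarrow> int \<Rightarrow> 'a \<Rightarrow> real" where
  "centered_sq g L k \<omega> = (lin (\<lambda>k l. g (k - l)) L k \<omega>)\<^sup>2 - (\<Sum>l\<in>L. var_inner 0 (g (k - l)))"

lemma centered_sq_measurable[measurable]: "centered_sq g L k \<in> borel_measurable M"
  unfolding centered_sq_def by measurable

lemma sum_centered_sq:
  "(\<Sum>k\<in>B. centered_sq g L k \<omega>) = offdiag (\<lambda>k l. g (k - l)) L B \<omega> + diag (\<lambda>k l. g (k - l)) L B \<omega>"
proof -
  have "diag (\<lambda>k l. g (k - l)) L B \<omega>
      = (\<Sum>k\<in>B. \<Sum>l\<in>L. (g (k - l) \<bullet> \<Xi> l \<omega>)\<^sup>2 - var_inner 0 (g (k - l)))"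
    unfolding diag_def
    by (subst sum.swap) (intro sum.cong refl arg_cong2[where f="(-)"] var_inner_eq)
  then show ?thesis
    by (simp add: centered_sq_def offdiag_def sum_subtractf sum.distrib)
qed

lemma offdiag_singleton_mean:
  assumes L: "finite L"
  shows "expectation (offdiag c L {k}) = 0 \<and> integrable M (offdiag c L {k})"
  using L
proof (induction L)
  case empty
  then show ?case by (simp add: offdiag_def lin_def)
next
  case (insert i L)
  have H: "(\<lambda>x. c k i \<bullet> x) \<in> borel_measurable borel" by measurable
  note 1 = indep_var_lebesgue_integral[OF indep_lin[OF insert.hyps(2) H] expectation_lin(1) integrable_inner]
  note 2 = indep_var_integrable[OF indep_lin[OF insert.hyps(2) H] expectation_lin(1) integrable_inner]
  have "offdiag c (insert i L) {k} = (\<lambda>\<omega>. offdiag c L {k} \<omega> + 2 * (lin c L k \<omega> * (c k i \<bullet> \<Xi> i \<omega>)))"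
    using insert.hyps by (auto simp: offdiag_def lin_insert power2_eq_square algebra_simps)
  moreover have "integrable M (\<lambda>\<omega>. 2 * (lin c L k \<omega> * (c k i \<bullet> \<Xi> i \<omega>)))"
    "expectation (\<lambda>\<omega>. 2 * (lin c L k \<omega> * (c k i \<bullet> \<Xi> i \<omega>))) = 0"
    using 1 2 by (simp_all add: expectation_lin)
  ultimately show ?case
    using insert.IH by (simp only: Bochner_Integration.integral_add Bochner_Integration.integrable_add simp_thms)
qed

lemma centered_sq_mean:
  assumes L: "finite L"
  shows "expectation (centered_sq g L k) = 0"
proof -
  have "centered_sq g L k = (\<lambda>\<omega>. offdiag (\<lambda>k l. g (k - l)) L {k} \<omega> + diag (\<lambda>k l. g (k - l)) L {k} \<omega>)"
    using sum_centered_sq[of g L _ "{k}"] by auto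
  moreover have "expectation (diag (\<lambda>k l. g (k - l)) L {k}) = 0" "integrable M (diag (\<lambda>k l. g (k - l)) L {k})"
    unfolding diag_def using integrable_inner_sq
    by (simp_all add: Bochner_Integration.integral_sum var_inner_def prob_space)
  ultimately show ?thesis using offdiag_singleton_mean[OF L, of "\<lambda>k l. g (k - l)" k] by simp
qed

text \<open>The diagonal contributes m. The off-diagonal part has second moment of order
  m^(2\<beta>2), hence p-th moment of order m^(p \<beta>2). \<open>C\<close> is chosen before L, and
  for that reason the bound survives Fatou's lemma.\<close>

lemma block_moment_le:
  fixes g :: "int \<Rightarrow> 'm" and \<sigma> \<beta>1 \<beta>2 K :: real
  assumes g: "\<And>l. norm (g l) \<le> K * (1 + \<bar>real_of_int l\<bar>) powr (-\<sigma>)" and K: "0 \<le> K"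
    and \<sigma>: "1/2 < \<sigma>" and \<beta>: "1/2 < \<beta>1" "\<beta>1 < 1" "2 - 2 * \<sigma> < \<beta>1" "\<beta>1 < \<beta>2"
  shows "\<exists>C\<ge>0. \<forall>L a m. finite L \<longrightarrow>
    (\<integral>\<^sup>+\<omega>. ennreal (\<bar>\<Sum>k\<in>{a<..a + int m}. centered_sq g L k \<omega>\<bar> powr p) \<partial>M)
      \<le> ennreal (C * real m powr (max 1 (p * \<beta>2)))"
proof -
  let ?a = "\<lambda>l::int. 1 + \<bar>real_of_int l\<bar>"
  from convolution_powr_le[OF \<sigma> \<beta>(1-3)] obtain Z1 where Z1: "0 \<le> Z1"
    "\<And>L k k'. finite L \<Longrightarrow> (\<Sum>l\<in>L. ?a (k - l) powr (-\<sigma>) * ?a (k' - l) powr (-\<sigma>)) \<le> Z1 * ?a (k - k') powr (\<beta>1 - 1)"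
    by blast
  from double_sum_powr_le[OF \<beta>(1,4)] obtain Z2 where Z2: "0 \<le> Z2"
    "\<And>a m. (\<Sum>k\<in>{a<..a + int m}. \<Sum>k'\<in>{a<..a + int m}. (?a (k - k') powr (\<beta>1 - 1))\<^sup>2) \<le> Z2 * real m powr (2 * \<beta>2)"
    by blast
  have "1 < 2 * \<sigma>" using \<sigma> by simp
  from finite_sum_int_powr_le[OF this] obtain Z3 where Z3: "0 \<le> Z3"
    "\<And>L k. finite L \<Longrightarrow> (\<Sum>l\<in>L. ?a (k - l) powr (-(2 * \<sigma>))) \<le> Z3"
    by blast
  define W where "W = K\<^sup>2 * Z3"
  \<comment> \<open>The summand 1 keeps the bound \<open>T\<close> positive even if s or K
    vanishes.\<close>
  define T0 where "T0 = 2 * s\<^sup>2 * ((K\<^sup>2 * Z1)\<^sup>2 * Z2) + 1"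
  have T0: "0 < T0" using Z2(1) by (auto simp: T0_def intro!: add_nonneg_pos)
  define C where "C = 4 * T0 powr (p/2) + 4 * (24 * (sp + s powr p) * W powr p)"
  have C0: "0 \<le> C" using sp_nonneg by (auto simp: C_def)
  have gsq: "(norm (g l))\<^sup>2 \<le> K\<^sup>2 * ?a l powr (-(2 * \<sigma>))" for l
  proof -
    have "(norm (g l))\<^sup>2 \<le> (K * ?a l powr (-\<sigma>))\<^sup>2" by (intro power_mono g) auto
    also have "\<dots> = K\<^sup>2 * (?a l powr (-\<sigma>) * ?a l powr (-\<sigma>))" by (simp add: power2_eq_square)
    finally show ?thesis unfolding powr_add[symmetric] by simp
  qed
  have "(\<integral>\<^sup>+\<omega>. ennreal (\<bar>\<Sum>k\<in>{a<..a + int m}. centered_sq g L k \<omega>\<bar> powr p) \<partial>M)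
      \<le> ennreal (C * real m powr (max 1 (p * \<beta>2)))" if L: "finite L" for L a m
  proof (cases "m = 0")
    case False
    define B where "B = {a<..a + int m}"
    have B: "finite B" "card B = m" by (auto simp: B_def)
    let ?c = "\<lambda>k l. g (k - l)"
    define T where "T = T0 * real m powr (2 * \<beta>2)"
    have T: "0 < T" using T0 False by (simp add: T_def)
    have rho: "(\<Sum>l\<in>L. norm (g (k - l)) * norm (g (k' - l))) \<le> K\<^sup>2 * Z1 * ?a (k - k') powr (\<beta>1 - 1)" for k k'
    proof -
      have "(\<Sum>l\<in>L. norm (g (k - l)) * norm (g (k' - l)))
          \<le> (\<Sum>l\<in>L. (K * ?a (k - l) powr (-\<sigma>)) * (K * ?a (k' - l) powr (-\<sigma>)))"
        by (intro sum_mono mult_mono g) (use K in auto)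
      also have "\<dots> = K\<^sup>2 * (\<Sum>l\<in>L. ?a (k - l) powr (-\<sigma>) * ?a (k' - l) powr (-\<sigma>))"
        unfolding sum_distrib_left by (intro sum.cong refl) (simp add: power2_eq_square)
      also have "\<dots> \<le> K\<^sup>2 * (Z1 * ?a (k - k') powr (\<beta>1 - 1))" by (intro mult_left_mono Z1 L) auto
      finally show ?thesis by simp
    qed
    have "expectation (\<lambda>\<omega>. (offdiag ?c L B \<omega>)\<^sup>2)
        \<le> 2 * s\<^sup>2 * (\<Sum>k\<in>B. \<Sum>k'\<in>B. (\<Sum>l\<in>L. norm (g (k - l)) * norm (g (k' - l)))\<^sup>2)"
      using expectation_offdiag_sq_le[OF L B(1), of ?c] by simp
    also have "\<dots> \<le> 2 * s\<^sup>2 * (\<Sum>k\<in>B. \<Sum>k'\<in>B. (K\<^sup>2 * Z1 * ?a (k - k') powr (\<beta>1 - 1))\<^sup>2)"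
      by (intro mult_left_mono sum_mono power_mono rho) (auto intro!: sum_nonneg)
    also have "\<dots> = 2 * s\<^sup>2 * ((K\<^sup>2 * Z1)\<^sup>2 * (\<Sum>k\<in>B. \<Sum>k'\<in>B. (?a (k - k') powr (\<beta>1 - 1))\<^sup>2))"
      unfolding sum_distrib_left by (simp only: power_mult_distrib)
    also have "\<dots> \<le> 2 * s\<^sup>2 * ((K\<^sup>2 * Z1)\<^sup>2 * (Z2 * real m powr (2 * \<beta>2)))"
      unfolding B_def by (intro mult_left_mono Z2) auto
    also have "\<dots> \<le> T" by (simp add: T_def T0_def algebra_simps)
    finally have V: "expectation (\<lambda>\<omega>. (offdiag ?c L B \<omega>)\<^sup>2) \<le> T" .
    have Vp: "integrable M (\<lambda>\<omega>. \<bar>offdiag ?c L B \<omega>\<bar> powr p) \<and>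
        expectation (\<lambda>\<omega>. \<bar>offdiag ?c L B \<omega>\<bar> powr p) \<le> T powr (p/2)"
      by (rule expectation_abs_powr_le_of_sq[OF _ _ _ _ T V])
         (use p expectation_offdiag_sq_le[OF L B(1), of ?c] in auto)
    have Dp: "integrable M (\<lambda>\<omega>. \<bar>diag ?c L B \<omega>\<bar> powr p) \<and>
       expectation (\<lambda>\<omega>. \<bar>diag ?c L B \<omega>\<bar> powr p) \<le> 24 * (sp + s powr p) * W powr p * real (card B)"
    proof (rule expectation_abs_diag_powr_le[OF L B(1) p integrable_powr powr_moment])
      show "0 \<le> W" using Z3(1) by (simp add: W_def)
      fix l
      have "(\<Sum>k\<in>B. (norm (g (k - l)))\<^sup>2) \<le> (\<Sum>k\<in>B. K\<^sup>2 * ?a (k - l) powr (-(2 * \<sigma>)))" by (intro sum_mono gsq)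
      also have "\<dots> = K\<^sup>2 * (\<Sum>k\<in>B. ?a (l - k) powr (-(2 * \<sigma>)))"
        unfolding sum_distrib_left by (intro sum.cong refl) (simp add: abs_minus_commute)
      also have "\<dots> \<le> W" unfolding W_def by (intro mult_left_mono Z3 B) auto
      finally show "(\<Sum>k\<in>B. (norm (g (k - l)))\<^sup>2) \<le> W" .
    next
      fix k
      have "(\<Sum>l\<in>L. (norm (g (k - l)))\<^sup>2) \<le> (\<Sum>l\<in>L. K\<^sup>2 * ?a (k - l) powr (-(2 * \<sigma>)))" by (intro sum_mono gsq)
      also have "\<dots> = K\<^sup>2 * (\<Sum>l\<in>L. ?a (k - l) powr (-(2 * \<sigma>)))"
        unfolding sum_distrib_left ..
      also have "\<dots> \<le> W" unfolding W_def by (intro mult_left_mono Z3 L) auto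
      finally show "(\<Sum>l\<in>L. (norm (g (k - l)))\<^sup>2) \<le> W" .
    qed
    let ?U = "\<lambda>\<omega>. offdiag ?c L B \<omega>" and ?D = "\<lambda>\<omega>. diag ?c L B \<omega>"
    have i1: "integrable M (\<lambda>\<omega>. \<bar>?U \<omega> + ?D \<omega>\<bar> powr p)"
      by (rule integrable_abs_powr_add) (use Vp Dp p in auto)
    have "expectation (\<lambda>\<omega>. \<bar>?U \<omega> + ?D \<omega>\<bar> powr p)
        \<le> expectation (\<lambda>\<omega>. 4 * \<bar>?U \<omega>\<bar> powr p + 4 * \<bar>?D \<omega>\<bar> powr p)"
      by (intro integral_mono i1 abs_powr_add_le_convex p) (use Vp Dp in auto)
    also have "\<dots> = 4 * expectation (\<lambda>\<omega>. \<bar>?U \<omega>\<bar> powr p) + 4 * expectation (\<lambda>\<omega>. \<bar>?D \<omega>\<bar> powr p)"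
      using Vp Dp by simp
    also have "\<dots> \<le> 4 * T powr (p/2) + 4 * (24 * (sp + s powr p) * W powr p * real m)"
      using Vp Dp B by simp
    also have "\<dots> \<le> C * real m powr (max 1 (p * \<beta>2))"
    proof -
      have "T powr (p/2) = T0 powr (p/2) * real m powr (p * \<beta>2)"
        by (simp add: T_def powr_mult powr_powr mult_ac)
      also have "\<dots> \<le> T0 powr (p/2) * real m powr (max 1 (p * \<beta>2))"
        using False by (intro mult_left_mono powr_mono) auto
      finally have 1: "T powr (p/2) \<le> T0 powr (p/2) * real m powr (max 1 (p * \<beta>2))" .
      have "real m = real m powr 1" by simp
      also have "\<dots> \<le> real m powr (max 1 (p * \<beta>2))" using False by (intro powr_mono) auto
      finally have "24 * (sp + s powr p) * W powr p * real m
          \<le> 24 * (sp + s powr p) * W powr p * real m powr (max 1 (p * \<beta>2))"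
        using sp_nonneg by (intro mult_left_mono) auto
      with 1 show ?thesis unfolding C_def distrib_right by linarith
    qed
    finally have "expectation (\<lambda>\<omega>. \<bar>?U \<omega> + ?D \<omega>\<bar> powr p) \<le> C * real m powr (max 1 (p * \<beta>2))" .
    then show ?thesis
      unfolding B_def[symmetric] sum_centered_sq
      by (subst nn_integral_eq_integral[OF i1]) (auto intro: ennreal_leI)
  qed simp
  then show ?thesis using C0 by blast
qed

text \<open>The windows stay fixed while k shifts. But nonnegative terms with bounded finite sums
  are summable in any order, so the substitution of k - l for l shows that one D serves every k:
  stationarity of the second moments.\<close>

lemma centered_limit:
  fixes g :: "int \<Rightarrow> 'm" and \<sigma> K :: real
  assumes g: "\<And>l. norm (g l) \<le> K * (1 + \<bar>real_of_int l\<bar>) powr (-\<sigma>)" and K: "0 \<le> K" and \<sigma>: "1/2 < \<sigma>"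
  shows "\<exists>D. \<forall>k. (\<lambda>N. \<Sum>l\<in>{- int N..int N}. var_inner 0 (g (k - l))) \<longlonglongrightarrow> D"
proof -
  let ?Q = "\<lambda>l. var_inner 0 (g l)"
  let ?a = "\<lambda>l::int. 1 + \<bar>real_of_int l\<bar>"
  have "1 < 2 * \<sigma>" using \<sigma> by simp
  from finite_sum_int_powr_le[OF this] obtain Z3 where Z3: "0 \<le> Z3"
    "\<And>L k. finite L \<Longrightarrow> (\<Sum>l\<in>L. ?a (k - l) powr (-(2 * \<sigma>))) \<le> Z3"
    by blast
  have Q: "?Q l \<le> (s * K\<^sup>2) * ?a (0 - l) powr (-(2 * \<sigma>))" for l
  proof -
    have "?Q l \<le> s * (norm (g l))\<^sup>2" by (rule var_inner_bounds)
    also have "\<dots> \<le> s * (K * ?a l powr (-\<sigma>))\<^sup>2" by (intro mult_left_mono power_mono g s_nonneg) auto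
    also have "\<dots> = (s * K\<^sup>2) * (?a l powr (-\<sigma>) * ?a l powr (-\<sigma>))" by (simp add: power2_eq_square)
    finally show ?thesis unfolding powr_add[symmetric] by simp
  qed
  have "?Q summable_on UNIV"
  proof (rule nonneg_bdd_above_summable_on)
    show "bdd_above (sum ?Q ` {F. F \<subseteq> UNIV \<and> finite F})"
    proof (intro bdd_aboveI2)
      fix F :: "int set" assume "F \<in> {F. F \<subseteq> UNIV \<and> finite F}"
      then have F: "finite F" by simp
      have "sum ?Q F \<le> (s * K\<^sup>2) * (\<Sum>l\<in>F. ?a (0 - l) powr (-(2 * \<sigma>)))"
        unfolding sum_distrib_left by (intro sum_mono Q)
      also have "\<dots> \<le> (s * K\<^sup>2) * Z3" using s_nonneg by (intro mult_left_mono Z3 F) auto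
      finally show "sum ?Q F \<le> (s * K\<^sup>2) * Z3" .
    qed
  qed (use var_inner_bounds in auto)
  then have sum: "(?Q has_sum (infsum ?Q UNIV)) UNIV" by simp
  have "(\<lambda>N. \<Sum>l\<in>{- int N..int N}. ?Q (k - l)) \<longlonglongrightarrow> infsum ?Q UNIV" for k
  proof -
    have "((\<lambda>l. ?Q (k - l)) has_sum (infsum ?Q UNIV)) UNIV"
      using sum by (subst has_sum_reindex_bij_betw[where g="\<lambda>l. k - l" and B=UNIV and f="?Q"])
        (auto intro!: bij_betwI[where g="\<lambda>l. k - l"])
    then have lim: "(sum (\<lambda>l. ?Q (k - l)) \<longlongrightarrow> infsum ?Q UNIV) (finite_subsets_at_top UNIV)"
      by (simp add: has_sum_def)
    have "filterlim (\<lambda>N. {- int N..int N}) (finite_subsets_at_top UNIV) sequentially"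
      unfolding filterlim_finite_subsets_at_top
    proof (intro allI impI)
      fix X :: "int set" assume X: "finite X \<and> X \<subseteq> UNIV"
      define b where "b = Max (insert 0 ((\<lambda>x. nat \<bar>x\<bar>) ` X))"
      have b: "nat \<bar>x\<bar> \<le> b" if "x \<in> X" for x unfolding b_def using X that by (intro Max_ge) auto
      have "X \<subseteq> {- int N..int N}" if "b \<le> N" for N
      proof
        fix x assume "x \<in> X"
        from b[OF this] that have "\<bar>x\<bar> \<le> int N" by linarith
        then show "x \<in> {- int N..int N}" by auto
      qed
      then show "\<forall>\<^sub>F N in sequentially. finite {- int N..int N} \<and> X \<subseteq> {- int N..int N} \<and> {- int N..int N} \<subseteq> UNIV"
        by (auto simp: eventually_sequentially)
    qed
    from filterlim_compose[OF lim this] show ?thesis by simp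
  qed
  then show ?thesis by blast
qed

lemma quadratic_process_lln:
  fixes g :: "int \<Rightarrow> 'm" and Y :: "int \<Rightarrow> 'a \<Rightarrow> real" and \<sigma> \<beta> K :: real
  assumes g: "\<And>l. norm (g l) \<le> K * (1 + \<bar>real_of_int l\<bar>) powr (-\<sigma>)" and K: "0 \<le> K"
    and \<sigma>: "1/2 < \<sigma>" and \<beta>: "1/2 < \<beta>" "\<beta> < 1" "2 - 2 * \<sigma> < \<beta>" "1 < p * \<beta>"
    and Y[measurable]: "\<And>k. Y k \<in> borel_measurable M"
    and conv: "\<And>k. AE \<omega> in M. (\<lambda>N. lin (\<lambda>k l. g (k - l)) {- int N..int N} k \<omega>) \<longlonglongrightarrow> Y k \<omega>"
  shows "\<exists>D. (\<forall>k. integrable M (\<lambda>\<omega>. (Y k \<omega>)\<^sup>2) \<and> expectation (\<lambda>\<omega>. (Y k \<omega>)\<^sup>2) = D) \<and>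
    (AE \<omega> in M. \<exists>K. \<forall>n. \<bar>\<Sum>k=1..n. (Y (int k) \<omega>)\<^sup>2 - D\<bar> \<le> K * real n powr \<beta>)"
proof -
  \<comment> \<open>Two intermediate exponents, at the thirds of the interval from \<beta>0 to
    \<beta>: \<beta>1 governs the decay of the covariances, \<beta>2 the block moments, and the rest
    up to \<beta> is left for the chaining.\<close>
  define \<beta>0 where "\<beta>0 = max (1/2) (2 - 2 * \<sigma>)"
  define \<beta>1 where "\<beta>1 = (2 * \<beta>0 + \<beta>) / 3"
  define \<beta>2 where "\<beta>2 = (\<beta>0 + 2 * \<beta>) / 3"
  have b: "1/2 < \<beta>1" "\<beta>1 < 1" "2 - 2 * \<sigma> < \<beta>1" "\<beta>1 < \<beta>2" "\<beta>2 < \<beta>"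
  proof -
    have "1/2 \<le> \<beta>0" "2 - 2 * \<sigma> \<le> \<beta>0" "\<beta>0 < \<beta>" using \<beta> by (auto simp: \<beta>0_def)
    then show "1/2 < \<beta>1" "\<beta>1 < 1" "2 - 2 * \<sigma> < \<beta>1" "\<beta>1 < \<beta>2" "\<beta>2 < \<beta>"
      using \<beta>(2) by (simp_all add: \<beta>1_def \<beta>2_def)
  qed
  from block_moment_le[OF g K \<sigma> b(1-4)] obtain C where C: "0 \<le> C"
    "\<And>L a m. finite L \<Longrightarrow> (\<integral>\<^sup>+\<omega>. ennreal (\<bar>\<Sum>k\<in>{a<..a + int m}. centered_sq g L k \<omega>\<bar> powr p) \<partial>M)
      \<le> ennreal (C * real m powr (max 1 (p * \<beta>2)))"
    by blast
  from centered_limit[OF g K \<sigma>] obtain D where D: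
    "\<And>k. (\<lambda>N. \<Sum>l\<in>{- int N..int N}. var_inner 0 (g (k - l))) \<longlonglongrightarrow> D" by blast
  have lim: "AE \<omega> in M. (\<lambda>N. centered_sq g {- int N..int N} k \<omega>) \<longlonglongrightarrow> (Y k \<omega>)\<^sup>2 - D" for k
    using conv[of k] unfolding centered_sq_def by eventually_elim (intro tendsto_intros D)
  have limB: "AE \<omega> in M. (\<lambda>N. \<Sum>k\<in>B. centered_sq g {- int N..int N} k \<omega>) \<longlonglongrightarrow> (\<Sum>k\<in>B. (Y k \<omega>)\<^sup>2 - D)"
    if "finite B" for B
  proof -
    have "AE \<omega> in M. \<forall>k\<in>B. (\<lambda>N. centered_sq g {- int N..int N} k \<omega>) \<longlonglongrightarrow> (Y k \<omega>)\<^sup>2 - D"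
      using that lim by (intro AE_finite_allI) auto
    then show ?thesis by eventually_elim (intro tendsto_sum, auto)
  qed
  have block: "(\<integral>\<^sup>+\<omega>. ennreal (\<bar>\<Sum>k\<in>{a<..a + int m}. (Y k \<omega>)\<^sup>2 - D\<bar> powr p) \<partial>M)
      \<le> ennreal (C * real m powr (max 1 (p * \<beta>2)))" for a m
    by (rule nn_integral_powr_limit_le[OF _ _ C(2) limB]) (use p in auto)
  have mean: "integrable M (\<lambda>\<omega>. (Y k \<omega>)\<^sup>2 - D) \<and> expectation (\<lambda>\<omega>. (Y k \<omega>)\<^sup>2 - D) = 0" for k
  proof -
    \<comment> \<open>A block of length one turns the block bound into a moment bound at a single
      time, uniform in N, from which the mean of the limit is identified.\<close>
    have "{k - 1<..k - 1 + int 1} = {k}" by auto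
    then have le: "(\<integral>\<^sup>+\<omega>. ennreal (\<bar>centered_sq g {- int N..int N} k \<omega>\<bar> powr p) \<partial>M) \<le> ennreal C" for N
      using C(2)[of "{- int N..int N}" "k - 1" 1] by simp
    show ?thesis
      using expectation_abs_powr_limit_zero[OF _ _ p(1) C(1) le lim centered_sq_mean] by auto
  qed
  have "integrable M (\<lambda>\<omega>. (Y k \<omega>)\<^sup>2) \<and> expectation (\<lambda>\<omega>. (Y k \<omega>)\<^sup>2) = D" for k
  proof -
    have i: "integrable M (\<lambda>\<omega>. (Y k \<omega>)\<^sup>2)"
      using Bochner_Integration.integrable_add[OF conjunct1[OF mean[of k]] integrable_const[of D]] by simp
    then show ?thesis using mean[of k] by (simp add: prob_space)
  qed
  moreover have "AE \<omega> in M. \<exists>K. \<forall>n. \<bar>\<Sum>k=1..n. (Y (int k) \<omega>)\<^sup>2 - D\<bar> \<le> K * real n powr \<beta>"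
  proof (rule AE_partial_sums_bound)
    show "max 1 (p * \<beta>2) < p * \<beta>" using \<beta> b p by auto
    show "(\<integral>\<^sup>+\<omega>. ennreal (\<bar>\<Sum>k\<in>{a<..a + m}. (Y (int k) \<omega>)\<^sup>2 - D\<bar> powr p) \<partial>M)
      \<le> ennreal (C * real m powr (max 1 (p * \<beta>2)))" for a m
    proof -
      have "(\<Sum>k\<in>{int a<..int a + int m}. (Y k \<omega>)\<^sup>2 - D) = (\<Sum>k\<in>{a<..a + m}. (Y (int k) \<omega>)\<^sup>2 - D)" for \<omega>
        by (rule sum.reindex_bij_witness[of _ int nat]) auto
      then show ?thesis using block[of "int a" m] by simp
    qed
  qed (use p C in auto)
  ultimately show ?thesis by blast
qed

end

section \<open>Vector-valued processes, and moments from tail bounds\<close>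

lemma norm_adjoint_le:
  fixes f :: "'a::euclidean_space \<Rightarrow> 'b::euclidean_space"
  assumes "linear f"
  shows "norm (adjoint f v) \<le> onorm f * norm v"
proof (cases "adjoint f v = 0")
  case False
  have "norm (adjoint f v) * norm (adjoint f v) = f (adjoint f v) \<bullet> v"
    using adjoint_works[OF assms, of "adjoint f v" v] by (simp add: power2_norm_eq_inner flip: power2_eq_square)
  also have "\<dots> \<le> norm (f (adjoint f v)) * norm v" by (rule norm_cauchy_schwarz)
  also have "\<dots> \<le> (onorm f * norm (adjoint f v)) * norm v"
    by (intro mult_right_mono onorm linear_conv_bounded_linear[THEN iffD1] assms) auto
  finally have "norm (adjoint f v) * norm (adjoint f v) \<le> (onorm f * norm v) * norm (adjoint f v)"
    by (simp add: mult_ac)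
  then show ?thesis using False by simp
qed (use assms in \<open>auto intro!: mult_nonneg_nonneg onorm_pos_le simp: linear_conv_bounded_linear\<close>)

text \<open>Where 2^j < X <= 2^(j+1), the power is at most 2^((j+1)p); the tail bound makes the
  resulting sum over j geometric with ratio 2^(p - \<alpha>) < 1.\<close>

lemma (in prob_space) integrable_powr_of_tail:
  fixes X :: "'a \<Rightarrow> real"
  assumes [measurable]: "X \<in> borel_measurable M" and X: "\<And>\<omega>. 0 \<le> X \<omega>"
    and p: "0 < p" "p < \<alpha>" and K: "0 \<le> K"
    and tail: "\<And>t. 0 \<le> t \<Longrightarrow> t powr \<alpha> * prob {\<omega> \<in> space M. t < X \<omega>} \<le> K"
  shows "integrable M (\<lambda>\<omega>. X \<omega> powr p)"
proof (rule integrableI_nonneg)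
  define r where "r = 2 powr (p - \<alpha>)"
  have r: "0 < r" "r < 1" using p by (auto simp: r_def powr_less_one)
  let ?A = "\<lambda>j::nat. {\<omega> \<in> space M. 2 ^ j < X \<omega>}"
  have term_le: "f j \<le> (\<Sum>j. f j)" for f :: "nat \<Rightarrow> ennreal" and j
    using sum_le_suminf[of f "{j}"] by (simp add: summableI)
  have pw: "ennreal (X \<omega> powr p) \<le> 1 + (\<Sum>j. ennreal ((2 ^ Suc j) powr p) * indicator (?A j) \<omega>)"
    if "\<omega> \<in> space M" for \<omega>
  proof (cases "X \<omega> \<le> 1")
    case True
    then have "X \<omega> powr p \<le> 1" using X p powr_mono2[of p "X \<omega>" 1] by simp
    then have "ennreal (X \<omega> powr p) \<le> 1" by (simp flip: ennreal_1 add: ennreal_leI)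
    then show ?thesis by (simp add: add_increasing2)
  next
    case False
    obtain n0 :: nat where "X \<omega> < 2 ^ n0" using real_arch_pow[of 2 "X \<omega>"] by auto
    define n where "n = (LEAST n::nat. X \<omega> \<le> 2 ^ n)"
    have n: "X \<omega> \<le> 2 ^ n" unfolding n_def by (rule LeastI[of _ n0]) (use \<open>X \<omega> < 2 ^ n0\<close> in simp)
    then obtain j where j: "n = Suc j" using False by (cases n) auto
    have "\<not> X \<omega> \<le> 2 ^ j" using not_less_Least[of j "\<lambda>n. X \<omega> \<le> 2 ^ n"] j by (simp add: n_def)
    then have ind: "indicator (?A j) \<omega> = (1::ennreal)" using that by simp
    have "ennreal (X \<omega> powr p) \<le> ennreal ((2 ^ Suc j) powr p)"
      using n X p unfolding j by (intro ennreal_leI powr_mono2) auto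
    also have "\<dots> = ennreal ((2 ^ Suc j) powr p) * indicator (?A j) \<omega>" unfolding ind by simp
    also have "\<dots> \<le> (\<Sum>j. ennreal ((2 ^ Suc j) powr p) * indicator (?A j) \<omega>)"
      by (rule term_le)
    finally show ?thesis by (simp add: add_increasing)
  qed
  have "(\<integral>\<^sup>+\<omega>. ennreal (X \<omega> powr p) \<partial>M)
      \<le> (\<integral>\<^sup>+\<omega>. 1 + (\<Sum>j. ennreal ((2 ^ Suc j) powr p) * indicator (?A j) \<omega>) \<partial>M)"
    by (rule nn_integral_mono) (rule pw)
  also have "\<dots> = 1 + (\<Sum>j. ennreal ((2 ^ Suc j) powr p) * emeasure M (?A j))"
    by (simp add: nn_integral_add nn_integral_suminf nn_integral_cmult emeasure_space_1)
  also have "\<dots> \<le> 1 + (\<Sum>j. ennreal (2 powr p * K * r ^ j))"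
  proof (intro add_left_mono suminf_le summableI)
    fix j
    have "(2 ^ j) powr \<alpha> * prob (?A j) \<le> K" by (rule tail) simp
    then have pr: "prob (?A j) \<le> K * (2 ^ j) powr (-\<alpha>)" by (simp add: powr_minus field_simps)
    have "(2 ^ Suc j) powr p * prob (?A j) \<le> (2 ^ Suc j) powr p * (K * (2 ^ j) powr (-\<alpha>))"
      by (intro mult_left_mono pr) auto
    also have "\<dots> = 2 powr p * K * ((2 ^ j) powr p * (2 ^ j) powr (-\<alpha>))"
      by (simp add: powr_mult)
    also have "(2 ^ j) powr p * (2 ^ j) powr (-\<alpha>) = r ^ j"
      unfolding powr_add[symmetric] r_def
      by (simp add: powr_realpow[symmetric] powr_powr mult.commute)
    finally show "ennreal ((2 ^ Suc j) powr p) * emeasure M (?A j) \<le> ennreal (2 powr p * K * r ^ j)"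
      unfolding emeasure_eq_measure by (simp add: ennreal_mult[symmetric] ennreal_leI)
  qed
  also have "\<dots> < \<infinity>"
  proof -
    have "(\<Sum>j. ennreal (2 powr p * K * r ^ j)) = ennreal (\<Sum>j. 2 powr p * K * r ^ j)"
      using K r by (intro suminf_ennreal2 summable_mult summable_geometric) auto
    then show ?thesis by simp
  qed
  finally show "(\<integral>\<^sup>+\<omega>. ennreal (X \<omega> powr p) \<partial>M) < \<infinity>" .
qed auto

context iid_innovations begin

text \<open>A direction v is moved onto the coefficients: the inner product of v with the process is
  a scalar linear process with coefficients \<open>adjoint (C l) v\<close>, which decay like the
  operator norms of C l. The directions used are u + w and u - w.\<close>

lemma vector_process_lln:
  fixes C :: "int \<Rightarrow> 'm \<Rightarrow> 'v::euclidean_space" and X :: "int \<Rightarrow> 'a \<Rightarrow> 'v" and \<sigma> \<beta> K :: real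
  assumes lin: "\<And>l. linear (C l)"
    and C: "\<And>l. onorm (C l) \<le> K * (1 + \<bar>real_of_int l\<bar>) powr (-\<sigma>)" and K: "0 \<le> K"
    and \<sigma>: "1/2 < \<sigma>" and \<beta>: "1/2 < \<beta>" "\<beta> < 1" "2 - 2 * \<sigma> < \<beta>" "1 < p * \<beta>"
    and X[measurable]: "\<And>k. X k \<in> borel_measurable M"
    and conv: "\<And>k. AE \<omega> in M. (\<lambda>N. \<Sum>l\<in>{- int N..int N}. C (k - l) (\<Xi> l \<omega>)) \<longlonglongrightarrow> X k \<omega>"
  shows "\<exists>D. (\<forall>k. integrable M (\<lambda>\<omega>. (u \<bullet> X k \<omega>) * (w \<bullet> X k \<omega>)) \<and>
        expectation (\<lambda>\<omega>. (u \<bullet> X k \<omega>) * (w \<bullet> X k \<omega>)) = D) \<and>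
    (AE \<omega> in M. \<exists>K. \<forall>n. \<bar>\<Sum>k=1..n. (u \<bullet> X (int k) \<omega>) * (w \<bullet> X (int k) \<omega>) - D\<bar> \<le> K * real n powr \<beta>)"
proof -
  have sq: "\<exists>D. (\<forall>k. integrable M (\<lambda>\<omega>. (v \<bullet> X k \<omega>)\<^sup>2) \<and> expectation (\<lambda>\<omega>. (v \<bullet> X k \<omega>)\<^sup>2) = D) \<and>
    (AE \<omega> in M. \<exists>K. \<forall>n. \<bar>\<Sum>k=1..n. (v \<bullet> X (int k) \<omega>)\<^sup>2 - D\<bar> \<le> K * real n powr \<beta>)" for v
  proof (rule quadratic_process_lln[where g="\<lambda>l. adjoint (C l) v" and K="K * norm v" and \<sigma>=\<sigma>])
    show "norm (adjoint (C l) v) \<le> K * norm v * (1 + \<bar>real_of_int l\<bar>) powr (-\<sigma>)" for l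
    proof -
      have "norm (adjoint (C l) v) \<le> onorm (C l) * norm v" by (rule norm_adjoint_le[OF lin])
      also have "\<dots> \<le> (K * (1 + \<bar>real_of_int l\<bar>) powr (-\<sigma>)) * norm v" by (intro mult_right_mono C) auto
      finally show ?thesis by (simp add: mult_ac)
    qed
    show "AE \<omega> in M. (\<lambda>N. lin (\<lambda>k l. adjoint (C (k - l)) v) {- int N..int N} k \<omega>) \<longlonglongrightarrow> v \<bullet> X k \<omega>" for k
      using conv[of k]
    proof eventually_elim
      case (elim \<omega>)
      have "lin (\<lambda>k l. adjoint (C (k - l)) v) {- int N..int N} k \<omega>
          = v \<bullet> (\<Sum>l\<in>{- int N..int N}. C (k - l) (\<Xi> l \<omega>))" for N
        unfolding lin_def inner_sum_right by (intro sum.cong refl adjoint_clauses lin)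
      then show ?case by (simp only:) (intro tendsto_intros elim)
    qed
  qed (use K \<sigma> \<beta> in auto)
  obtain D1 where D1: "\<And>k. integrable M (\<lambda>\<omega>. ((u + w) \<bullet> X k \<omega>)\<^sup>2)"
      "\<And>k. expectation (\<lambda>\<omega>. ((u + w) \<bullet> X k \<omega>)\<^sup>2) = D1"
      "AE \<omega> in M. \<exists>K. \<forall>n. \<bar>\<Sum>k=1..n. ((u + w) \<bullet> X (int k) \<omega>)\<^sup>2 - D1\<bar> \<le> K * real n powr \<beta>"
    using sq[of "u + w"] by blast
  obtain D2 where D2: "\<And>k. integrable M (\<lambda>\<omega>. ((u - w) \<bullet> X k \<omega>)\<^sup>2)"
      "\<And>k. expectation (\<lambda>\<omega>. ((u - w) \<bullet> X k \<omega>)\<^sup>2) = D2"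
      "AE \<omega> in M. \<exists>K. \<forall>n. \<bar>\<Sum>k=1..n. ((u - w) \<bullet> X (int k) \<omega>)\<^sup>2 - D2\<bar> \<le> K * real n powr \<beta>"
    using sq[of "u - w"] by blast
  have polar: "(u \<bullet> z) * (w \<bullet> z) = (1/4) * ((u + w) \<bullet> z)\<^sup>2 - (1/4) * ((u - w) \<bullet> z)\<^sup>2" for z
    by (simp add: inner_add_left inner_diff_left power2_eq_square algebra_simps)
  have "AE \<omega> in M. \<exists>K. \<forall>n. \<bar>\<Sum>k=1..n. (u \<bullet> X (int k) \<omega>) * (w \<bullet> X (int k) \<omega>) - (D1 / 4 - D2 / 4)\<bar>
      \<le> K * real n powr \<beta>"
    using D1(3) D2(3)
  proof eventually_elim
    case (elim \<omega>)
    then obtain K1 K2 where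
      K1: "\<And>n. \<bar>\<Sum>k=1..n. ((u + w) \<bullet> X (int k) \<omega>)\<^sup>2 - D1\<bar> \<le> K1 * real n powr \<beta>" and
      K2: "\<And>n. \<bar>\<Sum>k=1..n. ((u - w) \<bullet> X (int k) \<omega>)\<^sup>2 - D2\<bar> \<le> K2 * real n powr \<beta>" by blast
    have "\<bar>\<Sum>k=1..n. (u \<bullet> X (int k) \<omega>) * (w \<bullet> X (int k) \<omega>) - (D1 / 4 - D2 / 4)\<bar>
      \<le> (K1 + K2) * real n powr \<beta>" for n
    proof -
      have "(\<Sum>k=1..n. (u \<bullet> X (int k) \<omega>) * (w \<bullet> X (int k) \<omega>) - (D1 / 4 - D2 / 4))
        = (\<Sum>k=1..n. (1/4) * (((u + w) \<bullet> X (int k) \<omega>)\<^sup>2 - D1) - (1/4) * (((u - w) \<bullet> X (int k) \<omega>)\<^sup>2 - D2))"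
        unfolding polar by (intro sum.cong refl) (simp add: algebra_simps)
      also have "\<dots> = (1/4) * (\<Sum>k=1..n. ((u + w) \<bullet> X (int k) \<omega>)\<^sup>2 - D1)
          - (1/4) * (\<Sum>k=1..n. ((u - w) \<bullet> X (int k) \<omega>)\<^sup>2 - D2)"
        unfolding sum_distrib_left sum_subtractf[symmetric] ..
      finally show ?thesis using K1[of n] K2[of n] unfolding distrib_right by linarith
    qed
    then show ?case by blast
  qed
  moreover have "integrable M (\<lambda>\<omega>. (u \<bullet> X k \<omega>) * (w \<bullet> X k \<omega>)) \<and>
      expectation (\<lambda>\<omega>. (u \<bullet> X k \<omega>) * (w \<bullet> X k \<omega>)) = D1 / 4 - D2 / 4" for k
    unfolding polar using D1(1,2)[of k] D2(1,2)[of k] by simp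
  ultimately show ?thesis by blast
qed

end

section \<open>Convergence rate\<close>

lemma stack_measurable:
  fixes x :: "'a \<Rightarrow> real ^ 'd" and y :: "'a \<Rightarrow> real"
  assumes x: "x \<in> borel_measurable M" and y: "y \<in> borel_measurable M"
  shows "(\<lambda>\<omega>. stack (x \<omega>) (y \<omega>)) \<in> borel_measurable M"
proof -
  have c: "(\<lambda>\<omega>. stack (x \<omega>) (y \<omega>) $ i) \<in> borel_measurable M" for i
  proof (cases i)
    case (Inl a)
    have "(\<lambda>\<omega>. x \<omega> \<bullet> axis a 1) \<in> borel_measurable M" using x by measurable
    then show ?thesis by (simp add: stack_def Inl inner_axis)
  qed (use y in \<open>simp add: stack_def\<close>)
  have "(\<lambda>\<omega>. stack (x \<omega>) (y \<omega>) \<bullet> v) \<in> borel_measurable M" for v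
    unfolding inner_vec_def using c by measurable
  then show ?thesis by (subst borel_measurable_euclidean_space) auto
qed

lemma integrable_vecI:
  fixes f :: "'a \<Rightarrow> 'b::euclidean_space ^ 'n"
  assumes "\<And>i. integrable M (\<lambda>\<omega>. f \<omega> $ i)"
  shows "integrable M f"
proof -
  have bl: "bounded_linear (axis i :: 'b \<Rightarrow> 'b ^ 'n)" for i
    unfolding linear_conv_bounded_linear[symmetric] by (rule linearI) (auto simp: vec_eq_iff axis_def)
  have "v = (\<Sum>i\<in>UNIV. axis i (v $ i))" for v :: "'b ^ 'n"
    by (simp add: vec_eq_iff axis_def)
  then have "f = (\<lambda>\<omega>. \<Sum>i\<in>UNIV. axis i (f \<omega> $ i))" by auto
  moreover have "integrable M (\<lambda>\<omega>. \<Sum>i\<in>UNIV. axis i (f \<omega> $ i))"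
    by (intro Bochner_Integration.integrable_sum integrable_bounded_linear[OF bl] assms)
  ultimately show ?thesis by metis
qed

lemma bilateral_sum_symmetric:
  assumes "has_bilateral_sum f s"
  shows "(\<lambda>N. \<Sum>l\<in>{- int N..int N}. f l) \<longlonglongrightarrow> s"
proof -
  have "((\<lambda>(p, q). \<Sum>l = - int p..int q. f l) \<longlongrightarrow> s) (sequentially \<times>\<^sub>F sequentially)"
    using assms by (simp add: has_bilateral_sum_def)
  from filterlim_compose[OF this, of "\<lambda>N. (N, N)" sequentially] show ?thesis
    by (simp add: filterlim_Pair filterlim_ident)
qed

text \<open>The decay hypothesis says nothing about C 0, which therefore enters the constant
  separately. For l \<noteq> 0 one has 1 + |l| <= 2 |l|, and 2^\<sigma> <= 2.\<close>

lemma onorm_decay: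
  fixes C :: "int \<Rightarrow> real ^ 'm ^ 'n"
  assumes \<sigma>: "0 < \<sigma>" "\<sigma> \<le> 1"
    and decay: "bdd_above (range (\<lambda>l::int. \<bar>real_of_int l\<bar> powr \<sigma> * onorm ((*v) (C l))))"
  shows "\<exists>K\<ge>0. \<forall>l. onorm ((*v) (C l)) \<le> K * (1 + \<bar>real_of_int l\<bar>) powr (-\<sigma>)"
proof -
  have on: "0 \<le> onorm ((*v) (C l))" for l by (rule onorm_pos_le[OF matrix_vector_mul_bounded_linear])
  obtain K0 where K0: "\<And>l::int. \<bar>real_of_int l\<bar> powr \<sigma> * onorm ((*v) (C l)) \<le> K0"
    using decay unfolding bdd_above_def by blast
  \<comment> \<open>\<open>0 powr \<sigma>\<close> is 0, so the bound at l = 0 reads 0 <=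
    K0.\<close>
  have K00: "0 \<le> K0" using K0[of 0] by simp
  define K where "K = 2 * K0 + onorm ((*v) (C 0))"
  have "onorm ((*v) (C l)) \<le> K * (1 + \<bar>real_of_int l\<bar>) powr (-\<sigma>)" for l
  proof (cases "l = 0")
    case True
    then show ?thesis using K00 by (simp add: K_def)
  next
    case False
    define q where "q = 1 + \<bar>real_of_int l\<bar>"
    have q: "0 < q" by (simp add: q_def)
    have "q powr \<sigma> \<le> (2 * \<bar>real_of_int l\<bar>) powr \<sigma>"
      unfolding q_def using False \<sigma> by (intro powr_mono2) auto
    also have "\<dots> = 2 powr \<sigma> * \<bar>real_of_int l\<bar> powr \<sigma>" by (simp add: powr_mult)
    also have "\<dots> \<le> 2 powr 1 * \<bar>real_of_int l\<bar> powr \<sigma>" using \<sigma> by (intro mult_right_mono powr_mono) auto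
    finally have "q powr \<sigma> * onorm ((*v) (C l)) \<le> 2 * \<bar>real_of_int l\<bar> powr \<sigma> * onorm ((*v) (C l))"
      using on by (simp add: mult_right_mono)
    also have "\<dots> \<le> K" using K0[of l] on[of 0] by (simp add: K_def mult.assoc)
    finally show ?thesis using q unfolding q_def[symmetric] by (simp add: powr_minus field_simps)
  qed
  moreover have "0 \<le> K" using K00 on by (simp add: K_def)
  ultimately show ?thesis by blast
qed

lemma (in prob_space) iid_innovations_of_tail:
  fixes \<Xi> :: "int \<Rightarrow> 'a \<Rightarrow> 'm::euclidean_space"
  assumes indep: "indep_vars (\<lambda>_. borel) \<Xi> UNIV"
    and ident: "\<And>l l'. distr M borel (\<Xi> l) = distr M borel (\<Xi> l')"
    and zero_mean: "\<And>l. has_bochner_integral M (\<Xi> l) 0"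
    and tail: "bdd_above ((\<lambda>t. t powr \<alpha> * prob {\<omega> \<in> space M. (norm (\<Xi> 1 \<omega>))\<^sup>2 > t}) ` {0..})"
    and p: "1 < p" "p < \<alpha>" "\<alpha> < 2"
  shows "\<exists>s sp. iid_innovations M \<Xi> s p sp"
proof -
  have \<Xi>m[measurable]: "\<Xi> l \<in> borel_measurable M" for l
    using zero_mean[of l] by (auto simp: has_bochner_integral_iff)
  obtain K0 where K0: "\<And>t. 0 \<le> t \<Longrightarrow> t powr \<alpha> * prob {\<omega> \<in> space M. (norm (\<Xi> 1 \<omega>))\<^sup>2 > t} \<le> K0"
    using tail unfolding bdd_above_def by auto
  have "0 \<le> K0" using K0[of 0] by simp
  have int1: "integrable M (\<lambda>\<omega>. ((norm (\<Xi> 1 \<omega>))\<^sup>2) powr p)"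
    by (rule integrable_powr_of_tail[OF _ _ _ p(2) \<open>0 \<le> K0\<close> K0]) (use p in auto)
  have "integrable M (\<lambda>\<omega>. \<bar>(norm (\<Xi> 1 \<omega>))\<^sup>2\<bar> powr 1)"
    by (rule integrable_abs_powr_mono[of _ p]) (use p int1 in auto)
  then have int2: "integrable M (\<lambda>\<omega>. (norm (\<Xi> 1 \<omega>))\<^sup>2)" by simp
  \<comment> \<open>The tail bound concerns index 1 only; its moments pass to every l through the
    common law.\<close>
  have transfer: "integrable M (\<lambda>\<omega>. f (\<Xi> l \<omega>)) \<longleftrightarrow> integrable M (\<lambda>\<omega>. f (\<Xi> 1 \<omega>))"
      "expectation (\<lambda>\<omega>. f (\<Xi> l \<omega>)) = expectation (\<lambda>\<omega>. f (\<Xi> 1 \<omega>))"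
    if [measurable]: "f \<in> borel_measurable borel" for f :: "'m \<Rightarrow> real" and l
    using ident[of l 1] integrable_distr_eq[OF \<Xi>m that, of l] integrable_distr_eq[OF \<Xi>m that, of 1]
      integral_distr[OF \<Xi>m that, of l] integral_distr[OF \<Xi>m that, of 1] by auto
  have m1: "(\<lambda>x::'m. (norm x)\<^sup>2) \<in> borel_measurable borel"
    and m2: "(\<lambda>x::'m. ((norm x)\<^sup>2) powr p) \<in> borel_measurable borel" by measurable
  have "iid_innovations M \<Xi> (expectation (\<lambda>\<omega>. (norm (\<Xi> 1 \<omega>))\<^sup>2)) p
      (expectation (\<lambda>\<omega>. ((norm (\<Xi> 1 \<omega>))\<^sup>2) powr p))"
    by unfold_locales
       (use indep zero_mean ident p int1 int2 transfer[OF m1] transfer[OF m2] in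
         \<open>auto simp: has_bochner_integral_iff\<close>)
  then show ?thesis by blast
qed

theorem theorem2:
  fixes M :: "'w measure"
    and \<Xi> :: "int \<Rightarrow> 'w \<Rightarrow> real ^ 'm"
    and x :: "int \<Rightarrow> 'w \<Rightarrow> real ^ 'd"
    and y :: "int \<Rightarrow> 'w \<Rightarrow> real"
    and C :: "int \<Rightarrow> real ^ 'm ^ ('d + 1)"
    and A\<^sub>s :: "int \<Rightarrow> 'w \<Rightarrow> real ^ 'd ^ 'd"
    and b\<^sub>s :: "int \<Rightarrow> 'w \<Rightarrow> real ^ 'd"
    and A :: "real ^ 'd ^ 'd"
    and b h :: "real ^ 'd"
    and hbar :: "nat \<Rightarrow> 'w \<Rightarrow> real ^ 'd"
    and chi \<alpha> \<sigma> \<gamma> :: real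
    and j :: int
  assumes "prob_space M"
    and chi_range: "0 < chi" "chi < 1"
    and indep: "prob_space.indep_vars M (\<lambda>_. borel) \<Xi> UNIV"
    and ident: "\<And>l l'. distr M borel (\<Xi> l) = distr M borel (\<Xi> l')"
    and zero_mean: "\<And>l. has_bochner_integral M (\<Xi> l) 0"
    and alpha: "1 < \<alpha>" "\<alpha> < 2"
    and tail: "bdd_above ((\<lambda>t. t powr \<alpha> * measure M {\<omega> \<in> space M. (norm (\<Xi> 1 \<omega>))\<^sup>2 > t}) ` {0..})"
    and sigma: "1/2 < \<sigma>" "\<sigma> \<le> 1"
    and decay: "bdd_above (range (\<lambda>l::int. \<bar>real_of_int l\<bar> powr \<sigma> * onorm ((*v) (C l))))"
    and x_meas: "\<And>k. x k \<in> borel_measurable M"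
    and y_meas: "\<And>k. y k \<in> borel_measurable M"
    and series: "\<And>k. AE \<omega> in M.
                   has_bilateral_sum (\<lambda>l. C (k - l) *v \<Xi> l \<omega>) (stack (x k \<omega>) (y (k + 1) \<omega>))"
    and A\<^sub>s: "\<And>k \<omega>. A\<^sub>s k \<omega> = outer_prod (x k \<omega>) (x k \<omega>)"
    and b\<^sub>s: "\<And>k \<omega>. b\<^sub>s k \<omega> = y (k + 1) \<omega> *\<^sub>R x k \<omega>"
    and A: "A = (\<integral>\<omega>. outer_prod (x j \<omega>) (x j \<omega>) \<partial>M)"
    and b: "b = (\<integral>\<omega>. y (j + 1) \<omega> *\<^sub>R x j \<omega> \<partial>M)"
    and "positive_definite A"
    and h: "h = matrix_inv A *v b"
    and recursion: "\<And>k::nat. k \<ge> 1 \<Longrightarrow> AE \<omega> in M.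
          hbar (k + 1) \<omega> =
            hbar k \<omega> + (1 / real k powr chi) *\<^sub>R (b\<^sub>s (int k) \<omega> - A\<^sub>s (int k) \<omega> *v hbar k \<omega>)"
    and "0 \<le> \<gamma>"
    and "\<gamma> < min (chi - 1 / \<alpha>) (chi + 2 * \<sigma> - 2)"
  shows "AE \<omega> in M. (\<lambda>n. norm (hbar n \<omega> - h)) \<in> o(\<lambda>n. real n powr (- \<gamma>))"
proof -
  interpret prob_space M by fact
  define \<beta>0 where "\<beta>0 = max (1 / \<alpha>) (2 - 2 * \<sigma>)"
  \<comment> \<open>The midpoint between the threshold and chi - \<gamma>. Strictness below serves
    the moment bounds, strictness above turns O into o at the end.\<close>
  define \<beta> where "\<beta> = (\<beta>0 + (chi - \<gamma>)) / 2"
  have "1 / 2 < 1 / \<alpha>" using alpha by (simp add: field_simps)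
  moreover have "\<beta>0 < chi - \<gamma>" using \<open>\<gamma> < min _ _\<close> by (auto simp: \<beta>0_def)
  moreover have "1 / \<alpha> \<le> \<beta>0" "2 - 2 * \<sigma> \<le> \<beta>0" by (auto simp: \<beta>0_def)
  ultimately have \<beta>: "1 / \<alpha> < \<beta>" "1/2 < \<beta>" "2 - 2 * \<sigma> < \<beta>" "\<beta> < chi - \<gamma>" "\<beta> < chi" "\<beta> < 1"
    using \<open>0 \<le> \<gamma>\<close> chi_range by (auto simp: \<beta>_def)
  \<comment> \<open>p has to stay below \<alpha> for the moments to exist and above 1/\<beta> for
    the chaining; the window is nonempty because 1/\<alpha> < \<beta>.\<close>
  define p where "p = (1 / \<beta> + \<alpha>) / 2"
  have "1 / \<beta> < \<alpha>" "1 < 1 / \<beta>" using \<beta> alpha by (auto simp: field_simps)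
  then have p: "1 < p" "p < \<alpha>" "1 / \<beta> < p" by (auto simp: p_def)
  then have p\<beta>: "1 < p * \<beta>" using \<beta> by (simp add: field_simps)
  obtain s sp where "iid_innovations M \<Xi> s p sp"
    using iid_innovations_of_tail[OF indep ident zero_mean tail p(1,2) alpha(2)] by blast
  then interpret iid_innovations M \<Xi> s p sp .
  obtain K where K: "0 \<le> K" "\<And>l. onorm ((*v) (C l)) \<le> K * (1 + \<bar>real_of_int l\<bar>) powr (-\<sigma>)"
    using onorm_decay[OF _ sigma(2) decay] sigma(1) by auto
  \<comment> \<open>The entries of A_k and b_k, and y_(k+1)^2 too, are products of two coordinates
    of this single linear process.\<close>
  define X where "X = (\<lambda>k \<omega>. stack (x k \<omega>) (y (k + 1) \<omega>))"
  have Xm: "X k \<in> borel_measurable M" for k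
    unfolding X_def by (rule stack_measurable[OF x_meas y_meas])
  have conv: "AE \<omega> in M. (\<lambda>N. \<Sum>l\<in>{- int N..int N}. C (k - l) *v \<Xi> l \<omega>) \<longlonglongrightarrow> X k \<omega>" for k
    using series[of k] unfolding X_def by eventually_elim (rule bilateral_sum_symmetric)
  \<comment> \<open>The limit constant is the same for all k, so it may be evaluated at the time j
    that defines A and b.\<close>
  have lln: "(\<forall>k. integrable M (\<lambda>\<omega>. X k \<omega> $ i * X k \<omega> $ i')) \<and>
      (AE \<omega> in M. \<exists>K. \<forall>n. \<bar>\<Sum>k=1..n. X (int k) \<omega> $ i * X (int k) \<omega> $ i' -
         expectation (\<lambda>\<omega>. X j \<omega> $ i * X j \<omega> $ i')\<bar> \<le> K * real n powr \<beta>)" for i i'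
    using vector_process_lln[OF matrix_vector_mul_linear K(2,1) sigma(1) \<beta>(2,6,3) p\<beta> Xm conv,
        of "axis i 1" "axis i' 1"]
    by (auto simp: inner_axis')
  define E where "E = (\<lambda>i i'. expectation (\<lambda>\<omega>. X j \<omega> $ i * X j \<omega> $ i'))"
  have int: "integrable M (\<lambda>\<omega>. X j \<omega> $ i * X j \<omega> $ i')" for i i' using lln by blast
  have X_Inl: "X k \<omega> $ Inl i = x k \<omega> $ i" and X_Inr: "X k \<omega> $ Inr u = y (k + 1) \<omega>" for k \<omega> i u
    by (simp_all add: X_def stack_def)
  have A_entry: "A $ i $ i' = E (Inl i) (Inl i')" for i i'
  proof -
    \<comment> \<open>The integral of a non-integrable function is 0 by convention, so the whole
      matrix is shown to be integrable before an entry is taken out of the integral.\<close>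
    have "integrable M (\<lambda>\<omega>. x j \<omega> $ a * x j \<omega> $ a')" for a a'
      using int[of "Inl a" "Inl a'"] by (simp only: X_Inl)
    then have i: "integrable M (\<lambda>\<omega>. outer_prod (x j \<omega>) (x j \<omega>))"
      by (intro integrable_vecI) (simp add: outer_prod_def)
    have "bounded_linear (\<lambda>B :: real^'d^'d. B $ i $ i')"
      by (rule bounded_linear_compose[OF bounded_linear_vec_nth bounded_linear_vec_nth])
    from integral_bounded_linear[OF this i]
    have "A $ i $ i' = expectation (\<lambda>\<omega>. outer_prod (x j \<omega>) (x j \<omega>) $ i $ i')"
      by (simp only: A)
    then show ?thesis by (simp add: E_def X_Inl outer_prod_def)
  qed
  have b_entry: "b $ i = E (Inr 1) (Inl i)" for i
  proof -
    have "integrable M (\<lambda>\<omega>. y (j + 1) \<omega> * x j \<omega> $ a)" for a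
      using int[of "Inr 1" "Inl a"] by (simp only: X_Inl X_Inr)
    then have i: "integrable M (\<lambda>\<omega>. y (j + 1) \<omega> *\<^sub>R x j \<omega>)"
      by (intro integrable_vecI) simp
    have "bounded_linear (\<lambda>v :: real^'d. v $ i)" by (rule bounded_linear_vec_nth)
    from integral_bounded_linear[OF this i]
    have "b $ i = expectation (\<lambda>\<omega>. (y (j + 1) \<omega> *\<^sub>R x j \<omega>) $ i)"
      by (simp only: b)
    then show ?thesis by (simp add: E_def X_Inl X_Inr)
  qed
  have Ah: "A *v h = b" unfolding h by (rule positive_definite_matrix_inv_mult) fact
  \<comment> \<open>Finitely many pairs of coordinates and countably many k: one null set suffices,
    and from here on the argument is pathwise.\<close>
  have "AE \<omega> in M. \<forall>i\<in>UNIV. \<forall>i'\<in>UNIV. \<exists>K. \<forall>n. \<bar>\<Sum>k=1..n. X (int k) \<omega> $ i * X (int k) \<omega> $ i' - E i i'\<bar>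
      \<le> K * real n powr \<beta>"
    using lln unfolding E_def by (intro AE_finite_allI) auto
  moreover have "AE \<omega> in M. \<forall>k::nat. 1 \<le> k \<longrightarrow> hbar (k + 1) \<omega> =
            hbar k \<omega> + (1 / real k powr chi) *\<^sub>R (b\<^sub>s (int k) \<omega> - A\<^sub>s (int k) \<omega> *v hbar k \<omega>)"
    unfolding AE_all_countable using recursion by auto
  ultimately show ?thesis
  proof eventually_elim
    case (elim \<omega>)
    define Kf where "Kf = (\<lambda>i i'. SOME K. \<forall>n. \<bar>\<Sum>k=1..n. X (int k) \<omega> $ i * X (int k) \<omega> $ i' - E i i'\<bar>
      \<le> K * real n powr \<beta>)"
    have Kf: "\<bar>\<Sum>k=1..n. X (int k) \<omega> $ i * X (int k) \<omega> $ i' - E i i'\<bar> \<le> Kf i i' * real n powr \<beta>" for i i' n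
    proof -
      have "\<exists>K. \<forall>n. \<bar>\<Sum>k=1..n. X (int k) \<omega> $ i * X (int k) \<omega> $ i' - E i i'\<bar> \<le> K * real n powr \<beta>"
        using elim(1) by blast
      from someI_ex[OF this] show ?thesis unfolding Kf_def by blast
    qed
    \<comment> \<open>The constants depend on \<omega> and on the pair of coordinates; the sum of
      their absolute values serves all pairs at once.\<close>
    define K1 where "K1 = (\<Sum>i\<in>UNIV. \<Sum>i'\<in>UNIV. \<bar>Kf i i'\<bar>)"
    have K1: "Kf i i' \<le> K1" for i i'
    proof -
      have "Kf i i' \<le> \<bar>Kf i i'\<bar>" by simp
      also have "\<dots> \<le> (\<Sum>i'\<in>UNIV. \<bar>Kf i i'\<bar>)" by (rule member_le_sum) auto
      also have "\<dots> \<le> K1" unfolding K1_def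
        by (rule member_le_sum[of i UNIV "\<lambda>i. \<Sum>i'\<in>UNIV. \<bar>Kf i i'\<bar>"]) (auto intro: sum_nonneg)
      finally show ?thesis .
    qed
    have bound: "\<bar>\<Sum>k=1..n. X (int k) \<omega> $ i * X (int k) \<omega> $ i' - E i i'\<bar> \<le> K1 * real n powr \<beta>" for i i' n
      by (rule order_trans[OF Kf]) (intro mult_right_mono K1, simp)
    have "\<exists>c. eventually (\<lambda>k. norm (hbar k \<omega> - h) \<le> c * real k powr (\<beta> - chi)) sequentially"
    proof (rule least_squares_recursion_rate[where x="\<lambda>k. x (int k) \<omega>" and y="\<lambda>k. y (int k + 1) \<omega>"
          and K=K1 and yy="E (Inr 1) (Inr 1)", OF _ \<beta>(5) chi_range(2) \<open>positive_definite A\<close> Ah])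
      show "0 \<le> K1" unfolding K1_def by (intro sum_nonneg) auto
      show "0 \<le> E (Inr 1) (Inr 1)" unfolding E_def by (intro integral_nonneg_AE) auto
      show "\<bar>\<Sum>k=1..n. x (int k) \<omega> $ i * x (int k) \<omega> $ i' - A $ i $ i'\<bar> \<le> K1 * real n powr \<beta>" for i i' n
        using bound[of "Inl i" "Inl i'" n] by (simp add: X_Inl A_entry)
      show "\<bar>\<Sum>k=1..n. y (int k + 1) \<omega> * x (int k) \<omega> $ i - b $ i\<bar> \<le> K1 * real n powr \<beta>" for i n
        using bound[of "Inr 1" "Inl i" n] by (simp add: X_Inl X_Inr b_entry)
      show "\<bar>\<Sum>k=1..n. (y (int k + 1) \<omega>)\<^sup>2 - E (Inr 1) (Inr 1)\<bar> \<le> K1 * real n powr \<beta>" for n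
        using bound[of "Inr 1" "Inr 1" n] by (simp add: X_Inr power2_eq_square)
      show "hbar (Suc k) \<omega> = hbar k \<omega> + real k powr - chi *\<^sub>R
          (y (int k + 1) \<omega> *\<^sub>R x (int k) \<omega> - outer_prod (x (int k) \<omega>) (x (int k) \<omega>) *v hbar k \<omega>)"
        if "1 \<le> k" for k
        using elim(2) that by (simp add: A\<^sub>s b\<^sub>s powr_minus_divide)
    qed (use \<beta> in auto)
    then obtain c where c: "eventually (\<lambda>k. norm (hbar k \<omega> - h) \<le> c * real k powr (\<beta> - chi)) sequentially" ..
    have "(\<lambda>n. norm (hbar n \<omega> - h)) \<in> O(\<lambda>n. real n powr (\<beta> - chi))"
      by (rule bigoI[of _ c]) (use c in simp)
    also have "(\<lambda>n. real n powr (\<beta> - chi)) \<in> o(\<lambda>n. real n powr (- \<gamma>))"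
      using \<beta>(4) by (subst powr_smallo_iff) (auto intro: filterlim_real_sequentially)
    finally show ?case .
  qed
qed

end
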